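(* Let $\nu\in\mathbb{C}\setminus(1+2\mathbb{Z})$. There is a bijective linear map $A^\nu_{-\omega}(\mathrm{PSL}_2(\mathbb{Z}))\to\Psi_{\mathrm{mod}}(\nu)$, $\alpha\mapsto\psi_\alpha$.
   Context: Let $G=\mathrm{PSL}_2(\mathbb{R})$, elements written by representatives $\begin{pmatrix}a&b\\c&d\end{pmatrix}\in\mathrm{SL}_2(\mathbb{R})$, acting on $\mathbb{P}^1(\mathbb{C})$ by $g\cdot\tau=\frac{a\tau+b}{c\tau+d}$. Let $T=\mathbb{P}^1(\mathbb{R})=\mathbb{R}\cup\{\infty\}$, the common boundary of the upper half plane $\mathfrak{H}^+$ and the lower half plane $\mathfrak{H}^-$. A hyperfunction on an open set $U\subset T$ is an element of $\mathcal{O}(W\setminus U)/\mathcal{O}(W)$, where $W$ is an open neighborhood of $U$ in $\mathbb{P}^1(\mathbb{C})$ and $\mathcal{O}$ denotes holomorphic functions (this does not depend on $W$); a holomorphic function on $W\setminus U$ representing it is a representative. For $\nu\in\mathbb{C}$ let $M^\nu_{-\omega}$ be the space of hyperfunctions on $T$ with the action of $G$ defined on representatives by $(\pi_\nu(g)h)(\tau)=\Big(\frac{1+\tau^2}{(c\tau-a)^2+(d\tau-b)^2}\Big)^{(1+\nu)/2}h\Big(\frac{d\tau-b}{-c\tau+a}\Big)$ for $g=\begin{pmatrix}a&b\\c&d\end{pmatrix}$, where the power is the branch that is positive on $T$, continued holomorphically to a neighborhood of $T$. For a subgroup $\Gamma\subset G$, $A^\nu_{-\omega}(\Gamma)=\{\alpha\in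 M^\nu_{-\omega}:\pi_\nu(\gamma)\alpha=\alpha\ \forall\gamma\in\Gamma\}$ (automorphic hyperfunctions). $\Psi_{\mathrm{mod}}(\nu)$ is the space of holomorphic functions $\psi:\mathbb{C}\setminus(-\infty,0]\to\mathbb{C}$ such that $\psi(\tau)=\psi(\tau+1)+(\tau+1)^{-\nu-1}\psi\big(\frac{\tau}{\tau+1}\big)$ and such that both limits in $\lim_{\mathrm{Im}\tau\to\infty}\big(\psi(\tau)+\tau^{-1-\nu}\psi(-1/\tau)\big)+\lim_{\mathrm{Im}\tau\to-\infty}\big(\psi(\tau)+\tau^{-1-\nu}\psi(-1/\tau)\big)=0$ exist and the equality holds; powers use the principal branch of $\log$ on $\mathbb{C}\setminus(-\infty,0]$. *)

theory Defs
  imports "HOL-Complex_Analysis.Complex_Analysis"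
begin

text \<open>P^1(C) is modelled by the affine coordinate tau in C, the point infinity being
  handled through neighbourhoods of the form {z. R < norm z} and the chart w = 1/tau.
  T = P^1(R) corresponds to the real axis together with infinity.\<close>

text \<open>V (affine part of) an open neighbourhood W of T in P^1(C).\<close>
definition nbhdT :: "complex set \<Rightarrow> bool" where
  "nbhdT V \<longleftrightarrow> open V \<and> (\<real> :: complex set) \<subseteq> V \<and> (\<exists>R. {z. R < norm z} \<subseteq> V)"

text \<open>g is holomorphic on W (including the point infinity, via the chart w = 1/tau).\<close>
definition holo_sphere :: "(complex \<Rightarrow> complex) \<Rightarrow> complex set \<Rightarrow> bool" where
  "holo_sphere g V \<longleftrightarrow> g holomorphic_on V \<and>
     (\<exists>c r. r > 0 \<and> (\<lambda>w. if w = 0 then c else g (1 / w)) holomorphic_on ball 0 r)"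

definition hf_rep :: "(complex \<Rightarrow> complex) \<Rightarrow> bool" where
  "hf_rep h \<longleftrightarrow> (\<exists>V. nbhdT V \<and> h holomorphic_on (V - \<real>))"

definition hf_equiv :: "(complex \<Rightarrow> complex) \<Rightarrow> (complex \<Rightarrow> complex) \<Rightarrow> bool" where
  "hf_equiv h1 h2 \<longleftrightarrow> hf_rep h1 \<and> hf_rep h2 \<and>
     (\<exists>V g. nbhdT V \<and> holo_sphere g V \<and> (\<forall>z \<in> V - \<real>. h1 z - h2 z = g z))"

definition hf_class :: "(complex \<Rightarrow> complex) \<Rightarrow> (complex \<Rightarrow> complex) set" where
  "hf_class h = {h'. hf_equiv h h'}"

definition hyperfunctions :: "(complex \<Rightarrow> complex) set set" where
  "hyperfunctions = hf_class ` {h. hf_rep h}"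

definition hf_add :: "(complex \<Rightarrow> complex) set \<Rightarrow> (complex \<Rightarrow> complex) set \<Rightarrow> (complex \<Rightarrow> complex) set" where
  "hf_add \<alpha> \<beta> = {h. \<exists>f\<in>\<alpha>. \<exists>g\<in>\<beta>. hf_equiv (\<lambda>z. f z + g z) h}"

definition hf_scale :: "complex \<Rightarrow> (complex \<Rightarrow> complex) set \<Rightarrow> (complex \<Rightarrow> complex) set" where
  "hf_scale c \<alpha> = {h. \<exists>f\<in>\<alpha>. hf_equiv (\<lambda>z. c * f z) h}"

text \<open>Elements of PSL_2(R) given by representatives (a,b,c,d) with ad - bc = 1.\<close>
definition PSL2R :: "(real \<times> real \<times> real \<times> real) set" where
  "PSL2R = {(a,b,c,d). a * d - b * c = 1}"

definition PSL2Z :: "(real \<times> real \<times> real \<times> real) set" where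
  "PSL2Z = {(a,b,c,d). a \<in> \<int> \<and> b \<in> \<int> \<and> c \<in> \<int> \<and> d \<in> \<int> \<and> a * d - b * c = 1}"

text \<open>The action pi_nu on representatives; the power is the principal branch, which is
  positive on T and holomorphic on a neighbourhood of T.\<close>
definition pi_rep :: "complex \<Rightarrow> real \<times> real \<times> real \<times> real \<Rightarrow> (complex \<Rightarrow> complex) \<Rightarrow> complex \<Rightarrow> complex" where
  "pi_rep \<nu> g h \<tau> = (case g of (a, b, c, d) \<Rightarrow>
     ((1 + \<tau>^2) / ((of_real c * \<tau> - of_real a)^2 + (of_real d * \<tau> - of_real b)^2)) powr ((1 + \<nu>) / 2)
       * h ((of_real d * \<tau> - of_real b) / (- of_real c * \<tau> + of_real a)))"

definition pi_hf :: "complex \<Rightarrow> real \<times> real \<times> real \<times> real \<Rightarrow> (complex \<Rightarrow> complex) set \<Rightarrow> (complex \<Rightarrow> complex) set" where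
  "pi_hf \<nu> g \<alpha> = {h'. \<exists>h\<in>\<alpha>. hf_equiv (pi_rep \<nu> g h) h'}"

definition automorphic :: "complex \<Rightarrow> (real \<times> real \<times> real \<times> real) set \<Rightarrow> (complex \<Rightarrow> complex) set set" where
  "automorphic \<nu> \<Gamma> = {\<alpha> \<in> hyperfunctions. \<forall>\<gamma>\<in>\<Gamma>. pi_hf \<nu> \<gamma> \<alpha> = \<alpha>}"

definition slit :: "complex set" where
  "slit = UNIV - complex_of_real ` {..0}"

text \<open>Psi_mod(nu); functions are taken extensional (zero outside the slit plane).\<close>
definition Psi_mod :: "complex \<Rightarrow> (complex \<Rightarrow> complex) set" where
  "Psi_mod \<nu> = {\<psi>. \<psi> holomorphic_on slit \<and> (\<forall>z. z \<notin> slit \<longrightarrow> \<psi> z = 0) \<and>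
     (\<forall>\<tau>\<in>slit. \<psi> \<tau> = \<psi> (\<tau> + 1) + (\<tau> + 1) powr (- \<nu> - 1) * \<psi> (\<tau> / (\<tau> + 1))) \<and>
     (\<exists>L1 L2.
        ((\<lambda>\<tau>. \<psi> \<tau> + \<tau> powr (-1 - \<nu>) * \<psi> (- 1 / \<tau>)) \<longlongrightarrow> L1) (filtercomap Im at_top) \<and>
        ((\<lambda>\<tau>. \<psi> \<tau> + \<tau> powr (-1 - \<nu>) * \<psi> (- 1 / \<tau>)) \<longlongrightarrow> L2) (filtercomap Im at_bot) \<and>
        L1 + L2 = 0)}"

end

theory Submission
  imports Defs "HOL-Real_Asymp.Real_Asymp"
begin

text \<open>
  On the real line write a hyperfunction as \<open>h = (1 + \<tau>\<^sup>2) powr ((1 + \<nu>) / 2) * f\<close>; then \<open>\<pi>\<^sub>\<nu>\<close> becomes the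
  weight \<open>1 + \<nu>\<close> action on \<open>f\<close>. Invariance under \<open>\<tau> \<mapsto> \<tau> + 1\<close> allows \<open>f\<close> to be chosen 1-periodic and
  holomorphic off the real line with limits at \<open>\<plusminus>i\<infinity>\<close>, uniquely up to a constant, which the
  condition on the two limits fixes because \<open>\<nu>\<close> is not an odd integer. The period function is
  \<open>\<psi>(\<tau>) = f(\<tau>) - \<tau> powr (-1-\<nu>) * f(-1/\<tau>)\<close>: invariance under \<open>\<tau> \<mapsto> -1/\<tau>\<close> says that it extends across
  the positive axis, and periodicity gives the three-term equation. Conversely
  \<open>\<psi>(\<tau>) + \<tau> powr (-1-\<nu>) * \<psi>(-1/\<tau>)\<close> is \<open>1 + exp (-i\<pi>\<nu>)\<close> (upper half plane) or \<open>1 + exp (i\<pi>\<nu>)\<close> (lower half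
  plane) times \<open>f(\<tau>)\<close>, so \<open>\<psi>\<close> determines \<open>f\<close>. Both the passage to a periodic \<open>f\<close> and the glueing of the
  hyperfunction from \<open>f\<close> and \<open>f(-1/\<tau>)\<close> are additive Cousin problems, solved by Cauchy integrals over
  small squares and circles.
\<close>

subsection \<open>Germs along the real line\<close>

text \<open>The point at infinity shapes the proof. The principal branch of \<open>cfac\<close> is
  good near every finite real point but in general does not continue over infinity, so the weight
  picture lives on the finite line. Invariance under \<open>mS\<close>, which exchanges 0 and
  infinity, supplies the rest: equality at infinity is equality at 0. Translation, seen at infinity
  in the coordinate v = -1/\<tau>, is the parabolic map v -> v / (1 + v) fixing 0, and the
  three-term equation collapses its defect to \<psi>(v + 1), for which v = 0 is an interior point of
  the domain. The factors in front of f come from the principal branch: \<tau> and -1/\<tau> lie in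
  the same half plane, their logarithms add up to i \<pi> or -i \<pi>, and the weighted inversion
  applied twice therefore multiplies by -exp(-i \<pi> \<nu>) or -exp(i \<pi> \<nu>). Both factors
  vanish exactly when \<nu> is an odd integer. Everything is phrased by germs off the real line.
  Values of a representative on the line are arbitrary, and equality in the quotient becomes a
  pointwise condition, which allows representatives to be glued by cases.\<close>

abbreviation at_nonreal :: "complex \<Rightarrow> complex filter" where
  "at_nonreal x \<equiv> at x within -\<real>"

text \<open>A single analytic germ \<open>g\<close> must match \<open>u\<close> on both sides of the
  line. For a difference of two representatives this says that they define the same hyperfunction
  near \<open>x\<close>, whatever values they take on the line itself.\<close>

definition ext_at :: "(complex \<Rightarrow> complex) \<Rightarrow> complex \<Rightarrow> bool" where
  "ext_at u x \<longleftrightarrow> (\<exists>g. g analytic_on {x} \<and> (\<forall>\<^sub>F z in at_nonreal x. u z = g z))"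

lemma ext_atI:
  "g analytic_on {x} \<Longrightarrow> (\<forall>\<^sub>F z in at_nonreal x. u z = g z) \<Longrightarrow> ext_at u x"
  by (auto simp: ext_at_def)

lemma ext_at_analytic: "u analytic_on {x} \<Longrightarrow> ext_at u x"
  by (rule ext_atI) auto

lemma ext_at_cong:
  assumes "\<forall>\<^sub>F z in at_nonreal x. u z = v z"
  shows "ext_at u x \<longleftrightarrow> ext_at v x"
proof -
  have "ext_at a x" if ab: "ext_at b x" "\<forall>\<^sub>F z in at_nonreal x. a z = b z" for a b
  proof -
    obtain g where g: "g analytic_on {x}" "\<forall>\<^sub>F z in at_nonreal x. b z = g z"
      using ab(1) by (auto simp: ext_at_def)
    have "\<forall>\<^sub>F z in at_nonreal x. a z = g z"
      using ab(2) g(2) by eventually_elim simp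
    then show ?thesis using g(1) by (rule ext_atI[rotated])
  qed
  moreover have "\<forall>\<^sub>F z in at_nonreal x. v z = u z"
    using assms by eventually_elim simp
  ultimately show ?thesis using assms by blast
qed

lemma ext_at_add:
  assumes "ext_at u x" "ext_at v x"
  shows "ext_at (\<lambda>z. u z + v z) x"
proof -
  from assms obtain a b where ab: "a analytic_on {x}" "b analytic_on {x}"
    "\<forall>\<^sub>F z in at_nonreal x. u z = a z" "\<forall>\<^sub>F z in at_nonreal x. v z = b z"
    by (auto simp: ext_at_def)
  show ?thesis
    by (rule ext_atI[of "\<lambda>z. a z + b z"]) (use ab in \<open>auto intro!: analytic_intros elim: eventually_elim2\<close>)
qed

lemma ext_at_mult:
  assumes "ext_at u x" "ext_at v x"
  shows "ext_at (\<lambda>z. u z * v z) x"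
proof -
  from assms obtain a b where ab: "a analytic_on {x}" "b analytic_on {x}"
    "\<forall>\<^sub>F z in at_nonreal x. u z = a z" "\<forall>\<^sub>F z in at_nonreal x. v z = b z"
    by (auto simp: ext_at_def)
  show ?thesis
    by (rule ext_atI[of "\<lambda>z. a z * b z"]) (use ab in \<open>auto intro!: analytic_intros elim: eventually_elim2\<close>)
qed

lemma ext_at_minus: "ext_at u x \<Longrightarrow> ext_at (\<lambda>z. - u z) x"
  using ext_at_mult[of "\<lambda>_. -1" x u] by (simp add: ext_at_analytic)

lemma ext_at_diff: "ext_at u x \<Longrightarrow> ext_at v x \<Longrightarrow> ext_at (\<lambda>z. u z - v z) x"
  using ext_at_add[of u x "\<lambda>z. - v z"] ext_at_minus[of v x] by simp

lemma ext_at_0 [simp]: "ext_at (\<lambda>_. 0) x"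
  by (simp add: ext_at_analytic)

lemma at_within_nonreal_nontrivial:
  assumes "x \<in> \<real>"
  shows "at_nonreal x \<noteq> (bot :: complex filter)"
proof -
  have "x islimpt (-\<real>)"
    unfolding islimpt_approachable
  proof safe
    fix e :: real assume "e > 0"
    have "Im x = 0" using assms by (simp add: complex_is_Real_iff)
    then have "x + \<i> * of_real (e/2) \<in> -\<real>" "x + \<i> * of_real (e/2) \<noteq> x" "dist (x + \<i> * of_real (e/2)) x < e"
      using \<open>e > 0\<close> by (auto simp: complex_is_Real_iff dist_norm norm_mult)
    then show "\<exists>x'\<in>-\<real>. x' \<noteq> x \<and> dist x' x < e" by blast
  qed
  then show ?thesis by (simp add: trivial_limit_within)
qed

lemma isCont_eq_nonreal:
  fixes a b :: "complex \<Rightarrow> complex"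
  assumes "x \<in> \<real>" "isCont a x" "isCont b x" "\<forall>\<^sub>F z in at_nonreal x. a z = b z"
  shows "a x = b x"
proof -
  have "(a \<longlongrightarrow> a x) (at_nonreal x)" "(b \<longlongrightarrow> b x) (at_nonreal x)"
    using assms(2,3) by (auto simp: isCont_def intro: tendsto_within_subset)
  moreover have "(a \<longlongrightarrow> b x) (at_nonreal x)"
    using calculation(2) assms(4) by (simp add: tendsto_cong)
  ultimately show ?thesis
    using tendsto_unique at_within_nonreal_nontrivial[OF assms(1)] by blast
qed

lemma isCont_eq_nonreal':
  fixes a b :: "complex \<Rightarrow> complex"
  assumes "x \<in> \<real>" "isCont a x" "isCont b x" "\<forall>\<^sub>F z in nhds x. z \<notin> \<real> \<longrightarrow> a z = b z"
  shows "a x = b x"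
  by (rule isCont_eq_nonreal) (use assms in \<open>auto simp: eventually_at_filter elim: eventually_mono\<close>)

lemma eventually_nonreal_nhds:
  assumes "x \<in> \<real>"
  shows "(\<forall>\<^sub>F z in at_nonreal x. P z) \<longleftrightarrow> (\<forall>\<^sub>F z in nhds x. z \<notin> \<real> \<longrightarrow> P z)"
  unfolding eventually_at_filter
  by (rule eventually_cong[OF always_eventually]) (use assms in auto)

lemma filterlim_nonreal:
  assumes "isCont \<phi> x" "x \<in> \<real>" "\<phi> x \<in> \<real>" "\<And>z. z \<notin> \<real> \<Longrightarrow> \<phi> z \<notin> \<real>"
  shows "filterlim \<phi> (at_nonreal (\<phi> x)) (at_nonreal x)"
  unfolding filterlim_at
proof
  show "(\<phi> \<longlongrightarrow> \<phi> x) (at_nonreal x)"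
    using assms(1) by (auto simp: isCont_def intro: tendsto_within_subset)
  show "\<forall>\<^sub>F z in at_nonreal x. \<phi> z \<in> - \<real> \<and> \<phi> z \<noteq> \<phi> x"
    unfolding eventually_nonreal_nhds[OF assms(2)]
    by (rule always_eventually) (use assms(3,4) in \<open>metis ComplI\<close>)
qed

lemma analytic_at_compose:
  assumes "\<phi> analytic_on {x}" "g analytic_on {\<phi> x}"
  shows "(\<lambda>z. g (\<phi> z)) analytic_on {x}"
  using analytic_on_compose[of \<phi> "{x}" g] assms by (simp add: o_def)

lemma ext_at_compose:
  assumes "ext_at u (\<phi> x)" "\<phi> analytic_on {x}" "x \<in> \<real>" "\<phi> x \<in> \<real>" "\<And>z. z \<notin> \<real> \<Longrightarrow> \<phi> z \<notin> \<real>"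
  shows "ext_at (\<lambda>z. u (\<phi> z)) x"
proof -
  obtain g where g: "g analytic_on {\<phi> x}" "\<forall>\<^sub>F z in at_nonreal (\<phi> x). u z = g z"
    using assms(1) by (auto simp: ext_at_def)
  have "filterlim \<phi> (at_nonreal (\<phi> x)) (at_nonreal x)"
    by (intro filterlim_nonreal analytic_at_imp_isCont) (use assms in auto)
  then have "\<forall>\<^sub>F z in at_nonreal x. u (\<phi> z) = g (\<phi> z)"
    using g(2) by (rule eventually_compose_filterlim[rotated])
  then show ?thesis
    using analytic_at_compose[OF assms(2) g(1)] by (rule ext_atI[rotated])
qed

lemma analytic_eventually_nhds:
  assumes "g analytic_on {x}"
  shows "\<forall>\<^sub>F z in nhds x. g analytic_on {z}"
proof -
  obtain s where "open s" "x \<in> s" "g holomorphic_on s" using assms analytic_at by blast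
  then show ?thesis unfolding eventually_nhds
    by (metis analytic_at)
qed

lemma analytic_on_cong_nhds:
  assumes "\<forall>\<^sub>F z in nhds x. f z = g z"
  shows "f analytic_on {x} \<longleftrightarrow> g analytic_on {x}"
  using analytic_at_cong[of f g x x] assms by auto

text \<open>The pointwise form of being a representative. Only points off the line are tested, so
  jumps across it are permitted.\<close>

definition hol_near :: "(complex \<Rightarrow> complex) \<Rightarrow> complex \<Rightarrow> bool" where
  "hol_near h x \<longleftrightarrow> (\<forall>\<^sub>F z in at_nonreal x. h analytic_on {z})"

lemma ext_at_imp_hol_near:
  assumes "ext_at u x" "x \<in> \<real>"
  shows "hol_near u x"
proof -
  obtain g where g: "g analytic_on {x}" "\<forall>\<^sub>F z in at_nonreal x. u z = g z"
    using assms by (auto simp: ext_at_def)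
  then have "\<forall>\<^sub>F z in nhds x. z \<notin> \<real> \<longrightarrow> u z = g z"
    by (simp add: eventually_nonreal_nhds[OF assms(2)])
  \<comment> \<open>Analyticity at a nearby point \<open>y\<close> needs the equality on a whole
    neighbourhood of \<open>y\<close>, hence the nested filter.\<close>
  then have "\<forall>\<^sub>F y in nhds x. \<forall>\<^sub>F z in nhds y. z \<notin> \<real> \<longrightarrow> u z = g z"
    by (simp add: eventually_eventually)
  with analytic_eventually_nhds[OF g(1)]
  have "\<forall>\<^sub>F y in nhds x. y \<notin> \<real> \<longrightarrow> u analytic_on {y}"
  proof eventually_elim
    case (elim y)
    show ?case
    proof
      assume "y \<notin> \<real>"
      then have "\<forall>\<^sub>F z in nhds y. z \<in> -\<real>"
        by (intro eventually_nhds_in_open) (auto simp: open_Compl closed_complex_Reals)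
      then have "\<forall>\<^sub>F z in nhds y. u z = g z" using elim(2) by eventually_elim auto
      then show "u analytic_on {y}" using elim(1) analytic_on_cong_nhds by blast
    qed
  qed
  then show ?thesis by (simp add: hol_near_def eventually_nonreal_nhds[OF assms(2)])
qed

lemma hol_near_add: "hol_near u x \<Longrightarrow> hol_near v x \<Longrightarrow> hol_near (\<lambda>z. u z + v z) x"
  unfolding hol_near_def by (erule (1) eventually_elim2) (auto intro!: analytic_intros)

lemma hol_near_mult: "hol_near u x \<Longrightarrow> hol_near v x \<Longrightarrow> hol_near (\<lambda>z. u z * v z) x"
  unfolding hol_near_def by (erule (1) eventually_elim2) (auto intro!: analytic_intros)

lemma hol_near_compose:
  assumes "hol_near u (\<phi> x)" "\<phi> analytic_on {x}" "x \<in> \<real>" "\<phi> x \<in> \<real>" "\<And>z. z \<notin> \<real> \<Longrightarrow> \<phi> z \<notin> \<real>"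
  shows "hol_near (\<lambda>z. u (\<phi> z)) x"
proof -
  have "filterlim \<phi> (at_nonreal (\<phi> x)) (at_nonreal x)"
    by (intro filterlim_nonreal analytic_at_imp_isCont) (use assms in auto)
  then have "\<forall>\<^sub>F z in at_nonreal x. u analytic_on {\<phi> z}"
    using assms(1) unfolding hol_near_def by (rule eventually_compose_filterlim[rotated])
  moreover have "\<forall>\<^sub>F z in at_nonreal x. \<phi> analytic_on {z}"
    using analytic_eventually_nhds[OF assms(2)] by (simp add: eventually_at_filter eventually_mono)
  ultimately show ?thesis unfolding hol_near_def
    by eventually_elim (rule analytic_at_compose)
qed

lemma hol_near_diff: "hol_near u x \<Longrightarrow> hol_near v x \<Longrightarrow> hol_near (\<lambda>z. u z - v z) x"
  unfolding hol_near_def by (erule (1) eventually_elim2) (auto intro!: analytic_intros)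

subsection \<open>Local description of hyperfunctions on the circle\<close>

lemma nonreal_divide [simp]: "1 / z \<in> \<real> \<longleftrightarrow> z \<in> \<real>" for z :: complex
  by (metis Reals_1 Reals_divide divide_divide_eq_right div_by_1 mult_1)

lemma nonreal_inverse [simp]: "inverse z \<in> \<real> \<longleftrightarrow> z \<in> \<real>" for z :: complex
  using nonreal_divide[of z] by (simp add: divide_inverse)

lemma nonreal_uminus [simp]: "- z \<in> \<real> \<longleftrightarrow> z \<in> \<real>" for z :: complex
  by (rule Reals_minus_iff)

text \<open>Locality of representatives: the interior of the set where nothing goes wrong is itself
  the neighbourhood of the circle, so no covering has to be chosen. The chart w = 1/\<tau> turns the
  germ condition at 0 into a condition on a full exterior region.\<close>

lemma hf_rep_iff:
  "hf_rep h \<longleftrightarrow> (\<forall>x\<in>\<real>. hol_near h x) \<and> hol_near (\<lambda>w. h (1/w)) 0"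
proof
  assume "hf_rep h"
  then obtain V R where V: "open V" "\<real> \<subseteq> V" "{z. R < norm z} \<subseteq> V" "h holomorphic_on (V - \<real>)"
    unfolding hf_rep_def nbhdT_def by blast
  have an: "h analytic_on {z}" if "z \<in> V" "z \<notin> \<real>" for z
    using V that by (metis DiffI analytic_at closed_complex_Reals open_Diff)
  have "hol_near h x" if "x \<in> \<real>" for x
  proof -
    have "\<forall>\<^sub>F z in nhds x. z \<in> V" using V that by (intro eventually_nhds_in_open) auto
    then show ?thesis unfolding hol_near_def eventually_nonreal_nhds[OF that]
      by eventually_elim (use an in auto)
  qed
  moreover have "hol_near (\<lambda>w. h (1/w)) 0"
  proof -
    have "filterlim (\<lambda>w::complex. 1/w) at_infinity (at 0)"
      using filterlim_inverse_at_infinity by (simp add: divide_inverse)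
    then have "\<forall>\<^sub>F w in at 0. R < norm (1 / w :: complex)"
      unfolding filterlim_at_infinity_conv_norm_at_top
      by (auto simp: filterlim_at_top_dense norm_divide)
    then have "\<forall>\<^sub>F w in at_nonreal (0::complex). R < norm (1 / w)"
      using at_le[of "-\<real>" UNIV "0::complex"] filter_leD by blast
    moreover have "\<forall>\<^sub>F w in at_nonreal (0::complex). w \<in> -\<real>"
      by (simp add: eventually_at_filter)
    ultimately show ?thesis unfolding hol_near_def
    proof eventually_elim
      case (elim w)
      then have "h analytic_on {1/w}" using an[of "1/w"] V by auto
      then show ?case using elim
        by - (rule analytic_at_compose[of "\<lambda>w. 1/w" w h], auto intro!: analytic_intros)
    qed
  qed
  ultimately show "(\<forall>x\<in>\<real>. hol_near h x) \<and> hol_near (\<lambda>w. h (1/w)) 0" by blast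
next
  assume a: "(\<forall>x\<in>\<real>. hol_near h x) \<and> hol_near (\<lambda>w. h (1/w)) 0"
  define A where "A = {z. z \<notin> \<real> \<longrightarrow> h analytic_on {z}}"
  have int: "x \<in> interior A" if "x \<in> \<real>" for x
  proof -
    have "\<forall>\<^sub>F z in nhds x. z \<in> A"
      using a that eventually_nonreal_nhds[OF that] unfolding hol_near_def A_def by auto
    then show ?thesis unfolding eventually_nhds interior_def by blast
  qed
  have "\<forall>\<^sub>F w in nhds 0. w \<notin> \<real> \<longrightarrow> (\<lambda>w. h (1/w)) analytic_on {w}"
    using a unfolding hol_near_def by (subst (asm) eventually_nonreal_nhds) auto
  then obtain r where r: "r > 0" "\<And>w. norm w < r \<Longrightarrow> w \<notin> \<real> \<Longrightarrow> (\<lambda>w. h (1/w)) analytic_on {w}"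
    by (auto simp: eventually_nhds_metric dist_norm)
  have "z \<in> A" if "norm z > 1/r" for z
  proof -
    have "h analytic_on {z}" if "z \<notin> \<real>"
    proof -
      have "z \<noteq> 0" using that by auto
      have "norm (1/z) < r" using \<open>norm z > 1/r\<close> r(1) \<open>z \<noteq> 0\<close> by (simp add: norm_divide field_simps)
      then have "(\<lambda>w. h (1/w)) analytic_on {1/z}" using r that by auto
      then have "(\<lambda>z. h (1/(1/z))) analytic_on {z}"
        using \<open>z \<noteq> 0\<close> by - (rule analytic_at_compose[of "\<lambda>w. 1/w" _ "\<lambda>w. h (1/w)"], auto intro!: analytic_intros)
      then show ?thesis by simp
    qed
    then show ?thesis by (simp add: A_def)
  qed
  moreover have "open {z::complex. 1/r < norm z}"
    by (intro open_Collect_less continuous_intros)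
  ultimately have "{z. 1/r < norm z} \<subseteq> interior A"
    by (intro interior_maximal) auto
  then have "nbhdT (interior A)" unfolding nbhdT_def using int by auto
  moreover have "h holomorphic_on (interior A - \<real>)"
  proof -
    have "h analytic_on (interior A - \<real>)"
      unfolding analytic_on_analytic_at[of h "interior A - \<real>"]
      using interior_subset[of A] by (auto simp: A_def)
    then show ?thesis using analytic_imp_holomorphic by blast
  qed
  ultimately show "hf_rep h" unfolding hf_rep_def by blast
qed

text \<open>Filling in the boundary values turns local extensions across the real line into a global one.\<close>

definition real_fill :: "(complex \<Rightarrow> complex) \<Rightarrow> complex \<Rightarrow> complex" where
  "real_fill u z = (if z \<in> \<real> then Lim (at_nonreal z) u else u z)"

lemma real_fill_nonreal [simp]: "z \<notin> \<real> \<Longrightarrow> real_fill u z = u z"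
  by (simp add: real_fill_def)

lemma real_fill_analytic:
  assumes "ext_at u x" "x \<in> \<real>"
  shows "real_fill u analytic_on {x}"
proof -
  obtain g where g: "g analytic_on {x}" "\<forall>\<^sub>F z in at_nonreal x. u z = g z"
    using assms by (auto simp: ext_at_def)
  then have "\<forall>\<^sub>F z in nhds x. z \<notin> \<real> \<longrightarrow> u z = g z"
    by (simp add: eventually_nonreal_nhds[OF assms(2)])
  \<comment> \<open>The condition is moved to all \<open>y\<close> near \<open>x\<close>: the
    boundary value defining \<open>real_fill\<close> has to equal \<open>g\<close> at every real
    point nearby, not only at \<open>x\<close>.\<close>
  then have "\<forall>\<^sub>F y in nhds x. \<forall>\<^sub>F z in nhds y. z \<notin> \<real> \<longrightarrow> u z = g z"
    by (simp add: eventually_eventually)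
  with analytic_eventually_nhds[OF g(1)]
  have "\<forall>\<^sub>F y in nhds x. real_fill u y = g y"
  proof eventually_elim
    case (elim y)
    show ?case
    proof (cases "y \<in> \<real>")
      case True
      have "(g \<longlongrightarrow> g y) (at_nonreal y)"
        using analytic_at_imp_isCont[OF elim(1)] by (auto simp: isCont_def intro: tendsto_within_subset)
      moreover have "\<forall>\<^sub>F z in at_nonreal y. u z = g z"
        using elim(2) by (simp add: eventually_nonreal_nhds[OF True])
      ultimately have "(u \<longlongrightarrow> g y) (at_nonreal y)"
        by (simp add: tendsto_cong)
      then have "Lim (at_nonreal y) u = g y"
        using at_within_nonreal_nontrivial[OF True] by (intro tendsto_Lim) auto
      then show ?thesis using True by (simp add: real_fill_def)
    next
      case False
      then show ?thesis using eventually_nhds_x_imp_x[OF elim(2)] by simp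
    qed
  qed
  then show ?thesis using g(1) analytic_on_cong_nhds by blast
qed

lemma real_fill_analytic':
  assumes "u analytic_on {x}" "x \<notin> \<real>"
  shows "real_fill u analytic_on {x}"
proof -
  have "\<forall>\<^sub>F z in nhds x. z \<in> -\<real>" using assms
    by (intro eventually_nhds_in_open) (auto simp: open_Compl closed_complex_Reals)
  then have "\<forall>\<^sub>F z in nhds x. real_fill u z = u z" by eventually_elim auto
  then show ?thesis using assms(1) analytic_on_cong_nhds by blast
qed

text \<open>Local extensions agree off the line with the difference of the representatives, and
  \<open>real_fill\<close> glues them to one function on the whole neighbourhood. From here on
  equality of hyperfunctions is checked point by point.\<close>

lemma hf_equiv_iff:
  "hf_equiv h1 h2 \<longleftrightarrow> hf_rep h1 \<and> hf_rep h2 \<and> (\<forall>x\<in>\<real>. ext_at (\<lambda>z. h1 z - h2 z) x)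
     \<and> ext_at (\<lambda>w. h1 (1/w) - h2 (1/w)) 0"
proof (intro iffI conjI)
  assume eq: "hf_equiv h1 h2"
  then show "hf_rep h1" "hf_rep h2" by (auto simp: hf_equiv_def)
  from eq obtain V R g c r where V: "open V" "\<real> \<subseteq> V" "{z. R < norm z} \<subseteq> V"
    "g holomorphic_on V" "r > 0" "(\<lambda>w. if w = 0 then c else g (1 / w)) holomorphic_on ball 0 r"
    "\<And>z. z \<in> V \<Longrightarrow> z \<notin> \<real> \<Longrightarrow> h1 z - h2 z = g z"
    unfolding hf_equiv_def nbhdT_def holo_sphere_def by blast
  show "\<forall>x\<in>\<real>. ext_at (\<lambda>z. h1 z - h2 z) x"
  proof
    fix x :: complex assume x: "x \<in> \<real>"
    have "\<forall>\<^sub>F z in nhds x. z \<in> V" using V x by (intro eventually_nhds_in_open) auto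
    then have "\<forall>\<^sub>F z in at_nonreal x. h1 z - h2 z = g z" unfolding eventually_nonreal_nhds[OF x]
      by eventually_elim (use V in auto)
    moreover have "g analytic_on {x}" using V x analytic_at by blast
    ultimately show "ext_at (\<lambda>z. h1 z - h2 z) x" by (rule ext_atI[rotated])
  qed
  define G where "G = (\<lambda>w. if w = 0 then c else g (1 / w))"
  have "G analytic_on {0}" using V(5,6) unfolding G_def analytic_at_ball by blast
  moreover have "\<forall>\<^sub>F w in at_nonreal 0. h1 (1/w) - h2 (1/w) = G w"
  proof -
    have "filterlim (\<lambda>w::complex. 1/w) at_infinity (at 0)"
      using filterlim_inverse_at_infinity by (simp add: divide_inverse)
    then have "\<forall>\<^sub>F w in at 0. R < norm (1 / w :: complex)"
      unfolding filterlim_at_infinity_conv_norm_at_top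
      by (auto simp: filterlim_at_top_dense norm_divide)
    then have "\<forall>\<^sub>F w in at_nonreal (0::complex). R < norm (1 / w)"
      using at_le[of "-\<real>" UNIV "0::complex"] filter_leD by blast
    moreover have "\<forall>\<^sub>F w in at_nonreal (0::complex). w \<in> -\<real>"
      by (simp add: eventually_at_filter)
    ultimately show ?thesis
    proof eventually_elim
      case (elim w)
      then have "1/w \<in> V" "1/w \<notin> \<real>" using V(3) by (auto simp del: nonreal_inverse)
      then show ?case using V(7)[of "1/w"] elim by (auto simp: G_def)
    qed
  qed
  ultimately show "ext_at (\<lambda>w. h1 (1/w) - h2 (1/w)) 0" by (rule ext_atI)
next
  assume a: "hf_rep h1 \<and> hf_rep h2 \<and> (\<forall>x\<in>\<real>. ext_at (\<lambda>z. h1 z - h2 z) x)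
     \<and> ext_at (\<lambda>w. h1 (1/w) - h2 (1/w)) 0"
  then obtain V1 V2 where V12: "nbhdT V1" "nbhdT V2" "h1 holomorphic_on (V1 - \<real>)" "h2 holomorphic_on (V2 - \<real>)"
    unfolding hf_rep_def by blast
  define V where "V = V1 \<inter> V2"
  define d where "d = (\<lambda>z. h1 z - h2 z)"
  have opV: "open V" using V12 by (auto simp: V_def nbhdT_def)
  have V: "nbhdT V"
  proof -
    from V12 obtain R1 R2 where "{z. R1 < norm z} \<subseteq> V1" "{z. R2 < norm z} \<subseteq> V2"
      unfolding nbhdT_def by blast
    then have "{z. max R1 R2 < norm z} \<subseteq> V" unfolding V_def by auto
    then show ?thesis using V12 unfolding nbhdT_def V_def by blast
  qed
  have "d holomorphic_on (V - \<real>)" unfolding d_def V_def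
    by (intro holomorphic_intros) (use V12 in \<open>auto elim: holomorphic_on_subset\<close>)
  then have dan: "d analytic_on {z}" if "z \<in> V" "z \<notin> \<real>" for z
    using opV that by (metis DiffI analytic_at closed_complex_Reals open_Diff)
  have dext: "ext_at d x" if "x \<in> \<real>" for x using a that by (simp add: d_def)
  have fan: "real_fill d analytic_on {z}" if "z \<in> V" for z
    using dan[OF that] dext real_fill_analytic real_fill_analytic' by (cases "z \<in> \<real>") auto
  have fhol: "real_fill d holomorphic_on V"
    using fan analytic_on_analytic_at[of "real_fill d" V] analytic_imp_holomorphic by blast
  obtain k where k: "k analytic_on {0}" "\<forall>\<^sub>F w in at_nonreal 0. d (1/w) = k w"
    using a by (auto simp: ext_at_def d_def)
  have "\<forall>\<^sub>F w in nhds 0. w \<notin> \<real> \<longrightarrow> d (1/w) = k w"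
    using k(2) by (subst (asm) eventually_nonreal_nhds) auto
  then obtain r1 where r1: "r1 > 0" "\<And>w. norm w < r1 \<Longrightarrow> w \<notin> \<real> \<Longrightarrow> d (1/w) = k w"
    by (auto simp: eventually_nhds_metric dist_norm)
  obtain r2 where r2: "r2 > 0" "k holomorphic_on ball 0 r2"
    using k(1) analytic_at_ball by blast
  define r where "r = min r1 r2"
  have r: "r > 0" using r1 r2 by (simp add: r_def)
  have eq: "(if w = 0 then k 0 else real_fill d (1/w)) = k w" if "w \<in> ball 0 r" for w
  proof (cases "w \<in> \<real> \<and> w \<noteq> 0")
    \<comment> \<open>At a real point other than 0 the two sides are compared by continuity from the
      nonreal points z nearby, where both equal \<open>d (1/z)\<close>.\<close>
    case True
    have "1/w \<in> V" using True V unfolding nbhdT_def by auto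
    then have "(\<lambda>w. real_fill d (1/w)) analytic_on {w}"
      using True fan by - (rule analytic_at_compose[of "\<lambda>w. 1/w" w "real_fill d"], auto intro!: analytic_intros)
    moreover have "k analytic_on {w}" using r2 that analytic_at[of k w]
      by (intro iffD2[OF analytic_at] exI[of _ "ball 0 r2"]) (auto simp: r_def)
    moreover have "\<forall>\<^sub>F z in nhds w. z \<notin> \<real> \<longrightarrow> real_fill d (1/z) = k z"
    proof -
      have "\<forall>\<^sub>F z in nhds w. z \<in> ball 0 r" using that by (intro eventually_nhds_in_open) auto
      then show ?thesis by eventually_elim (use r1 in \<open>auto simp: r_def\<close>)
    qed
    ultimately have "real_fill d (1/w) = k w"
      using True by (intro isCont_eq_nonreal'[of w "\<lambda>w. real_fill d (1/w)" k] analytic_at_imp_isCont) auto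
    then show ?thesis using True by auto
  next
    case False
    then show ?thesis using r1 that by (auto simp: r_def)
  qed
  have "(\<lambda>w. if w = 0 then k 0 else real_fill d (1/w)) holomorphic_on ball 0 r"
    by (rule holomorphic_transform[of k]) (use eq r2 in \<open>auto simp: r_def elim: holomorphic_on_subset\<close>)
  then have "holo_sphere (real_fill d) V"
    unfolding holo_sphere_def using fhol r by blast
  moreover have "\<forall>z\<in>V-\<real>. h1 z - h2 z = real_fill d z" by (simp add: d_def)
  ultimately show "hf_equiv h1 h2" unfolding hf_equiv_def using a V by blast
qed

lemma hf_equiv_refl: "hf_rep h \<Longrightarrow> hf_equiv h h"
  by (simp add: hf_equiv_iff)

lemma hf_equiv_sym: "hf_equiv h1 h2 \<Longrightarrow> hf_equiv h2 h1"
  unfolding hf_equiv_iff using ext_at_minus[of "\<lambda>z. h1 z - h2 z"] ext_at_minus[of "\<lambda>w. h1 (1/w) - h2 (1/w)" 0]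
  by simp

lemma hf_equiv_trans:
  assumes "hf_equiv h1 h2" "hf_equiv h2 h3"
  shows "hf_equiv h1 h3"
proof -
  have "ext_at (\<lambda>z. h1 z - h3 z) x" if "x \<in> \<real>" for x
    using assms that ext_at_add[of "\<lambda>z. h1 z - h2 z" x "\<lambda>z. h2 z - h3 z"] by (simp add: hf_equiv_iff)
  moreover have "ext_at (\<lambda>w. h1 (1/w) - h3 (1/w)) 0"
    using assms ext_at_add[of "\<lambda>z. h1 (1/z) - h2 (1/z)" 0 "\<lambda>z. h2 (1/z) - h3 (1/z)"] by (simp add: hf_equiv_iff)
  ultimately show ?thesis using assms by (simp add: hf_equiv_iff)
qed

text \<open>\<open>h1\<close> is the difference plus \<open>h2\<close>, and a function that extends
  across the line is holomorphic beside it; so proving the equivalence also proves that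
  \<open>h1\<close> is a representative.\<close>

lemma hf_equiv_rep:
  assumes "hf_rep h2" "\<And>x. x \<in> \<real> \<Longrightarrow> ext_at (\<lambda>z. h1 z - h2 z) x" "ext_at (\<lambda>w. h1 (1/w) - h2 (1/w)) 0"
  shows "hf_equiv h1 h2"
proof -
  have "hol_near h1 x" if "x \<in> \<real>" for x
    using ext_at_imp_hol_near[OF assms(2)[OF that] that] assms(1) that
      hol_near_add[of "\<lambda>z. h1 z - h2 z" x h2] by (simp add: hf_rep_iff)
  moreover have "hol_near (\<lambda>w. h1 (1/w)) 0"
    using ext_at_imp_hol_near[OF assms(3)] assms(1)
      hol_near_add[of "\<lambda>z. h1 (1/z) - h2 (1/z)" 0 "\<lambda>w. h2 (1/w)"] by (simp add: hf_rep_iff)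
  ultimately have "hf_rep h1" by (simp add: hf_rep_iff)
  then show ?thesis using assms by (simp add: hf_equiv_iff)
qed

subsection \<open>The action of the modular group\<close>

lemma eventually_nonreal_nonreal:
  fixes x :: complex
  assumes "x \<in> \<real>" "\<forall>\<^sub>F z in at_nonreal x. P z"
  shows "\<forall>\<^sub>F z in at_nonreal x. \<forall>\<^sub>F y in nhds z. P y"
proof -
  have "\<forall>\<^sub>F z in nhds x. \<forall>\<^sub>F y in nhds z. y \<notin> \<real> \<longrightarrow> P y"
    using assms(2) by (simp add: eventually_nonreal_nhds[OF assms(1)] eventually_eventually)
  then show ?thesis unfolding eventually_nonreal_nhds[OF assms(1)]
  proof eventually_elim
    case (elim z)
    show ?case
    proof
      assume "z \<notin> \<real>"
      then have "\<forall>\<^sub>F y in nhds z. y \<in> -\<real>"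
        by (intro eventually_nhds_in_open) (auto simp: open_Compl closed_complex_Reals)
      with elim show "\<forall>\<^sub>F y in nhds z. P y" by eventually_elim auto
    qed
  qed
qed

lemma hol_near_cong:
  assumes "x \<in> \<real>" "\<forall>\<^sub>F z in at_nonreal x. u z = v z" "hol_near u x"
  shows "hol_near v x"
  using eventually_nonreal_nonreal[OF assms(1,2)] assms(3) unfolding hol_near_def
  by eventually_elim (use analytic_on_cong_nhds in blast)

lemma hol_near_analytic: "a analytic_on {x} \<Longrightarrow> hol_near a x"
  unfolding hol_near_def
  using analytic_eventually_nhds[of a x] by (simp add: eventually_at_filter eventually_mono)

lemma moebius_nonreal:
  fixes a b c d :: real and z :: complex
  assumes "a * d - b * c = 1" "z \<notin> \<real>"
  shows "(of_real d * z - of_real b) / (- of_real c * z + of_real a) \<notin> \<real>"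
proof
  assume "(of_real d * z - of_real b) / (- of_real c * z + of_real a) \<in> \<real>"
  then obtain r where r: "(of_real d * z - of_real b) / (- of_real c * z + of_real a) = of_real r"
    by (auto elim: Reals_cases)
  have im: "Im z \<noteq> 0" using assms by (simp add: complex_is_Real_iff)
  have nz: "- of_real c * z + of_real a \<noteq> 0"
  proof
    assume "- of_real c * z + of_real a = 0"
    then have "Im (- of_real c * z + of_real a) = 0" "Re (- of_real c * z + of_real a) = 0" by simp_all
    then show False using im assms by auto
  qed
  then have "of_real d * z - of_real b = of_real r * (- of_real c * z + of_real a)"
    using r by (simp add: field_simps)
  then have "Im (of_real d * z - of_real b) = Im (of_real r * (- of_real c * z + of_real a))"
    "Re (of_real d * z - of_real b) = Re (of_real r * (- of_real c * z + of_real a))" by simp_all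
  then have 1: "d * Im z = - (r * c * Im z)" "d * Re z - b = r * (a - c * Re z)" by simp_all
  then have "(d + r * c) * Im z = 0" by algebra
  then have d: "d = - r * c" using im by auto
  then have "b = - r * a" using 1(2) by (simp add: algebra_simps)
  then show False using assms(1) d by auto
qed

text \<open>Both arguments are below \<pi>/2 in absolute value, so their sum stays inside the
  principal strip. The product rules for powers of \<open>jfac\<close> and \<open>cfac\<close> are
  reduced to such factors.\<close>

lemma powr_mult_Re_pos:
  assumes "Re x > 0" "Re y > 0"
  shows "(x * y) powr s = x powr s * y powr (s::complex)"
proof -
  have "x \<noteq> 0" "y \<noteq> 0" using assms by auto
  moreover have "\<bar>Im (Ln x)\<bar> < pi/2" "\<bar>Im (Ln y)\<bar> < pi/2"
    using assms Re_Ln_pos_lt[of x] Re_Ln_pos_lt[of y] calculation by auto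
  ultimately have "Ln (x * y) = Ln x + Ln y" by (intro Ln_times_simple) auto
  then show ?thesis using \<open>x \<noteq> 0\<close> \<open>y \<noteq> 0\<close> by (simp add: powr_def ring_distribs exp_add)
qed

abbreviation jfac :: "real \<times> real \<times> real \<times> real \<Rightarrow> complex \<Rightarrow> complex" where
  "jfac g \<tau> \<equiv> (case g of (a, b, c, d) \<Rightarrow>
     (1 + \<tau>^2) / ((of_real c * \<tau> - of_real a)^2 + (of_real d * \<tau> - of_real b)^2))"

text \<open>The factor \<open>jfac\<close> in the chart w = 1/\<tau>, with numerator and denominator
  multiplied by w^2 so that it makes sense at w = 0.\<close>

abbreviation jfac_inf :: "real \<times> real \<times> real \<times> real \<Rightarrow> complex \<Rightarrow> complex" where
  "jfac_inf g w \<equiv> (case g of (a, b, c, d) \<Rightarrow>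
     (w^2 + 1) / ((of_real c - of_real a * w)^2 + (of_real d - of_real b * w)^2))"

lemma pi_rep_jfac:
  "pi_rep \<nu> (a,b,c,d) h \<tau> = jfac (a,b,c,d) \<tau> powr ((1 + \<nu>) / 2) *
     h ((of_real d * \<tau> - of_real b) / (- of_real c * \<tau> + of_real a))"
  by (simp add: pi_rep_def)

lemma jfac_inverse: "w \<noteq> 0 \<Longrightarrow> jfac g (1/w) = jfac_inf g w"
  by (cases g) (auto simp: divide_simps power2_eq_square)

lemma sum_squares_det_pos:
  fixes a b c d t :: real
  assumes "a * d - b * c = 1"
  shows "(c * t - a)\<^sup>2 + (d * t - b)\<^sup>2 > 0" "(c - a * t)\<^sup>2 + (d - b * t)\<^sup>2 > 0"
proof -
  have "\<not> (c * t - a = 0 \<and> d * t - b = 0)" "\<not> (c - a * t = 0 \<and> d - b * t = 0)"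
    using assms by algebra+
  then show "(c * t - a)\<^sup>2 + (d * t - b)\<^sup>2 > 0" "(c - a * t)\<^sup>2 + (d - b * t)\<^sup>2 > 0"
    by (metis sum_power2_gt_zero_iff)+
qed

text \<open>Numerator and denominator are positive real numbers on the circle (the denominator
  because of the determinant), so the principal power is analytic there and is the branch that is
  positive on T.\<close>

lemma jfac_analytic:
  assumes "g \<in> PSL2R" "x \<in> \<real>"
  shows "jfac g analytic_on {x}" "Re (jfac g x) > 0" "Im (jfac g x) = 0"
    and "jfac_inf g analytic_on {x}" "Re (jfac_inf g x) > 0" "Im (jfac_inf g x) = 0"
proof -
  obtain a b c d where g: "g = (a,b,c,d)" "a * d - b * c = 1"
    using assms by (auto simp: PSL2R_def)
  obtain t where t: "x = of_real t" using assms by (auto elim: Reals_cases)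
  have pos: "(c * t - a)\<^sup>2 + (d * t - b)\<^sup>2 > 0" "(c - a * t)\<^sup>2 + (d - b * t)\<^sup>2 > 0" "1 + t\<^sup>2 > 0" "t\<^sup>2 + 1 > 0"
    using sum_squares_det_pos[OF g(2)] by (auto simp: add_pos_nonneg add_nonneg_pos)
  have "(of_real c * x - of_real a)^2 + (of_real d * x - of_real b)^2 = of_real ((c * t - a)\<^sup>2 + (d * t - b)\<^sup>2)"
    "(of_real c - of_real a * x)^2 + (of_real d - of_real b * x)^2 = of_real ((c - a * t)\<^sup>2 + (d - b * t)\<^sup>2)"
    by (simp_all add: t)
  then have nz: "(of_real c * x - of_real a)^2 + (of_real d * x - of_real b)^2 \<noteq> 0"
    "(of_real c - of_real a * x)^2 + (of_real d - of_real b * x)^2 \<noteq> 0"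
    using pos by (metis less_irrefl of_real_eq_0_iff)+
  show "jfac g analytic_on {x}" "jfac_inf g analytic_on {x}"
    using nz by (auto simp: g intro!: analytic_intros)
  have "jfac g x = of_real ((1 + t\<^sup>2) / ((c * t - a)\<^sup>2 + (d * t - b)\<^sup>2))"
    "jfac_inf g x = of_real ((t\<^sup>2 + 1) / ((c - a * t)\<^sup>2 + (d - b * t)\<^sup>2))"
    by (simp_all add: g t)
  then show "Re (jfac g x) > 0" "Im (jfac g x) = 0" "Re (jfac_inf g x) > 0" "Im (jfac_inf g x) = 0"
    using pos by (metis Re_complex_of_real Im_complex_of_real divide_pos_pos)+
qed

lemma eventually_Re_pos:
  assumes "f analytic_on {x}" "Re (f x) > 0"
  shows "\<forall>\<^sub>F z in at_nonreal x. Re (f z) > 0"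
proof -
  have "(f \<longlongrightarrow> f x) (at_nonreal x)"
    using analytic_at_imp_isCont[OF assms(1)] by (auto simp: isCont_def intro: tendsto_within_subset)
  then have "((\<lambda>z. Re (f z)) \<longlongrightarrow> Re (f x)) (at_nonreal x)" by (rule tendsto_Re)
  then show ?thesis using assms(2) order_tendstoD(1) by blast
qed

lemma analytic_powr_pos:
  assumes "f analytic_on {x}" "Re (f x) > 0"
  shows "(\<lambda>z. f z powr s) analytic_on {x}"
  using assms by (auto intro!: analytic_intros simp: complex_nonpos_Reals_iff)

text \<open>The predicate \<open>Q\<close> stands for \<open>hol_near\<close> and for
  \<open>ext_at\<close>, so that preservation of representatives and of their equivalence is one
  argument. Four cases arise, since a point of the circle and its image may each be finite or
  infinite.\<close>

lemma pi_rep_local: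
  fixes Q :: "(complex \<Rightarrow> complex) \<Rightarrow> complex \<Rightarrow> bool"
  assumes cmp: "\<And>u \<phi> x. Q u (\<phi> x) \<Longrightarrow> \<phi> analytic_on {x} \<Longrightarrow> x \<in> \<real> \<Longrightarrow> \<phi> x \<in> \<real> \<Longrightarrow>
       (\<And>z. z \<notin> \<real> \<Longrightarrow> \<phi> z \<notin> \<real>) \<Longrightarrow> Q (\<lambda>z. u (\<phi> z)) x"
    and cong: "\<And>u v x. x \<in> \<real> \<Longrightarrow> (\<forall>\<^sub>F z in at_nonreal x. u z = v z) \<Longrightarrow> Q u x \<Longrightarrow> Q v x"
    and mult: "\<And>u a x. x \<in> \<real> \<Longrightarrow> a analytic_on {x} \<Longrightarrow> Q u x \<Longrightarrow> Q (\<lambda>z. a z * u z) x"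
    and g: "g \<in> PSL2R" and Qu: "\<And>x. x \<in> \<real> \<Longrightarrow> Q u x" "Q (\<lambda>w. u (1/w)) 0"
  shows "(\<forall>x\<in>\<real>. Q (pi_rep \<nu> g u) x) \<and> Q (\<lambda>w. pi_rep \<nu> g u (1/w)) 0"
proof -
  obtain a b c d where abcd: "g = (a,b,c,d)" "a * d - b * c = 1"
    using g by (auto simp: PSL2R_def)
  define \<phi> where "\<phi> = (\<lambda>z::complex. (of_real d * z - of_real b) / (- of_real c * z + of_real a))"
  note nonr = moebius_nonreal[OF abcd(2)]
  have nonr1: "\<phi> z \<notin> \<real>" if "z \<notin> \<real>" for z using nonr[OF that] by (simp add: \<phi>_def)
  have inv: "1 / \<phi> z = (- of_real c * z + of_real a) / (of_real d * z - of_real b)" for z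
    by (simp add: \<phi>_def)
  have "Q (\<lambda>z. u (\<phi> z)) x" if x: "x \<in> \<real>" for x
  proof (cases "- of_real c * x + of_real a = 0")
    case False
    then have an: "\<phi> analytic_on {x}" unfolding \<phi>_def by (auto intro!: analytic_intros)
    have "\<phi> x \<in> \<real>" using x by (simp add: \<phi>_def)
    then show ?thesis using cmp[OF Qu(1) an x] nonr1 by blast
  next
    \<comment> \<open>\<open>x\<close> is the pole of \<phi>: its image is infinity, where 1/\<phi>
      is the local coordinate. The determinant prevents numerator and denominator from vanishing
      together.\<close>
    case True
    obtain t where t: "x = of_real t" using x by (auto elim: Reals_cases)
    have "- c * t + a = 0" using True unfolding t
      by (metis of_real_add of_real_eq_0_iff of_real_minus of_real_mult)
    then have "d * t - b \<noteq> 0" using abcd(2) by algebra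
    then have nz: "of_real d * x - of_real b \<noteq> 0" unfolding t
      by (metis of_real_diff of_real_eq_0_iff of_real_mult)
    have an: "(\<lambda>z. 1 / \<phi> z) analytic_on {x}" unfolding inv using nz by (auto intro!: analytic_intros)
    have "1 / \<phi> x = 0" unfolding inv using True by simp
    then have "Q (\<lambda>z. u (1/(1/\<phi> z))) x"
      using cmp[of "\<lambda>w. u (1/w)" "\<lambda>z. 1 / \<phi> z" x, OF _ an x] Qu(2) nonr1 by simp
    then show ?thesis by simp
  qed
  then have fin: "Q (pi_rep \<nu> g u) x" if x: "x \<in> \<real>" for x
    using mult[OF x analytic_powr_pos[OF jfac_analytic(1,2)[OF g x], of "(1+\<nu>)/2"], of "\<lambda>z. u (\<phi> z)"] x
    by (simp add: abcd pi_rep_def[abs_def] \<phi>_def)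
  have nw: "\<forall>\<^sub>F w in at_nonreal 0. w \<noteq> (0::complex)" by (simp add: eventually_at_filter)
  define \<theta> where "\<theta> = (\<lambda>w::complex. (of_real d - of_real b * w) / (- of_real c + of_real a * w))"
  have chi: "\<phi> (1/w) = \<theta> w" if "w \<noteq> 0" for w
    using that by (simp add: \<phi>_def \<theta>_def divide_simps)
  have nonr2: "\<theta> w \<notin> \<real>" if "w \<notin> \<real>" for w
    using nonr1[of "1/w"] that chi[of w] by (cases "w = 0") simp_all
  have "Q (\<lambda>w. u (\<theta> w)) 0"
  proof (cases "c = 0")
    case False
    then have an: "\<theta> analytic_on {0}" unfolding \<theta>_def by (auto intro!: analytic_intros)
    have "\<theta> 0 \<in> \<real>" by (simp add: \<theta>_def)
    then show ?thesis using cmp[OF Qu(1) an Reals_0] nonr2 by blast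
  next
    \<comment> \<open>Infinity is fixed, so the chart at infinity is used on both sides.\<close>
    case True
    then have "d \<noteq> 0" using abcd by auto
    have i2: "1 / \<theta> w = (- of_real c + of_real a * w) / (of_real d - of_real b * w)" for w
      by (simp add: \<theta>_def)
    have an: "(\<lambda>w. 1 / \<theta> w) analytic_on {0}" unfolding i2 using \<open>d \<noteq> 0\<close> by (auto intro!: analytic_intros)
    have "1 / \<theta> 0 = 0" unfolding i2 using True by simp
    then have "Q (\<lambda>z. u (1/(1/\<theta> z))) 0"
      using cmp[of "\<lambda>w. u (1/w)" "\<lambda>z. 1 / \<theta> z" 0, OF _ an Reals_0] Qu(2) nonr2 by simp
    then show ?thesis by simp
  qed
  then have "Q (\<lambda>w. jfac_inf g w powr ((1+\<nu>)/2) * u (\<theta> w)) 0"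
    using mult[OF Reals_0 analytic_powr_pos[OF jfac_analytic(4,5)[OF g Reals_0]]] by blast
  moreover have "\<forall>\<^sub>F w in at_nonreal 0. jfac_inf g w powr ((1+\<nu>)/2) * u (\<theta> w) = pi_rep \<nu> g u (1/w)"
    using nw
  proof eventually_elim
    case (elim w)
    show ?case using chi[OF elim] jfac_inverse[OF elim, of g] by (simp add: abcd pi_rep_jfac \<phi>_def)
  qed
  ultimately have "Q (\<lambda>w. pi_rep \<nu> g u (1/w)) 0" by (rule cong[OF Reals_0, rotated])
  then show ?thesis using fin by blast
qed

lemma pi_rep_diff: "pi_rep \<nu> g (\<lambda>z. u z - v z) = (\<lambda>z. pi_rep \<nu> g u z - pi_rep \<nu> g v z)"
  by (cases g) (simp add: fun_eq_iff pi_rep_def ring_distribs)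

lemma hf_rep_pi_rep:
  assumes "g \<in> PSL2R" "hf_rep h"
  shows "hf_rep (pi_rep \<nu> g h)"
  unfolding hf_rep_iff
proof (rule pi_rep_local[where Q=hol_near])
  show "hol_near (\<lambda>z. a z * u z) x" if "a analytic_on {x}" "hol_near u x" for u a x
    using that by (simp add: hol_near_mult hol_near_analytic)
qed (use assms in \<open>auto simp: hf_rep_iff intro: hol_near_compose hol_near_cong\<close>)

lemma hf_equiv_pi_rep:
  assumes "g \<in> PSL2R" "hf_equiv u v"
  shows "hf_equiv (pi_rep \<nu> g u) (pi_rep \<nu> g v)"
proof -
  have D: "\<forall>x\<in>\<real>. ext_at (\<lambda>z. u z - v z) x" "ext_at (\<lambda>w. u (1/w) - v (1/w)) 0"
    using assms by (auto simp: hf_equiv_iff)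
  have "(\<forall>x\<in>\<real>. ext_at (pi_rep \<nu> g (\<lambda>z. u z - v z)) x) \<and> ext_at (\<lambda>w. pi_rep \<nu> g (\<lambda>z. u z - v z) (1/w)) 0"
  proof (rule pi_rep_local[where Q=ext_at])
    show "ext_at (\<lambda>z. a z * u z) x" if "a analytic_on {x}" "ext_at u x" for u a x
      using that by (simp add: ext_at_mult ext_at_analytic)
  qed (use assms(1) D in \<open>auto intro: ext_at_compose simp: ext_at_cong\<close>)
  then show ?thesis
    using assms hf_rep_pi_rep[OF assms(1)] by (simp add: hf_equiv_iff pi_rep_diff)
qed

lemma hf_equiv_eventually:
  assumes "hf_rep v" "\<And>x. x \<in> \<real> \<Longrightarrow> \<forall>\<^sub>F z in at_nonreal x. u z = v z"
    "\<forall>\<^sub>F w in at_nonreal 0. u (1/w) = v (1/w)"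
  shows "hf_equiv u v"
proof (rule hf_equiv_rep[OF assms(1)])
  show "ext_at (\<lambda>z. u z - v z) x" if "x \<in> \<real>" for x
    by (rule ext_atI[of "\<lambda>_. 0"]) (use assms(2)[OF that] in auto)
  show "ext_at (\<lambda>w. u (1/w) - v (1/w)) 0"
    by (rule ext_atI[of "\<lambda>_. 0"]) (use assms(3) in auto)
qed

section \<open>Generators of the modular group and invariance under them\<close>

definition mS :: "real \<times> real \<times> real \<times> real" where "mS = (0, -1, 1, 0)"
definition mT :: "real \<Rightarrow> real \<times> real \<times> real \<times> real" where "mT n = (1, n, 0, 1)"

lemma mS_mT_PSL2R [simp]: "mS \<in> PSL2R" "mT n \<in> PSL2R"
  by (auto simp: mS_def mT_def PSL2R_def)

text \<open>The factor is a quotient of equal terms. At \<open>z\<close> = i and \<open>z\<close> =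
  -i it is 0 / 0 = 0 instead of 1, hence the hypothesis; both points are away from the
  circle.\<close>

lemma pi_rep_mS: "1 + z\<^sup>2 \<noteq> 0 \<Longrightarrow> pi_rep \<nu> mS h z = h (- 1 / z)"
  by (simp add: mS_def pi_rep_def add.commute)

lemma pi_rep_mT:
  "pi_rep \<nu> (mT n) h z = ((1 + z\<^sup>2) / (1 + (z - of_real n)\<^sup>2)) powr ((1 + \<nu>) / 2) * h (z - of_real n)"
  by (simp add: mT_def pi_rep_def)

lemma one_plus_square_Re_pos: "x \<in> \<real> \<Longrightarrow> Re (1 + x\<^sup>2) > 0"
  by (auto elim!: Reals_cases simp: add_pos_nonneg simp flip: of_real_power)

lemma eventually_one_plus_square:
  fixes x :: complex
  shows "x \<in> \<real> \<Longrightarrow> \<forall>\<^sub>F z in at_nonreal x. 1 + z\<^sup>2 \<noteq> 0"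
  "\<forall>\<^sub>F w in at_nonreal 0. 1 + (1/w)\<^sup>2 \<noteq> (0::complex)"
proof -
  have 1: "\<forall>\<^sub>F z in at_nonreal x. 1 + z\<^sup>2 \<noteq> 0" if "x \<in> \<real>" for x :: complex
  proof -
    have "\<forall>\<^sub>F z in at_nonreal x. Re (1 + z\<^sup>2) > 0"
      by (rule eventually_Re_pos) (use one_plus_square_Re_pos[OF that] in \<open>auto intro!: analytic_intros\<close>)
    then show ?thesis by eventually_elim (metis less_irrefl zero_complex.sel(1))
  qed
  then show "x \<in> \<real> \<Longrightarrow> \<forall>\<^sub>F z in at_nonreal x. 1 + z\<^sup>2 \<noteq> 0" .
  have "\<forall>\<^sub>F w in at_nonreal 0. w \<noteq> (0::complex)" by (simp add: eventually_at_filter)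
  with 1[OF Reals_0] show "\<forall>\<^sub>F w in at_nonreal 0. 1 + (1/w)\<^sup>2 \<noteq> (0::complex)"
    by eventually_elim (auto simp: field_simps power2_eq_square)
qed

text \<open>The matrix is S g. As the factor of S is 1, the two powers have the same base and no
  branches have to be compared.\<close>

lemma pi_rep_mS_mult:
  assumes "g = (a,b,c,d)" "g \<in> PSL2R" "hf_rep h"
  shows "hf_equiv (pi_rep \<nu> (-c,-d,a,b) h) (pi_rep \<nu> mS (pi_rep \<nu> g h))"
proof -
  have det: "a * d - b * c = 1" using assms by (auto simp: PSL2R_def)
  have eq: "pi_rep \<nu> (-c,-d,a,b) h z = pi_rep \<nu> mS (pi_rep \<nu> g h) z" if z: "1 + z\<^sup>2 \<noteq> 0" "z \<notin> \<real>" for z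
  proof -
    have z0: "z \<noteq> 0" using z by auto
    have "jfac (-c,-d,a,b) z = jfac g (-1/z)"
      using z0 by (simp add: assms(1) divide_simps power2_eq_square) (simp add: algebra_simps)
    moreover have "(of_real b * z - of_real (-d)) / (- of_real a * z + of_real (-c)) =
      (of_real d * (-1/z) - of_real b) / (- of_real c * (-1/z) + of_real a)"
    proof -
      have "of_real d * (-1/z) - of_real b = - (of_real b * z + of_real d) / z"
        "- of_real c * (-1/z) + of_real a = (of_real a * z + of_real c) / z"
        using z0 by (simp_all add: field_simps)
      then have "(of_real d * (-1/z) - of_real b) / (- of_real c * (-1/z) + of_real a) =
          - (of_real b * z + of_real d) / (of_real a * z + of_real c)"
        using z0 by simp
      moreover have "(of_real b * z - of_real (-d)) / (- of_real a * z + of_real (-c)) =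
          (of_real b * z + of_real d) / (- (of_real a * z + of_real c))"
        by simp
      ultimately show ?thesis by (simp only: divide_minus_left divide_minus_right)
    qed
    ultimately show ?thesis
      unfolding pi_rep_mS[OF z(1)] assms(1) pi_rep_jfac by simp
  qed
  show ?thesis
  proof (rule hf_equiv_eventually)
    show "hf_rep (pi_rep \<nu> mS (pi_rep \<nu> g h))"
      by (intro hf_rep_pi_rep assms mS_mT_PSL2R)
    show "\<forall>\<^sub>F z in at_nonreal x. pi_rep \<nu> (-c,-d,a,b) h z = pi_rep \<nu> mS (pi_rep \<nu> g h) z"
      if "x \<in> \<real>" for x
    proof -
      have "\<forall>\<^sub>F z in at_nonreal x. z \<notin> \<real>" by (simp add: eventually_at_filter)
      with eventually_one_plus_square(1)[OF that] show ?thesis by eventually_elim (rule eq)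
    qed
    have "\<forall>\<^sub>F z in at_nonreal (0::complex). z \<notin> \<real>" by (simp add: eventually_at_filter)
    with eventually_one_plus_square(2)
    show "\<forall>\<^sub>F w in at_nonreal 0. pi_rep \<nu> (-c,-d,a,b) h (1/w) = pi_rep \<nu> mS (pi_rep \<nu> g h) (1/w)"
      by eventually_elim (rule eq, auto)
  qed
qed

text \<open>The matrix is T^n g. The product rule for the principal power is applied to factors in
  the right half plane, which is guaranteed only near the circle; so composition is stated as an
  equivalence of representatives and not as an equation of functions.\<close>

lemma pi_rep_mT_mult:
  assumes "g = (a,b,c,d)" "g \<in> PSL2R" "hf_rep h"
  shows "hf_equiv (pi_rep \<nu> (a + n*c, b + n*d, c, d) h) (pi_rep \<nu> (mT n) (pi_rep \<nu> g h))"
proof -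
  have det: "a * d - b * c = 1" using assms by (auto simp: PSL2R_def)
  let ?N = "of_real n :: complex" and ?gn = "(a + n*c, b + n*d, c, d)"
  have gn: "?gn \<in> PSL2R" using det by (auto simp: PSL2R_def algebra_simps)
  have eq: "pi_rep \<nu> ?gn h z = pi_rep \<nu> (mT n) (pi_rep \<nu> g h) z"
    if z: "Re (jfac (mT n) z) > 0" "Re (jfac g (z - ?N)) > 0" for z
  proof -
    have 1: "1 + (z - ?N)\<^sup>2 \<noteq> 0" using z(1) by (auto simp: mT_def)
    have "(of_real c * (z - ?N) - of_real a)^2 + (of_real d * (z - ?N) - of_real b)^2 =
      (of_real c * z - of_real (a + n*c))^2 + (of_real d * z - of_real (b + n*d))^2"
      by (simp add: algebra_simps)
    then have "jfac ?gn z = jfac (mT n) z * jfac g (z - ?N)"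
      using 1 by (simp add: assms(1) mT_def)
    then have "jfac ?gn z powr ((1+\<nu>)/2) = jfac (mT n) z powr ((1+\<nu>)/2) * jfac g (z - ?N) powr ((1+\<nu>)/2)"
      using powr_mult_Re_pos[OF z, of "(1+\<nu>)/2"] by (simp only:)
    moreover have "(of_real d * z - of_real (b + n*d)) / (- of_real c * z + of_real (a + n*c)) =
       (of_real d * (z - ?N) - of_real b) / (- of_real c * (z - ?N) + of_real a)"
      by (simp add: algebra_simps)
    ultimately show ?thesis
      unfolding assms(1) mT_def pi_rep_jfac by simp
  qed
  show ?thesis
  proof (rule hf_equiv_eventually)
    show "hf_rep (pi_rep \<nu> (mT n) (pi_rep \<nu> g h))"
      by (intro hf_rep_pi_rep assms mS_mT_PSL2R)
    show "\<forall>\<^sub>F z in at_nonreal x. pi_rep \<nu> ?gn h z = pi_rep \<nu> (mT n) (pi_rep \<nu> g h) z"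
      if x: "x \<in> \<real>" for x
    proof -
      have "\<forall>\<^sub>F z in at_nonreal x. Re (jfac (mT n) z) > 0"
        by (intro eventually_Re_pos jfac_analytic mS_mT_PSL2R x)
      moreover have "(\<lambda>z. jfac g (z - ?N)) analytic_on {x}"
        by (rule analytic_at_compose[of "\<lambda>z. z - ?N" x "jfac g"], intro analytic_intros, rule jfac_analytic(1))
          (use x assms in auto)
      then have "\<forall>\<^sub>F z in at_nonreal x. Re (jfac g (z - ?N)) > 0"
        by (rule eventually_Re_pos) (rule jfac_analytic(2), use x assms in auto)
      ultimately show ?thesis by eventually_elim (rule eq)
    qed
    have "\<forall>\<^sub>F w in at_nonreal 0. Re (jfac_inf (mT n) w) > 0"
      by (intro eventually_Re_pos jfac_analytic mS_mT_PSL2R Reals_0)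
    \<comment> \<open>The point 1/w - n has the coordinate w / (1 - n w) at infinity.\<close>
    moreover have "(\<lambda>w. jfac_inf g (w / (1 - ?N * w))) analytic_on {0}"
      by (rule analytic_at_compose[of "\<lambda>w. w / (1 - ?N * w)" 0 "jfac_inf g"], force intro!: analytic_intros, rule jfac_analytic(4))
        (use assms in auto)
    then have "\<forall>\<^sub>F w in at_nonreal 0. Re (jfac_inf g (w / (1 - ?N * w))) > 0"
      by (rule eventually_Re_pos) (rule jfac_analytic(5), use assms in auto)
    moreover have "\<forall>\<^sub>F z in at_nonreal (0::complex). z \<notin> \<real>" by (simp add: eventually_at_filter)
    ultimately show "\<forall>\<^sub>F w in at_nonreal 0. pi_rep \<nu> ?gn h (1/w) = pi_rep \<nu> (mT n) (pi_rep \<nu> g h) (1/w)"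
    proof eventually_elim
      case (elim w)
      have w: "w \<noteq> 0" using elim by auto
      have "1 - ?N * w \<noteq> 0"
      proof
        assume "1 - ?N * w = 0"
        then have "Im (1 - ?N * w) = 0" "Re (1 - ?N * w) = 0" by simp_all
        then show False using elim(3) by (auto simp: complex_is_Real_iff)
      qed
      then have *: "w / (1 - ?N * w) \<noteq> 0" "1 / (w / (1 - ?N * w)) = 1/w - ?N"
        using w by (auto simp: field_simps)
      show ?case
      proof (rule eq)
        show "Re (jfac (mT n) (1/w)) > 0" using elim(1) by (simp only: jfac_inverse[OF w])
        show "Re (jfac g (1/w - ?N)) > 0"
          using elim(2) by (simp only: jfac_inverse[OF *(1), unfolded *(2)])
      qed
    qed
  qed
qed

text \<open>The sign disappears in the squares and in the quotient, so the action depends only on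
  the element of PSL_2.\<close>

lemma pi_rep_uminus: "pi_rep \<nu> (-a,-b,-c,-d) h = pi_rep \<nu> (a,b,c,d) h"
proof
  fix z :: complex
  have "(of_real (-c) * z - of_real (-a))^2 + (of_real (-d) * z - of_real (-b))^2 =
    (of_real c * z - of_real a)^2 + (of_real d * z - of_real b)^2"
    by (simp add: power2_eq_square algebra_simps)
  moreover have "(of_real (-d) * z - of_real (-b)) / (- of_real (-c) * z + of_real (-a)) =
    (of_real d * z - of_real b) / (- of_real c * z + of_real a)"
    using minus_divide_divide[of "of_real d * z - of_real b" "- of_real c * z + of_real a"]
    by simp
  ultimately show "pi_rep \<nu> (-a,-b,-c,-d) h z = pi_rep \<nu> (a,b,c,d) h z"
    unfolding pi_rep_jfac by simp
qed

text \<open>Euclid's algorithm on the first column, by induction on the absolute value of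
  \<open>c\<close>. The rule \<open>minus\<close> compensates for S^2 = -1.\<close>

lemma SL2Z_induct:
  fixes P :: "int \<Rightarrow> int \<Rightarrow> int \<Rightarrow> int \<Rightarrow> bool"
  assumes one: "P 1 0 0 1"
    and T: "\<And>n a b c d. a * d - b * c = 1 \<Longrightarrow> P a b c d \<Longrightarrow> P (a + n * c) (b + n * d) c d"
    and S: "\<And>a b c d. a * d - b * c = 1 \<Longrightarrow> P a b c d \<Longrightarrow> P (-c) (-d) a b"
    and minus: "\<And>a b c d. a * d - b * c = 1 \<Longrightarrow> P a b c d \<Longrightarrow> P (-a) (-b) (-c) (-d)"
    and det: "a * d - b * c = 1"
  shows "P a b c d"
  using det
proof (induction "nat \<bar>c\<bar>" arbitrary: a b c d rule: less_induct)
  case less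
  show ?case
  proof (cases "c = 0")
    case True
    then have "a * d = 1" using less.prems by simp
    then have "a = 1 \<and> d = 1 \<or> a = -1 \<and> d = -1" by (simp add: zmult_eq_1_iff)
    then show ?thesis
    proof
      assume ad: "a = 1 \<and> d = 1"
      show ?thesis using T[OF _ one, of b] True ad by simp
    next
      assume ad: "a = -1 \<and> d = -1"
      have "P 1 (-b) 0 1" using T[OF _ one, of "-b"] by simp
      from minus[OF _ this] show ?thesis using True ad by simp
    qed
  next
    case False
    define q where "q = a div c"
    define a' where "a' = a - q * c"
    define b' where "b' = b - q * d"
    have a': "a' = a mod c" unfolding a'_def q_def by (simp add: minus_div_mult_eq_mod)
    then have "\<bar>a'\<bar> < \<bar>c\<bar>" using False by (simp add: abs_mod_less)
    then have lt: "nat \<bar>a'\<bar> < nat \<bar>c\<bar>" by simp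
    have det': "(- c) * b' - (-d) * a' = 1" "a' * d - b' * c = 1"
      using less.prems by (simp_all add: a'_def b'_def algebra_simps)
    \<comment> \<open>After a swap the remainder \<open>a'\<close> of \<open>a\<close> modulo
      \<open>c\<close> is the lower left entry, so the induction hypothesis applies.
      \<open>S\<close>, \<open>minus\<close> and \<open>T\<close> then undo the swap, its sign and
      the division.\<close>
    have "P (-c) (-d) a' b'" using less.hyps[OF lt det'(1)] .
    from S[OF det'(1) this] have "P (-a') (-b') (-c) (-d)" .
    from minus[OF _ this] have "P a' b' c d" using det' by simp
    from T[OF det'(2) this, of q] show ?thesis by (simp add: a'_def b'_def)
  qed
qed

text \<open>\<open>SL2Z_induct\<close> asks for all integer powers of T, which are obtained
  beforehand; T^(-1) comes from applying it to the invariance under T. Each product is resolved up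
  to equivalence only.\<close>

lemma mS_mT_invariant_imp:
  assumes h: "hf_rep h" and S: "hf_equiv (pi_rep \<nu> mS h) h" and T: "hf_equiv (pi_rep \<nu> (mT 1) h) h"
    and g: "g \<in> PSL2Z"
  shows "hf_equiv (pi_rep \<nu> g h) h"
proof -
  have one: "hf_equiv (pi_rep \<nu> (mT 0) h) h"
  proof (rule hf_equiv_eventually[OF h])
    have eq: "pi_rep \<nu> (mT 0) h z = h z" if "1 + z\<^sup>2 \<noteq> 0" for z using that by (simp add: pi_rep_mT)
    show "\<forall>\<^sub>F z in at_nonreal x. pi_rep \<nu> (mT 0) h z = h z" if "x \<in> \<real>" for x
      using eventually_one_plus_square(1)[OF that] by eventually_elim (rule eq)
    show "\<forall>\<^sub>F w in at_nonreal 0. pi_rep \<nu> (mT 0) h (1/w) = h (1/w)"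
      using eventually_one_plus_square(2) by eventually_elim (rule eq)
  qed
  have add: "hf_equiv (pi_rep \<nu> (mT (m + n)) h) (pi_rep \<nu> (mT m) (pi_rep \<nu> (mT n) h))" for m n
    using pi_rep_mT_mult[of "mT n" 1 n 0 1 h \<nu> m] h mS_mT_PSL2R by (simp add: mT_def add.commute)
  have Tminus: "hf_equiv (pi_rep \<nu> (mT (-1)) h) h"
  proof -
    have "hf_equiv (pi_rep \<nu> (mT (-1)) (pi_rep \<nu> (mT 1) h)) h"
      using hf_equiv_trans[OF hf_equiv_sym[OF add[of "-1" 1]]] one by simp
    then show ?thesis
      using hf_equiv_trans hf_equiv_sym hf_equiv_pi_rep[OF mS_mT_PSL2R(2) T] by blast
  qed
  have Tnat: "hf_equiv (pi_rep \<nu> (mT (of_nat n)) h) h \<and> hf_equiv (pi_rep \<nu> (mT (- of_nat n)) h) h" for n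
  proof (induction n)
    case 0
    then show ?case using one by simp
  next
    case (Suc n)
    have "hf_equiv (pi_rep \<nu> (mT 1) (pi_rep \<nu> (mT (of_nat n)) h)) h"
      "hf_equiv (pi_rep \<nu> (mT (-1)) (pi_rep \<nu> (mT (- of_nat n)) h)) h"
      using Suc hf_equiv_pi_rep[OF mS_mT_PSL2R(2)] hf_equiv_trans T Tminus by blast+
    then show ?case using hf_equiv_trans add[of 1 "of_nat n"] add[of "-1" "- of_nat n"] by simp
  qed
  have Tint: "hf_equiv (pi_rep \<nu> (mT (of_int n)) h) h" for n
    using Tnat[of "nat n"] Tnat[of "nat (-n)"] by (cases "n \<ge> 0") auto
  have "hf_equiv (pi_rep \<nu> (of_int a, of_int b, of_int c, of_int d) h) h"
    if "a * d - b * c = 1" for a b c d :: int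
    using that
  proof (rule SL2Z_induct[where P="\<lambda>a b c d. hf_equiv (pi_rep \<nu> (of_int a, of_int b, of_int c, of_int d) h) h", rotated 4])
    show "hf_equiv (pi_rep \<nu> (of_int 1, of_int 0, of_int 0, of_int 1) h) h"
      using one by (simp add: mT_def)
    fix a b c d :: int
    assume det: "a * d - b * c = 1" and IH: "hf_equiv (pi_rep \<nu> (of_int a, of_int b, of_int c, of_int d) h) h"
    have G: "(of_int a, of_int b, of_int c, of_int d) \<in> PSL2R"
      using det unfolding PSL2R_def by (simp flip: of_int_mult of_int_diff)
    show "hf_equiv (pi_rep \<nu> (of_int (- a), of_int (- b), of_int (- c), of_int (- d)) h) h"
      using IH pi_rep_uminus[of \<nu> "of_int a" "of_int b" "of_int c" "of_int d" h] by simp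
    have "hf_equiv (pi_rep \<nu> mS (pi_rep \<nu> (of_int a, of_int b, of_int c, of_int d) h)) h"
      using hf_equiv_trans[OF hf_equiv_pi_rep[OF mS_mT_PSL2R(1) IH] S] .
    from hf_equiv_trans[OF pi_rep_mS_mult[OF refl G h] this]
    show "hf_equiv (pi_rep \<nu> (of_int (- c), of_int (- d), of_int a, of_int b) h) h" by simp
    fix n :: int
    have "hf_equiv (pi_rep \<nu> (mT (of_int n)) (pi_rep \<nu> (of_int a, of_int b, of_int c, of_int d) h)) h"
      using hf_equiv_trans[OF hf_equiv_pi_rep[OF mS_mT_PSL2R(2) IH] Tint] .
    from hf_equiv_trans[OF pi_rep_mT_mult[OF refl G h] this]
    show "hf_equiv (pi_rep \<nu> (of_int (a + n * c), of_int (b + n * d), of_int c, of_int d) h) h" by simp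
  qed
  moreover obtain a b c d where g: "g = (of_int a, of_int b, of_int c, of_int d)"
    "of_int a * of_int d - of_int b * of_int c = (1::real)"
    using g unfolding PSL2Z_def by (auto elim!: Ints_cases)
  moreover have "a * d - b * c = 1"
    using g(2) by (metis of_int_diff of_int_eq_1_iff of_int_mult)
  ultimately show ?thesis by simp
qed

lemma PSL2Z_subset: "PSL2Z \<subseteq> PSL2R"
  by (auto simp: PSL2Z_def PSL2R_def)

lemma mem_hf_class: "h' \<in> hf_class h \<longleftrightarrow> hf_equiv h h'"
  by (simp add: hf_class_def)

lemma automorphic_classI:
  assumes h: "hf_rep h" and S: "hf_equiv (pi_rep \<nu> mS h) h" and T: "hf_equiv (pi_rep \<nu> (mT 1) h) h"
  shows "hf_class h \<in> automorphic \<nu> PSL2Z"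
proof -
  have "pi_hf \<nu> g (hf_class h) = hf_class h" if g: "g \<in> PSL2Z" for g
  proof -
    have gR: "g \<in> PSL2R" using g PSL2Z_subset by blast
    have inv: "hf_equiv (pi_rep \<nu> g h) h" by (rule mS_mT_invariant_imp[OF assms g])
    have "hf_equiv (pi_rep \<nu> g k) h" if "hf_equiv h k" for k
      using hf_equiv_trans[OF hf_equiv_sym[OF hf_equiv_pi_rep[OF gR that]] inv] .
    then show ?thesis
      unfolding pi_hf_def hf_class_def using hf_equiv_trans hf_equiv_sym hf_equiv_refl[OF h] by blast
  qed
  then show ?thesis using h by (auto simp: automorphic_def hyperfunctions_def)
qed

lemma automorphicD:
  assumes "\<alpha> \<in> automorphic \<nu> PSL2Z"
  obtains h where "hf_rep h" "\<alpha> = hf_class h" "hf_equiv (pi_rep \<nu> mS h) h" "hf_equiv (pi_rep \<nu> (mT 1) h) h"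
proof -
  obtain h where h: "hf_rep h" "\<alpha> = hf_class h"
    using assms by (auto simp: automorphic_def hyperfunctions_def)
  have "hf_equiv (pi_rep \<nu> g h) h" if g: "g \<in> PSL2Z" for g
  proof -
    have gR: "g \<in> PSL2R" using g PSL2Z_subset by blast
    have "h \<in> pi_hf \<nu> g \<alpha>"
      using assms h hf_equiv_refl[OF h(1)] g by (auto simp: automorphic_def mem_hf_class)
    then obtain k where "hf_equiv h k" "hf_equiv (pi_rep \<nu> g k) h"
      using h by (auto simp: pi_hf_def mem_hf_class)
    then show ?thesis using hf_equiv_pi_rep[OF gR] hf_equiv_trans by blast
  qed
  moreover have "mS \<in> PSL2Z" "mT 1 \<in> PSL2Z" by (auto simp: mS_def mT_def PSL2Z_def)
  ultimately show ?thesis using h that by blast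
qed

subsection \<open>Cauchy transforms, splitting at a point and on an annulus\<close>

text \<open>Holomorphy is differentiation under the integral sign, decay at infinity the length
  estimate. That estimate is the assumption \<open>bnd\<close>, with \<open>L\<close> in the role of
  the length, so that segments and circles share the proof.\<close>

lemma cauchy_transform:
  assumes g: "valid_path \<gamma>" "\<forall>t\<in>{0..1}. norm (vector_derivative \<gamma> (at t)) \<le> B"
    and bnd: "\<forall>f M. f contour_integrable_on \<gamma> \<longrightarrow> M \<ge> 0 \<longrightarrow> (\<forall>w\<in>path_image \<gamma>. norm (f w) \<le> M)
      \<longrightarrow> norm (contour_integral \<gamma> f) \<le> M * L"
    and u: "u holomorphic_on S" "open S" "path_image \<gamma> \<subseteq> S"
  shows "(\<lambda>z. contour_integral \<gamma> (\<lambda>w. u w / (w - z))) holomorphic_on - path_image \<gamma>"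
    and "((\<lambda>z. contour_integral \<gamma> (\<lambda>w. u w / (w - z))) \<longlongrightarrow> 0) at_infinity"
    and "\<And>z. z \<notin> path_image \<gamma> \<Longrightarrow> (\<lambda>w. u w / (w - z)) contour_integrable_on \<gamma>"
proof -
  show int: "(\<lambda>w. u w / (w - z)) contour_integrable_on \<gamma>" if "z \<notin> path_image \<gamma>" for z
    by (rule contour_integrable_holomorphic_simple[of _ "S - {z}"])
      (use u g that in \<open>auto intro!: holomorphic_intros elim: holomorphic_on_subset\<close>)
  have cont: "continuous_on (path_image \<gamma>) u"
    using u holomorphic_on_imp_continuous_on continuous_on_subset by blast
  let ?E = "\<lambda>z. contour_integral \<gamma> (\<lambda>w. u w / (w - z))"
  have "\<exists>D. (?E has_field_derivative D) (at z)" if "z \<notin> path_image \<gamma>" for z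
  proof -
    have "(?E has_field_derivative of_nat 1 * contour_integral \<gamma> (\<lambda>w. u w / (w - z)^Suc 1)) (at z)"
    proof (rule Cauchy_next_derivative(2)[where S = UNIV and k = 1 and B = B and f' = u])
      show "((\<lambda>x. u x / (x - w) ^ 1) has_contour_integral ?E w) \<gamma>" if "w \<in> UNIV - path_image \<gamma>" for w
        using int[of w] that by (simp add: has_contour_integral_integral)
    qed (use that g cont in auto)
    then show ?thesis by blast
  qed
  then show "?E holomorphic_on - path_image \<gamma>"
    using field_differentiable_at_within unfolding holomorphic_on_def field_differentiable_def
    by (meson ComplD has_field_derivative_at_within)
  have comp: "compact (path_image \<gamma>)" using g by (simp add: compact_path_image valid_path_imp_path)
  then obtain R where R: "R > 0" "\<And>w. w \<in> path_image \<gamma> \<Longrightarrow> norm w \<le> R"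
    using compact_imp_bounded bounded_pos by metis
  have "compact (u ` path_image \<gamma>)" using comp cont compact_continuous_image by blast
  then obtain M where M: "M > 0" "\<And>w. w \<in> path_image \<gamma> \<Longrightarrow> norm (u w) \<le> M"
    using compact_imp_bounded bounded_pos by (metis imageI)
  have ev: "\<forall>\<^sub>F z in at_infinity. norm (?E z) \<le> M * L / (norm z - R)"
    unfolding eventually_at_infinity
  proof (intro exI[of _ "R + 1"] allI impI)
    fix z :: complex assume z: "R + 1 \<le> norm z"
    have "norm (?E z) \<le> M / (norm z - R) * L"
    proof (rule bnd[rule_format])
      show "(\<lambda>w. u w / (w - z)) contour_integrable_on \<gamma>" using int[of z] R z by force
      show "0 \<le> M / (norm z - R)" using M z by auto
      fix w assume w: "w \<in> path_image \<gamma>"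
      have "norm z - R \<le> norm (w - z)"
        using R(2)[OF w] norm_triangle_ineq2[of z w] by (simp add: norm_minus_commute)
      then show "norm (u w / (w - z)) \<le> M / (norm z - R)"
        unfolding norm_divide using M(2)[OF w] z M(1) by (intro frac_le) auto
    qed
    then show "norm (?E z) \<le> M * L / (norm z - R)" by simp
  qed
  have "((\<lambda>z::complex. M * L / (norm z - R)) \<longlongrightarrow> 0) at_infinity"
  proof (rule tendsto_divide_0[OF tendsto_const])
    have "filterlim (\<lambda>z::complex. - R + norm z) at_top at_infinity"
      by (rule filterlim_tendsto_add_at_top[OF tendsto_const filterlim_norm_at_top])
    then show "filterlim (\<lambda>z::complex. norm z - R) at_infinity at_infinity"
      by (simp add: filterlim_at_top_imp_at_infinity)
  qed
  then show "(?E \<longlongrightarrow> 0) at_infinity"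
    using ev by (rule Lim_null_comparison[rotated])
qed

lemma cauchy_transform_linepath:
  assumes "u holomorphic_on S" "open S" "closed_segment a b \<subseteq> S"
  shows "(\<lambda>z. contour_integral (linepath a b) (\<lambda>w. u w / (w - z))) holomorphic_on - closed_segment a b"
    and "((\<lambda>z. contour_integral (linepath a b) (\<lambda>w. u w / (w - z))) \<longlongrightarrow> 0) at_infinity"
    and "\<And>z. z \<notin> closed_segment a b \<Longrightarrow> (\<lambda>w. u w / (w - z)) contour_integrable_on linepath a b"
proof -
  have bnd: "\<forall>f M. f contour_integrable_on linepath a b \<longrightarrow> M \<ge> 0 \<longrightarrow> (\<forall>w\<in>path_image (linepath a b). norm (f w) \<le> M)
      \<longrightarrow> norm (contour_integral (linepath a b) f) \<le> M * norm (b - a)"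
    by (auto intro!: contour_integral_bound_linepath)
  have der: "\<forall>t\<in>{0..1}. norm (vector_derivative (linepath a b) (at t)) \<le> norm (b - a)" by simp
  have im: "path_image (linepath a b) \<subseteq> S" using assms(3) by simp
  note * = cauchy_transform[OF valid_path_linepath der bnd assms(1,2) im, unfolded path_image_linepath]
  show "(\<lambda>z. contour_integral (linepath a b) (\<lambda>w. u w / (w - z))) holomorphic_on - closed_segment a b"
    "((\<lambda>z. contour_integral (linepath a b) (\<lambda>w. u w / (w - z))) \<longlongrightarrow> 0) at_infinity"
    "\<And>z. z \<notin> closed_segment a b \<Longrightarrow> (\<lambda>w. u w / (w - z)) contour_integrable_on linepath a b"
    by (fact *)+
qed

lemma cauchy_transform_circlepath:
  assumes "u holomorphic_on S" "open S" "sphere c r \<subseteq> S" "r > 0"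
  shows "(\<lambda>z. contour_integral (circlepath c r) (\<lambda>w. u w / (w - z))) holomorphic_on - sphere c r"
    and "((\<lambda>z. contour_integral (circlepath c r) (\<lambda>w. u w / (w - z))) \<longlongrightarrow> 0) at_infinity"
    and "\<And>z. z \<notin> sphere c r \<Longrightarrow> (\<lambda>w. u w / (w - z)) contour_integrable_on circlepath c r"
proof -
  have bnd: "\<forall>f M. f contour_integrable_on circlepath c r \<longrightarrow> M \<ge> 0 \<longrightarrow> (\<forall>w\<in>path_image (circlepath c r). norm (f w) \<le> M)
      \<longrightarrow> norm (contour_integral (circlepath c r) f) \<le> M * (2 * pi * r)"
    using assms(4)
    by (auto intro!: has_contour_integral_bound_circlepath[OF has_contour_integral_integral] simp: dist_norm norm_minus_commute)
  have der: "\<forall>t\<in>{0..1}. norm (vector_derivative (circlepath c r) (at t)) \<le> 2 * pi * r"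
    using assms(4) by (simp add: vector_derivative_circlepath norm_mult)
  have sph: "path_image (circlepath c r) = sphere c r" using assms(4) by simp
  have im: "path_image (circlepath c r) \<subseteq> S" using assms(3,4) by simp
  note * = cauchy_transform[OF valid_path_circlepath der bnd assms(1,2) im, unfolded sph]
  show "(\<lambda>z. contour_integral (circlepath c r) (\<lambda>w. u w / (w - z))) holomorphic_on - sphere c r"
    "((\<lambda>z. contour_integral (circlepath c r) (\<lambda>w. u w / (w - z))) \<longlongrightarrow> 0) at_infinity"
    "\<And>z. z \<notin> sphere c r \<Longrightarrow> (\<lambda>w. u w / (w - z)) contour_integrable_on circlepath c r"
    by (fact *)+
qed

lemma closed_segment_coord:
  fixes z :: complex
  assumes "z \<in> closed_segment a b"
  shows "Re z \<in> closed_segment (Re a) (Re b)" "Im z \<in> closed_segment (Im a) (Im b)"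
  using assms by (auto simp: closed_segment_def)

text \<open>The two functions are the Cauchy transforms of \<open>u\<close> along the left side of a small square and
  along its three other sides.\<close>

lemma local_splitting:
  fixes z0 :: complex and u :: "complex \<Rightarrow> complex"
  assumes "u analytic_on {z0}" "\<epsilon> > 0"
  obtains \<eta> eL eR where "\<eta> > 0" "\<eta> < \<epsilon>"
    "\<And>z. \<bar>Im (z - z0)\<bar> > \<eta> \<or> \<bar>Re (z - z0)\<bar> > \<eta> \<or> (\<bar>Im (z - z0)\<bar> < \<eta> \<and> Re (z - z0) < \<eta>) \<Longrightarrow> eR analytic_on {z}"
    "\<And>z. \<bar>Im (z - z0)\<bar> > \<eta> \<or> \<bar>Re (z - z0)\<bar> > \<eta> \<or> Re (z - z0) > - \<eta> \<Longrightarrow> eL analytic_on {z}"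
    "\<And>z. \<bar>Im (z - z0)\<bar> < \<eta> \<Longrightarrow> \<bar>Re (z - z0)\<bar> < \<eta> \<Longrightarrow> eR z - eL z = u z"
    "\<And>z. \<bar>Im (z - z0)\<bar> > \<eta> \<or> \<bar>Re (z - z0)\<bar> > \<eta> \<Longrightarrow> eR z = eL z"
    "(eL \<longlongrightarrow> 0) at_infinity"
proof -
  obtain r where r: "r > 0" "u holomorphic_on ball z0 r"
    using assms analytic_at_ball by blast
  \<comment> \<open>The square of half side \<eta> has to fit into the disc of radius
    \<open>r\<close>: its points are within 2 \<eta> \<le> r/2 of the centre.\<close>
  define \<eta> where "\<eta> = min (r/4) (\<epsilon>/2)"
  have \<eta>: "\<eta> > 0" "\<eta> < \<epsilon>" "4 * \<eta> \<le> r" using r assms by (auto simp: \<eta>_def)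
  define a1 where "a1 = z0 - Complex \<eta> \<eta>"
  define a3 where "a3 = z0 + Complex \<eta> \<eta>"
  define a2 where "a2 = Complex (Re a3) (Im a1)"
  define a4 where "a4 = Complex (Re a1) (Im a3)"
  have ReIm [simp]: "Re a1 = Re z0 - \<eta>" "Im a1 = Im z0 - \<eta>" "Re a3 = Re z0 + \<eta>" "Im a3 = Im z0 + \<eta>"
    "Re a2 = Re z0 + \<eta>" "Im a2 = Im z0 - \<eta>" "Re a4 = Re z0 - \<eta>" "Im a4 = Im z0 + \<eta>"
    by (simp_all add: a1_def a2_def a3_def a4_def)
  let ?S = "ball z0 r" and ?Q = "cbox a1 a3"
  have Q: "z \<in> ?Q \<longleftrightarrow> \<bar>Re (z - z0)\<bar> \<le> \<eta> \<and> \<bar>Im (z - z0)\<bar> \<le> \<eta>" for z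
    by (auto simp: in_cbox_complex_iff)
  have QS: "?Q \<subseteq> ?S"
  proof
    fix z assume "z \<in> ?Q"
    then have "norm (z - z0) \<le> 2 * \<eta>" using cmod_le[of "z - z0"] unfolding Q by linarith
    then show "z \<in> ?S" using \<eta> by (simp add: dist_norm norm_minus_commute)
  qed
  have segs: "closed_segment a1 a2 \<subseteq> ?Q" "closed_segment a2 a3 \<subseteq> ?Q" "closed_segment a3 a4 \<subseteq> ?Q" "closed_segment a4 a1 \<subseteq> ?Q"
    using \<eta> by (intro closed_segment_subset; auto simp: in_cbox_complex_iff)+
  define I where "I = (\<lambda>a b z. contour_integral (linepath a b) (\<lambda>w. u w / (w - z)))"
  have seg: "I a b analytic_on {z}" if "closed_segment a b \<subseteq> ?Q" "z \<notin> closed_segment a b" for a b z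
    unfolding I_def analytic_at
    by (intro exI[of _ "- closed_segment a b"]) (use that QS r cauchy_transform_linepath(1)[of u ?S a b] in auto)
  define eR where "eR = (\<lambda>z. (I a1 a2 z + I a2 a3 z + I a3 a4 z) / (2 * of_real pi * \<i>))"
  \<comment> \<open>The minus sign makes \<open>eR - eL\<close> the Cauchy integral over the whole
    boundary: it is \<open>u\<close> inside and 0 outside, while each function alone is singular
    only on its own sides.\<close>
  define eL where "eL = (\<lambda>z. - I a4 a1 z / (2 * of_real pi * \<i>))"
  have nR: "z \<notin> closed_segment a1 a2 \<and> z \<notin> closed_segment a2 a3 \<and> z \<notin> closed_segment a3 a4"
    if "\<bar>Im (z - z0)\<bar> > \<eta> \<or> \<bar>Re (z - z0)\<bar> > \<eta> \<or> (\<bar>Im (z - z0)\<bar> < \<eta> \<and> Re (z - z0) < \<eta>)" for z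
    using that segs Q[of z] closed_segment_coord[of z a1 a2] closed_segment_coord[of z a2 a3] closed_segment_coord[of z a3 a4] by auto
  have nL: "z \<notin> closed_segment a4 a1"
    if "\<bar>Im (z - z0)\<bar> > \<eta> \<or> \<bar>Re (z - z0)\<bar> > \<eta> \<or> Re (z - z0) > - \<eta>" for z
    using that segs Q[of z] closed_segment_coord[of z a4 a1] by auto
  have aR: "eR analytic_on {z}"
    if "\<bar>Im (z - z0)\<bar> > \<eta> \<or> \<bar>Re (z - z0)\<bar> > \<eta> \<or> (\<bar>Im (z - z0)\<bar> < \<eta> \<and> Re (z - z0) < \<eta>)" for z
    unfolding eR_def using nR[OF that] segs by (intro analytic_intros seg) auto
  have aL: "eL analytic_on {z}"
    if "\<bar>Im (z - z0)\<bar> > \<eta> \<or> \<bar>Re (z - z0)\<bar> > \<eta> \<or> Re (z - z0) > - \<eta>" for z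
    unfolding eL_def using nL[OF that] segs by (intro analytic_intros seg) auto
  have rect: "eR z - eL z = contour_integral (rectpath a1 a3) (\<lambda>w. u w / (w - z)) / (2 * of_real pi * \<i>)"
    if "z \<notin> closed_segment a1 a2" "z \<notin> closed_segment a2 a3" "z \<notin> closed_segment a3 a4" "z \<notin> closed_segment a4 a1" for z
  proof -
    have int: "(\<lambda>w. u w / (w - z)) contour_integrable_on linepath a b"
      if "closed_segment a b \<subseteq> ?Q" "z \<notin> closed_segment a b" for a b
      using that QS r cauchy_transform_linepath(3)[of u ?S a b z] by auto
    have "contour_integral (rectpath a1 a3) (\<lambda>w. u w / (w - z)) = I a1 a2 z + I a2 a3 z + I a3 a4 z + I a4 a1 z"
      unfolding rectpath_def Let_def I_def a2_def[symmetric] a4_def[symmetric]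
      using int segs that
      by (simp add: contour_integrable_join valid_path_join)
    then show ?thesis by (simp add: eR_def eL_def field_simps)
  qed
  have uQ: "u holomorphic_on ?Q" using r QS holomorphic_on_subset by blast
  have vp: "valid_path (rectpath a1 a3)" "pathfinish (rectpath a1 a3) = pathstart (rectpath a1 a3)" "path_image (rectpath a1 a3) \<subseteq> ?Q"
    using \<eta> by (auto intro!: path_image_rectpath_subset_cbox[THEN subsetD])
  have inn: "eR z - eL z = u z" if "\<bar>Im (z - z0)\<bar> < \<eta>" "\<bar>Re (z - z0)\<bar> < \<eta>" for z
  proof -
    have zb: "z \<in> box a1 a3" using that by (auto simp: in_box_complex_iff)
    have "z \<notin> path_image (rectpath a1 a3)" using path_image_rectpath_inter_box[of a1 a3] zb \<eta> by auto
    then have "((\<lambda>w. u w / (w - z)) has_contour_integral (2*pi * \<i> * winding_number (rectpath a1 a3) z * u z)) (rectpath a1 a3)"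
      using zb vp uQ by (intro Cauchy_integral_formula_convex_simple[of ?Q]) auto
    then have "contour_integral (rectpath a1 a3) (\<lambda>w. u w / (w - z)) = 2*pi * \<i> * u z"
      using winding_number_rectpath[OF zb] contour_integral_unique by force
    moreover have "z \<notin> closed_segment a4 a1" using that nL[of z] by auto
    ultimately show ?thesis using rect[of z] nR[of z] that by auto
  qed
  have out: "eR z = eL z" if "\<bar>Im (z - z0)\<bar> > \<eta> \<or> \<bar>Re (z - z0)\<bar> > \<eta>" for z
  proof -
    have zQ: "z \<notin> ?Q" using that Q by auto
    then have "((\<lambda>w. u w / (w - z)) has_contour_integral 0) (rectpath a1 a3)"
      using vp uQ by (intro Cauchy_theorem_convex_simple[of _ ?Q]) (auto intro!: holomorphic_intros)
    then have "contour_integral (rectpath a1 a3) (\<lambda>w. u w / (w - z)) = 0"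
      using contour_integral_unique by blast
    then show ?thesis using rect[of z] zQ segs by auto
  qed
  have "(I a4 a1 \<longlongrightarrow> 0) at_infinity"
    unfolding I_def by (rule cauchy_transform_linepath(2)[of u ?S]) (use segs QS r in auto)
  then have "(eL \<longlongrightarrow> - 0 / (2 * of_real pi * \<i>)) at_infinity"
    unfolding eL_def by (intro tendsto_intros) auto
  then show ?thesis using that[of \<eta> eR eL] \<eta> aR aL inn out by simp
qed

text \<open>The Laurent decomposition, by Cauchy integrals over an outer and an inner circle.
  \<open>B\<close> is holomorphic only beyond the inner circle of integration, so the decomposition
  starts at a radius \<open>r1\<close> above \<open>r\<close>.\<close>

lemma annulus_splitting:
  fixes F :: "complex \<Rightarrow> complex"
  assumes F: "F holomorphic_on {q. r < norm q \<and> norm q < R}" and rR: "0 \<le> r" "r < R"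
  obtains r1 A B where "r < r1" "r1 < R" "A holomorphic_on ball 0 R" "B holomorphic_on {q. r1 < norm q}"
    "(B \<longlongrightarrow> 0) at_infinity" "\<And>q. r1 < norm q \<Longrightarrow> norm q < R \<Longrightarrow> F q = A q + B q"
proof -
  define r1 where "r1 = (2*r + R) / 3"
  define r2 where "r2 = (r + 2*R) / 3"
  have rr: "r < r1" "r1 < r2" "r2 < R" "0 < r1" "0 < r2" using rR by (auto simp: r1_def r2_def)
  define S where "S = {q::complex. r < norm q \<and> norm q < R}"
  have opS: "open S" unfolding S_def by (intro open_Collect_conj open_Collect_less continuous_intros)
  define C where "C = (\<lambda>\<rho> z. contour_integral (circlepath 0 \<rho>) (\<lambda>w. F w / (w - z)) / (2 * of_real pi * \<i>))"
  have sph: "sphere 0 r1 \<subseteq> S" "sphere 0 r2 \<subseteq> S" using rr by (auto simp: S_def)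
  have FS: "F holomorphic_on S" using F by (simp add: S_def)
  have C1: "C \<rho> holomorphic_on - sphere 0 \<rho>" "(C \<rho> \<longlongrightarrow> 0) at_infinity" if "sphere 0 \<rho> \<subseteq> S" "\<rho> > 0" for \<rho>
  proof -
    show "C \<rho> holomorphic_on - sphere 0 \<rho>" unfolding C_def
      using cauchy_transform_circlepath(1)[OF FS opS that] by (intro holomorphic_intros) auto
    have "(C \<rho> \<longlongrightarrow> 0 / (2 * of_real pi * \<i>)) at_infinity" unfolding C_def
      using cauchy_transform_circlepath(2)[OF FS opS that] by (intro tendsto_intros) auto
    then show "(C \<rho> \<longlongrightarrow> 0) at_infinity" by simp
  qed
  have split: "F z = C r2 z - C r1 z" if z: "r1 < norm z" "norm z < r2" for z
  proof -
    have zS: "z \<in> S" using z rr by (auto simp: S_def)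
    \<comment> \<open>Cauchy's formula for the annulus: the difference quotient has a removable
      singularity at \<open>z\<close>, so its integrals over the two homotopic circles agree.
      Splitting off the kernel 1 / (w - z), whose integrals are 0 and 2 \<pi> i, leaves the
      formula.\<close>
    define \<phi> where "\<phi> = (\<lambda>w. if w = z then deriv F z else (F w - F z) / (w - z))"
    have hol: "\<phi> holomorphic_on S" unfolding \<phi>_def
      by (rule pole_lemma) (use FS zS opS in \<open>auto simp: interior_open\<close>)
    have "homotopic_loops S (circlepath 0 r1) (circlepath 0 r2)"
    proof (rule homotopic_loops_linear)
      fix t :: real
      have e: "circlepath 0 \<rho> t = of_real \<rho> * exp (2 * of_real pi * \<i> * of_real t)" for \<rho>
        by (simp add: circlepath)
      show "closed_segment (circlepath 0 r1 t) (circlepath 0 r2 t) \<subseteq> S"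
      proof
        fix x assume "x \<in> closed_segment (circlepath 0 r1 t) (circlepath 0 r2 t)"
        then obtain v where v: "0 \<le> v" "v \<le> 1" "x = (1 - v) *\<^sub>R circlepath 0 r1 t + v *\<^sub>R circlepath 0 r2 t"
          by (auto simp: closed_segment_def)
        then have "x = of_real ((1 - v) * r1 + v * r2) * exp (2 * of_real pi * \<i> * of_real t)"
          unfolding e by (simp add: scaleR_conv_of_real algebra_simps)
        then have "norm x = \<bar>(1 - v) * r1 + v * r2\<bar>"
          by (simp only: norm_mult norm_of_real) (simp add: norm_exp_eq_Re)
        moreover have "(1 - v) * r1 + v * r2 = r1 + v * (r2 - r1)" by (simp add: algebra_simps)
        moreover have D: "0 \<le> v * (r2 - r1)" "v * (r2 - r1) \<le> r2 - r1"
          using v(1,2) rr by (simp_all add: mult_left_le_one_le)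
        ultimately have "norm x = r1 + v * (r2 - r1)" using rr by simp
        then have "r < norm x" "norm x < R" using D rr by linarith+
        then show "x \<in> S" by (simp add: S_def)
      qed
    qed auto
    then have eq: "contour_integral (circlepath 0 r1) \<phi> = contour_integral (circlepath 0 r2) \<phi>"
      by (rule Cauchy_theorem_homotopic_loops) (use opS hol in auto)
    have dec: "contour_integral (circlepath 0 \<rho>) \<phi> = 2 * of_real pi * \<i> * C \<rho> z - F z * contour_integral (circlepath 0 \<rho>) (\<lambda>w. 1 / (w - z))"
      and dec2: "(\<lambda>w. 1 / (w - z)) contour_integrable_on circlepath 0 \<rho>"
      if "sphere 0 \<rho> \<subseteq> S" "\<rho> > 0" "norm z \<noteq> \<rho>" for \<rho>
    proof -
      have nz: "z \<notin> sphere 0 \<rho>" using that by auto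
      have i1: "(\<lambda>w. F w / (w - z)) contour_integrable_on circlepath 0 \<rho>"
        by (rule cauchy_transform_circlepath(3)[OF FS opS that(1,2) nz])
      show i2: "(\<lambda>w. 1 / (w - z)) contour_integrable_on circlepath 0 \<rho>"
        by (rule cauchy_transform_circlepath(3)[OF _ opS that(1,2) nz]) auto
      have "contour_integral (circlepath 0 \<rho>) \<phi> = contour_integral (circlepath 0 \<rho>) (\<lambda>w. F w / (w - z) - F z * (1 / (w - z)))"
        by (rule contour_integral_cong) (use nz that(2) in \<open>auto simp: \<phi>_def diff_divide_distrib\<close>)
      also have "\<dots> = contour_integral (circlepath 0 \<rho>) (\<lambda>w. F w / (w - z)) - contour_integral (circlepath 0 \<rho>) (\<lambda>w. F z * (1 / (w - z)))"
        by (rule contour_integral_diff[OF i1 contour_integrable_lmul[OF i2]])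
      also have "contour_integral (circlepath 0 \<rho>) (\<lambda>w. F z * (1 / (w - z))) = F z * contour_integral (circlepath 0 \<rho>) (\<lambda>w. 1 / (w - z))"
        by (rule contour_integral_lmul[OF i2])
      finally show "contour_integral (circlepath 0 \<rho>) \<phi> = 2 * of_real pi * \<i> * C \<rho> z - F z * contour_integral (circlepath 0 \<rho>) (\<lambda>w. 1 / (w - z))"
        by (simp add: C_def)
    qed
    have k1: "contour_integral (circlepath 0 r1) (\<lambda>w. 1 / (w - z)) = 0"
    proof -
      have "((\<lambda>w. 1 / (w - z)) has_contour_integral 0) (circlepath 0 r1)"
        by (rule Cauchy_theorem_convex_simple[of _ "cball 0 r1"]) (use z rr in \<open>auto intro!: holomorphic_intros\<close>)
      then show ?thesis by (rule contour_integral_unique)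
    qed
    have k2: "contour_integral (circlepath 0 r2) (\<lambda>w. 1 / (w - z)) = 2 * of_real pi * \<i>"
    proof -
      have "((\<lambda>w. 1 / (w - z)) has_contour_integral (2 * of_real pi * \<i> * 1)) (circlepath 0 r2)"
        by (rule Cauchy_integral_circlepath[of 0 r2 "\<lambda>_. 1"]) (use z in auto)
      then show ?thesis using contour_integral_unique by force
    qed
    have "2 * of_real pi * \<i> * C r1 z = 2 * of_real pi * \<i> * C r2 z - F z * (2 * of_real pi * \<i>)"
      using eq dec[OF sph(1)] dec[OF sph(2)] rr z k1 k2 by simp
    then have "2 * of_real pi * \<i> * C r1 z = 2 * of_real pi * \<i> * (C r2 z - F z)"
      by (simp add: algebra_simps)
    then have "C r1 z = C r2 z - F z" by (subst (asm) mult_cancel_left) simp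
    then show ?thesis by simp
  qed
  define B where "B = (\<lambda>q. - C r1 q)"
  \<comment> \<open>\<open>C r2\<close> is usable only inside its circle of integration;
    \<open>F - B\<close> continues it up to radius \<open>R\<close>.\<close>
  define A where "A = (\<lambda>q. if q \<in> ball 0 r2 then C r2 q else F q - B q)"
  have Bh: "B holomorphic_on {q. r1 < norm q}" unfolding B_def
    by (intro holomorphic_intros holomorphic_on_subset[OF C1(1)[OF sph(1)]]) (use rr in auto)
  have "A holomorphic_on (ball 0 r2 \<union> {q. r1 < norm q \<and> norm q < R})" unfolding A_def
  proof (rule holomorphic_on_If_Un)
    show "C r2 holomorphic_on ball 0 r2"
      by (rule holomorphic_on_subset[OF C1(1)[OF sph(2)]]) (use rr in auto)
    show "(\<lambda>q. F q - B q) holomorphic_on {q. r1 < norm q \<and> norm q < R}"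
      by (intro holomorphic_intros holomorphic_on_subset[OF FS] holomorphic_on_subset[OF Bh]) (use rr in \<open>auto simp: S_def\<close>)
    show "open {q::complex. r1 < norm q \<and> norm q < R}"
      by (intro open_Collect_conj open_Collect_less continuous_intros)
    show "C r2 q = F q - B q" if "q \<in> ball 0 r2" "q \<in> {q. r1 < norm q \<and> norm q < R}" for q
      using split[of q] that by (auto simp: B_def)
  qed auto
  moreover have "ball 0 r2 \<union> {q::complex. r1 < norm q \<and> norm q < R} = ball 0 R" using rr by auto
  ultimately have Ah: "A holomorphic_on ball 0 R" by simp
  have "F q = A q + B q" if "r1 < norm q" "norm q < R" for q
    using split[of q] that by (auto simp: A_def B_def)
  moreover have "(B \<longlongrightarrow> 0) at_infinity"
    unfolding B_def using tendsto_minus[OF C1(2)[OF sph(1)]] rr by simp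
  ultimately show ?thesis using that[of r1 A B] rr Ah Bh by auto
qed

subsection \<open>Periodic representatives on the real line\<close>

lemma analytic_at_imp_tendsto_nhds:
  "f analytic_on {x} \<Longrightarrow> (f \<longlongrightarrow> f x) (nhds x)"
  using analytic_at_imp_isCont[of f x] unfolding isCont_def tendsto_at_iff_tendsto_nhds .

lemma ext_at_shift_nat:
  assumes "\<And>x. x \<in> \<real> \<Longrightarrow> ext_at (\<lambda>z. f z - f (z - 1)) x" "x \<in> \<real>"
  shows "ext_at (\<lambda>z. f z - f (z - of_nat n)) x"
proof (induction n)
  case 0
  then show ?case by simp
next
  case (Suc n)
  have "ext_at (\<lambda>z. f (z - of_nat n) - f (z - of_nat n - 1)) x"
    by (rule ext_at_compose[of "\<lambda>z. f z - f (z - 1)" "\<lambda>z. z - of_nat n"])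
      (use assms in \<open>auto intro!: analytic_intros simp: complex_is_Real_iff\<close>)
  from ext_at_add[OF Suc this] show ?case by (simp add: algebra_simps)
qed

lemma ext_at_shift_int:
  assumes "\<And>x. x \<in> \<real> \<Longrightarrow> ext_at (\<lambda>z. f z - f (z - 1)) x" "x \<in> \<real>"
  shows "ext_at (\<lambda>z. f z - f (z - of_int n)) x"
proof (cases "n \<ge> 0")
  case True
  then show ?thesis using ext_at_shift_nat[of f x "nat n"] assms by simp
next
  case False
  have "ext_at (\<lambda>z. f (z - of_int n) - f (z - of_int n - of_nat (nat (-n)))) x"
    by (rule ext_at_compose[of "\<lambda>z. f z - f (z - of_nat (nat (-n)))" "\<lambda>z. z - of_int n"], rule ext_at_shift_nat)
      (use assms in \<open>auto intro!: analytic_intros simp: complex_is_Real_iff\<close>)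
  from ext_at_minus[OF this] show ?thesis using False by simp
qed

lemma exp_2pi_i_Ln: "q \<noteq> 0 \<Longrightarrow> exp (2 * of_real pi * \<i> * (Ln q / (2 * of_real pi * \<i>))) = q"
  by simp

lemma norm_exp_2pi_i: "norm (exp (2 * of_real pi * \<i> * z)) = exp (- 2 * pi * Im z)"
  by (simp add: norm_exp_eq_Re)

lemma norm_exp_2pi_i_less_1: "norm (exp (2 * of_real pi * \<i> * z)) < 1 \<longleftrightarrow> Im z > 0"
  "norm (exp (2 * of_real pi * \<i> * z)) > 1 \<longleftrightarrow> Im z < 0"
  unfolding norm_exp_2pi_i by (auto simp: mult_less_0_iff zero_less_mult_iff)

lemma Ln_2pi_i_nonreal:
  assumes "norm q \<noteq> 1" "q \<noteq> 0"
  shows "Ln q / (2 * of_real pi * \<i>) \<notin> \<real>"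
proof
  assume "Ln q / (2 * of_real pi * \<i>) \<in> \<real>"
  then have "Im (Ln q / (2 * of_real pi * \<i>)) = 0" by (simp add: complex_is_Real_iff)
  then have "norm (exp (2 * of_real pi * \<i> * (Ln q / (2 * of_real pi * \<i>)))) = 1"
    unfolding norm_exp_2pi_i by simp
  then show False using assms(1) unfolding exp_2pi_i_Ln[OF assms(2)] by simp
qed

text \<open>In the coordinate \<open>q = exp (2 \<pi> i z)\<close> the window \<open>-1/2 < Re z \<le> 1/2\<close> becomes the plane cut along
  the negative axis; splitting the defect \<open>f0 z - f0 (z - 1)\<close> at \<open>q = -1\<close> closes the cut.\<close>

lemma circle_representative:
  assumes hol: "\<And>x. x \<in> \<real> \<Longrightarrow> hol_near f0 x"
    and inv: "\<And>x. x \<in> \<real> \<Longrightarrow> ext_at (\<lambda>z. f0 z - f0 (z - 1)) x"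
  obtains F where
    "\<And>q0. norm q0 = 1 \<Longrightarrow> \<forall>\<^sub>F q in nhds q0. norm q \<noteq> 1 \<longrightarrow> F analytic_on {q}"
    "\<And>x. x \<in> \<real> \<Longrightarrow> ext_at (\<lambda>z. f0 z - F (exp (2 * of_real pi * \<i> * z))) x"
proof -
  let ?c = "2 * of_real pi * \<i> :: complex"
  let ?e = "\<lambda>z. exp (?c * z)"
  obtain g where g: "g analytic_on {1/2}" "\<forall>\<^sub>F z in at_nonreal (1/2). f0 z - f0 (z - 1) = g z"
    using inv[of "1/2"] by (auto simp: ext_at_def)
  \<comment> \<open>A logarithm with the cut on the positive axis, analytic at -1 with value 1/2.
    Near -1 it is the principal logarithm divided by 2 \<pi> i on and above the negative axis, and
    exceeds it by 1 below.\<close>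
  define \<mu> where "\<mu> = (\<lambda>q. (Ln (- q) + \<i> * of_real pi) / ?c)"
  have \<mu>1: "\<mu> (-1) = 1/2" by (simp add: \<mu>_def)
  have \<mu>an: "\<mu> analytic_on {-1}" unfolding \<mu>_def by (auto intro!: analytic_intros)
  have e\<mu>: "?e (\<mu> q) = q" if "q \<noteq> 0" for q
    using that by (simp add: \<mu>_def exp_add)
  have \<mu>nr: "\<mu> q \<notin> \<real>" if "norm q \<noteq> 1" "q \<noteq> 0" for q
  proof
    assume "\<mu> q \<in> \<real>"
    then have "Im (\<mu> q) = 0" by (simp add: complex_is_Real_iff)
    then show False using norm_exp_2pi_i[of "\<mu> q"] e\<mu>[OF that(2)] that(1) by simp
  qed
  \<comment> \<open>The substitution q = -1 - i p rotates the tangent of the unit circle at -1 into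
    the real axis of p, the direction in which \<open>local_splitting\<close> separates left from
    right.\<close>
  have "(\<lambda>p. g (\<mu> (- 1 - \<i> * p))) analytic_on {0}"
    by (rule analytic_at_compose[of "\<lambda>p. - 1 - \<i> * p" 0 "\<lambda>q. g (\<mu> q)"], force intro!: analytic_intros,
        rule analytic_at_compose[of \<mu> _ g]) (use \<mu>an g(1)[folded \<mu>1] in auto)
  then obtain \<eta> eL eR where \<eta>: "\<eta> > 0" "\<eta> < 1/2"
    and eR: "\<And>z. \<bar>Im (z - 0)\<bar> > \<eta> \<or> \<bar>Re (z - 0)\<bar> > \<eta> \<or> (\<bar>Im (z - 0)\<bar> < \<eta> \<and> Re (z - 0) < \<eta>) \<Longrightarrow> eR analytic_on {z}"
    and eL: "\<And>z. \<bar>Im (z - 0)\<bar> > \<eta> \<or> \<bar>Re (z - 0)\<bar> > \<eta> \<or> Re (z - 0) > - \<eta> \<Longrightarrow> eL analytic_on {z}"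
    and jump: "\<And>z. \<bar>Im (z - 0)\<bar> < \<eta> \<Longrightarrow> \<bar>Re (z - 0)\<bar> < \<eta> \<Longrightarrow> eR z - eL z = g (\<mu> (- 1 - \<i> * z))"
    and out: "\<And>z. \<bar>Im (z - 0)\<bar> > \<eta> \<or> \<bar>Re (z - 0)\<bar> > \<eta> \<Longrightarrow> eR z = eL z"
    by (rule local_splitting[of "\<lambda>p. g (\<mu> (- 1 - \<i> * p))" 0 "1/2"]) auto
  define EU where "EU = (\<lambda>q. eR (\<i> * (q + 1)))"
  define EL where "EL = (\<lambda>q. eL (\<i> * (q + 1)))"
  have EU: "EU analytic_on {q}"
    if "\<bar>Re q + 1\<bar> > \<eta> \<or> \<bar>Im q\<bar> > \<eta> \<or> (\<bar>Re q + 1\<bar> < \<eta> \<and> Im q > - \<eta>)" for q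
    unfolding EU_def
    by (rule analytic_at_compose[of "\<lambda>q. \<i> * (q + 1)" q eR], force intro!: analytic_intros, rule eR)
      (use that in auto)
  have EL: "EL analytic_on {q}" if "\<bar>Re q + 1\<bar> > \<eta> \<or> \<bar>Im q\<bar> > \<eta> \<or> Im q < \<eta>" for q
    unfolding EL_def
    by (rule analytic_at_compose[of "\<lambda>q. \<i> * (q + 1)" q eL], force intro!: analytic_intros, rule eL)
      (use that in auto)
  have Ejump: "EU q - EL q = g (\<mu> q)" if "\<bar>Re q + 1\<bar> < \<eta>" "\<bar>Im q\<bar> < \<eta>" for q
    using jump[of "\<i> * (q + 1)"] that by (simp add: EU_def EL_def algebra_simps)
  have Eout: "EU q = EL q" if "\<bar>Re q + 1\<bar> > \<eta> \<or> \<bar>Im q\<bar> > \<eta>" for q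
    using out[of "\<i> * (q + 1)"] that by (auto simp: EU_def EL_def)
  \<comment> \<open>Across the negative axis the principal branch jumps by 1, and f0 along it by
    \<open>g (\<mu> q)\<close>, which is \<open>EU q - EL q\<close> near -1: the two corrections
    cancel the jump. On the positive axis they coincide.\<close>
  define F where "F = (\<lambda>q. f0 (Ln q / ?c) - (if Im q \<ge> 0 then EU q else EL q))"
  \<comment> \<open>Near each point of the circle \<open>F\<close> is \<open>f0\<close> along a
    local logarithm \<open>l\<close> minus an analytic correction \<open>E\<close>; both conclusions
    follow from this form.\<close>
  have main: "\<exists>l E. l analytic_on {?e x} \<and> E analytic_on {?e x} \<and> l (?e x) = x \<and>
      (\<forall>\<^sub>F q in nhds (?e x). norm q \<noteq> 1 \<longrightarrow> l q \<notin> \<real> \<and> F q = f0 (l q) - E q) \<and>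
      (\<forall>\<^sub>F z in nhds x. l (?e z) = z)"
    if x: "x \<in> \<real>" "- 1/2 < Re x" "Re x \<le> 1/2" for x
  proof (cases "Re x = 1/2")
    case True
    then have x2: "x = 1/2" using x by (simp add: complex_eq_iff complex_is_Real_iff)
    have ex: "?e x = -1" by (simp add: x2 exp_Euler)
    have cont: "filterlim \<mu> (nhds (1/2)) (nhds (-1))"
      using analytic_at_imp_tendsto_nhds[OF \<mu>an] unfolding \<mu>1 .
    have gev: "\<forall>\<^sub>F q in nhds (-1). \<mu> q \<notin> \<real> \<longrightarrow> f0 (\<mu> q) - f0 (\<mu> q - 1) = g (\<mu> q)"
      using g(2) unfolding eventually_nonreal_nhds[of "1/2::complex", simplified]
      by (rule eventually_compose_filterlim[OF _ cont])
    have "\<forall>\<^sub>F q in nhds (-1::complex). q \<in> box (-1 - Complex \<eta> \<eta>) (-1 + Complex \<eta> \<eta>)"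
      using \<eta> by (intro eventually_nhds_in_open) (auto simp: in_box_complex_iff)
    with gev have "\<forall>\<^sub>F q in nhds (-1). norm q \<noteq> 1 \<longrightarrow> \<mu> q \<notin> \<real> \<and> F q = f0 (\<mu> q) - EU q"
    proof eventually_elim
      case (elim q)
      have q: "\<bar>Re q + 1\<bar> < \<eta>" "\<bar>Im q\<bar> < \<eta>" "Re q < 0" "q \<noteq> 0"
        using elim(2) \<eta> by (auto simp: in_box_complex_iff)
      show ?case
      proof
        assume nq: "norm q \<noteq> 1"
        have nr: "\<mu> q \<notin> \<real>" using \<mu>nr nq q by blast
        show "\<mu> q \<notin> \<real> \<and> F q = f0 (\<mu> q) - EU q"
        proof (cases "Im q \<ge> 0")
          case True
          then have "Ln q = Ln (-q) + \<i> * of_real pi" using Ln_minus[OF q(4)] q(3) by auto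
          then show ?thesis using nr True by (simp add: F_def \<mu>_def)
        next
          case False
          then have "Ln q = Ln (-q) - \<i> * of_real pi" using Ln_minus[OF q(4)] q(3) by auto
          then have "Ln q / ?c = \<mu> q - 1" by (simp add: \<mu>_def field_simps)
          then have "F q = f0 (\<mu> q - 1) - EL q" using False by (simp add: F_def)
          moreover have "f0 (\<mu> q) - f0 (\<mu> q - 1) = EU q - EL q" using elim(1) nr Ejump[OF q(1,2)] by simp
          ultimately have "F q = f0 (\<mu> q) - EU q" by algebra
          then show ?thesis using nr by blast
        qed
      qed
    qed
    moreover have "\<forall>\<^sub>F z in nhds x. \<mu> (?e z) = z"
    proof -
      have "\<forall>\<^sub>F z in nhds x. z \<in> {z. Re z > 0 \<and> Re z < 1}"
        using True by (intro eventually_nhds_in_open open_Collect_conj open_Collect_less continuous_intros) auto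
      then show ?thesis
      proof eventually_elim
        case (elim z)
        have "- ?e z = exp (?c * z - \<i> * of_real pi)" by (simp add: exp_diff exp_Euler)
        moreover have "Ln (exp (?c * z - \<i> * of_real pi)) = ?c * z - \<i> * of_real pi"
          using elim by (intro Ln_exp) (auto simp: algebra_simps)
        ultimately show ?case by (simp add: \<mu>_def)
      qed
    qed
    moreover have "EU analytic_on {-1}" using EU[of "-1"] \<eta> by auto
    moreover have "\<mu> (-1) = x" unfolding \<mu>1 x2 ..
    ultimately show ?thesis using \<mu>an unfolding ex by blast
  next
    case False
    define l where "l = (\<lambda>q. Ln q / ?c)"
    have xr: "- 1/2 < Re x" "Re x < 1/2" "Im x = 0" using x False by (auto simp: complex_is_Real_iff)
    have le: "l (?e z) = z" if "- 1/2 < Re z" "Re z < 1/2" for z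
    proof -
      have "pi * (2 * Re z) < pi * 1" "pi * (-1) < pi * (2 * Re z)"
        using that by (intro mult_strict_left_mono; simp)+
      then have "Ln (?e z) = ?c * z" by (intro Ln_exp) (auto simp: algebra_simps)
      then show ?thesis by (simp add: l_def)
    qed
    define q0 where "q0 = ?e x"
    have lx: "l q0 = x" unfolding q0_def using le xr by blast
    have nq0: "norm q0 = 1" unfolding q0_def norm_exp_2pi_i using xr by simp
    have "q0 \<notin> \<real>\<^sub>\<le>\<^sub>0"
    proof
      assume a: "q0 \<in> \<real>\<^sub>\<le>\<^sub>0"
      then have "q0 = -1" using nq0 by (auto elim!: nonpos_Reals_cases)
      then have "l q0 = 1/2" by (simp add: l_def)
      then have "x = 1/2" unfolding lx .
      then have "Re x = Re (1/2)" by (rule arg_cong)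
      then show False using xr by simp
    qed
    then have lan: "l analytic_on {q0}" unfolding l_def by (auto intro!: analytic_intros)
    have sq: "(Re q0)\<^sup>2 + (Im q0)\<^sup>2 = 1" using nq0 by (metis cmod_power2 one_power2)
    have "\<exists>E. E analytic_on {q0} \<and> (\<forall>\<^sub>F q in nhds q0. E q = (if Im q \<ge> 0 then EU q else EL q))"
    proof (cases "Im q0 = 0")
      case True
      then have "q0 = 1 \<or> q0 = -1" using sq by (auto simp: complex_eq_iff power2_eq_1_iff)
      then have "q0 = 1" using \<open>q0 \<notin> \<real>\<^sub>\<le>\<^sub>0\<close> by auto
      then have "EU analytic_on {q0}" using EU[of 1] \<eta> by auto
      moreover have "\<forall>\<^sub>F q in nhds q0. q \<in> {q. Re q > 0}"
        using \<open>q0 = 1\<close> by (intro eventually_nhds_in_open open_Collect_less continuous_intros) auto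
      then have "\<forall>\<^sub>F q in nhds q0. EU q = (if Im q \<ge> 0 then EU q else EL q)"
      proof eventually_elim
        case (elim q)
        then show ?case using Eout[of q] \<eta> by auto
      qed
      ultimately show ?thesis by blast
    next
      case False
      have *: "Re q0 \<noteq> -1" using sq False by auto
      show ?thesis
      proof (cases "Im q0 > 0")
        case True
        have "EU analytic_on {q0} \<or> EL analytic_on {q0} \<and> False"
        \<comment> \<open>\<open>EU\<close> may also be singular on the two vertical sides of the
          square. The circle avoids them: at height at most \<eta> the right side lies inside the
          unit disc, by the bound on \<eta>, and the left side outside.\<close>
        proof (cases "\<bar>Re q0 + 1\<bar> = \<eta> \<and> Im q0 \<le> \<eta>")
          case True
          then have "Re q0 = \<eta> - 1 \<or> Re q0 = - \<eta> - 1" by auto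
          then have "(Re q0)\<^sup>2 + (Im q0)\<^sup>2 \<noteq> 1"
          proof
            assume r: "Re q0 = \<eta> - 1"
            have "(Im q0)\<^sup>2 \<le> \<eta>\<^sup>2" using True \<open>Im q0 > 0\<close> by (intro power_mono) auto
            then have "(Re q0)\<^sup>2 + (Im q0)\<^sup>2 \<le> 1 - 2 * \<eta> + 2 * \<eta>\<^sup>2" by (simp add: r power2_eq_square algebra_simps)
            also have "\<dots> = 1 - 2 * \<eta> * (1 - \<eta>)" by (simp add: power2_eq_square algebra_simps)
            also have "\<dots> < 1" using \<eta> by simp
            finally show ?thesis by simp
          next
            assume r: "Re q0 = - \<eta> - 1"
            have "(Re q0)\<^sup>2 = 1 + 2 * \<eta> + \<eta>\<^sup>2" by (simp add: r power2_eq_square algebra_simps)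
            then show ?thesis using \<eta> zero_le_power2[of "Im q0"] zero_le_power2[of \<eta>] by linarith
          qed
          then show ?thesis using sq by simp
        next
          case False
          then show ?thesis using EU[of q0] True \<eta> by force
        qed
        then have "EU analytic_on {q0}" by blast
        moreover have "\<forall>\<^sub>F q in nhds q0. q \<in> {q. Im q > 0}"
          using True by (intro eventually_nhds_in_open open_Collect_less continuous_intros) auto
        then have "\<forall>\<^sub>F q in nhds q0. EU q = (if Im q \<ge> 0 then EU q else EL q)"
          by eventually_elim auto
        ultimately show ?thesis by blast
      next
        case False
        with \<open>Im q0 \<noteq> 0\<close> have "Im q0 < 0" by simp
        then have "\<forall>\<^sub>F q in nhds q0. q \<in> {q. Im q < 0}"
          by (intro eventually_nhds_in_open open_Collect_less continuous_intros) auto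
        then have "\<forall>\<^sub>F q in nhds q0. EL q = (if Im q \<ge> 0 then EU q else EL q)"
          by eventually_elim auto
        moreover have "EL analytic_on {q0}" using EL[of q0] \<open>Im q0 < 0\<close> \<eta> by auto
        ultimately show ?thesis by blast
      qed
    qed
    then obtain E where E: "E analytic_on {q0}" "\<forall>\<^sub>F q in nhds q0. E q = (if Im q \<ge> 0 then EU q else EL q)"
      by blast
    have "\<forall>\<^sub>F q in nhds q0. q \<in> -{0}" using nq0 by (intro eventually_nhds_in_open) auto
    with E(2) have "\<forall>\<^sub>F q in nhds q0. norm q \<noteq> 1 \<longrightarrow> l q \<notin> \<real> \<and> F q = f0 (l q) - E q"
      by eventually_elim (use Ln_2pi_i_nonreal in \<open>auto simp: F_def l_def\<close>)
    moreover have "\<forall>\<^sub>F z in nhds x. z \<in> {z. - 1/2 < Re z \<and> Re z < 1/2}"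
      using xr by (intro eventually_nhds_in_open open_Collect_conj open_Collect_less continuous_intros) auto
    then have "\<forall>\<^sub>F z in nhds x. l (?e z) = z" by eventually_elim (use le in auto)
    ultimately show ?thesis using lan E(1) lx unfolding q0_def by blast
  qed
  have F1: "\<forall>\<^sub>F q in nhds q0. norm q \<noteq> 1 \<longrightarrow> F analytic_on {q}" if q0: "norm q0 = 1" for q0
  proof -
    define x where "x = Ln q0 / ?c"
    have "q0 \<noteq> 0" using q0 by auto
    have ex: "?e x = q0" unfolding x_def using exp_2pi_i_Ln[OF \<open>q0 \<noteq> 0\<close>] .
    have ri: "Im x = - ln (norm q0) / (2 * pi)" "Re x = Im (Ln q0) / (2 * pi)"
      using \<open>q0 \<noteq> 0\<close> by (simp_all add: x_def Re_divide Im_divide power2_eq_square)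
    have x: "x \<in> \<real>" "- 1/2 < Re x" "Re x \<le> 1/2"
      using mpi_less_Im_Ln[OF \<open>q0 \<noteq> 0\<close>] Im_Ln_le_pi[OF \<open>q0 \<noteq> 0\<close>] q0 unfolding complex_is_Real_iff ri
      by (simp_all add: pos_less_divide_eq pos_divide_le_eq)
    obtain l E where l: "l analytic_on {q0}" "E analytic_on {q0}" "l q0 = x"
      "\<forall>\<^sub>F q in nhds q0. norm q \<noteq> 1 \<longrightarrow> l q \<notin> \<real> \<and> F q = f0 (l q) - E q"
      using main[OF x] unfolding ex by blast
    have "\<forall>\<^sub>F y in nhds x. y \<notin> \<real> \<longrightarrow> f0 analytic_on {y}"
      using hol[OF x(1)] by (simp add: hol_near_def eventually_nonreal_nhds[OF x(1)])
    moreover have "filterlim l (nhds x) (nhds q0)"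
      using analytic_at_imp_tendsto_nhds[OF l(1)] unfolding l(3) .
    ultimately have "\<forall>\<^sub>F q in nhds q0. l q \<notin> \<real> \<longrightarrow> f0 analytic_on {l q}"
      by (rule eventually_compose_filterlim)
    moreover have "\<forall>\<^sub>F q in nhds q0. \<forall>\<^sub>F q' in nhds q. norm q' \<noteq> 1 \<longrightarrow> l q' \<notin> \<real> \<and> F q' = f0 (l q') - E q'"
      using l(4) by (simp add: eventually_eventually)
    ultimately show ?thesis
      using analytic_eventually_nhds[OF l(1)] analytic_eventually_nhds[OF l(2)]
    proof eventually_elim
      case (elim q)
      show ?case
      proof
        assume nq: "norm q \<noteq> 1"
        have "\<forall>\<^sub>F q' in nhds q. q' \<in> {q. norm q \<noteq> 1}"
          using nq by (intro eventually_nhds_in_open open_Collect_neq continuous_intros) auto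
        with elim(2) have "\<forall>\<^sub>F q' in nhds q. F q' = f0 (l q') - E q'" by eventually_elim auto
        moreover have "l q \<notin> \<real>" using eventually_nhds_x_imp_x[OF elim(2)] nq by blast
        then have "(\<lambda>q. f0 (l q)) analytic_on {q}"
          using elim(1,3) analytic_at_compose[of l q f0] by blast
        then have "(\<lambda>q. f0 (l q) - E q) analytic_on {q}"
          using elim(4) by (intro analytic_intros)
        ultimately show "F analytic_on {q}" by (rule iffD2[OF analytic_on_cong_nhds])
      qed
    qed
  qed
  have F2: "ext_at (\<lambda>z. f0 z - F (?e z)) x" if x: "x \<in> \<real>" "- 1/2 < Re x" "Re x \<le> 1/2" for x
  proof -
    obtain l E where l: "E analytic_on {?e x}"
      "\<forall>\<^sub>F q in nhds (?e x). norm q \<noteq> 1 \<longrightarrow> l q \<notin> \<real> \<and> F q = f0 (l q) - E q"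
      "\<forall>\<^sub>F z in nhds x. l (?e z) = z"
      using main[OF x] by blast
    have ean: "?e analytic_on {x}" by (intro analytic_intros)
    have "filterlim ?e (nhds (?e x)) (nhds x)"
      by (rule analytic_at_imp_tendsto_nhds[OF ean])
    then have "\<forall>\<^sub>F z in nhds x. norm (?e z) \<noteq> 1 \<longrightarrow> l (?e z) \<notin> \<real> \<and> F (?e z) = f0 (l (?e z)) - E (?e z)"
      using l(2) by (rule eventually_compose_filterlim[rotated])
    with l(3) have "\<forall>\<^sub>F z in at_nonreal x. f0 z - F (?e z) = E (?e z)"
      unfolding eventually_nonreal_nhds[OF x(1)]
      by eventually_elim (auto simp: norm_exp_eq_Re complex_is_Real_iff)
    moreover have "(\<lambda>z. E (?e z)) analytic_on {x}"
      by (rule analytic_at_compose[OF ean l(1)])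
    ultimately show ?thesis by (rule ext_atI[rotated])
  qed
  have F3: "ext_at (\<lambda>z. f0 z - F (?e z)) x" if x: "x \<in> \<real>" for x
  proof -
    \<comment> \<open>The ceiling matches the half-open window: the real part of
      \<open>x - n\<close> lands between -1/2, excluded, and 1/2, included.\<close>
    define n where "n = \<lceil>Re x - 1/2\<rceil>"
    have n: "- 1/2 < Re (x - of_int n)" "Re (x - of_int n) \<le> 1/2" unfolding n_def by simp_all linarith+
    have "ext_at (\<lambda>z. f0 (z - of_int n) - F (?e (z - of_int n))) x"
      by (rule ext_at_compose[of "\<lambda>z. f0 z - F (?e z)" "\<lambda>z. z - of_int n"], rule F2)
        (use x n in \<open>auto intro!: analytic_intros simp: complex_is_Real_iff\<close>)
    moreover have "ext_at (\<lambda>z. f0 z - f0 (z - of_int n)) x"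
      by (rule ext_at_shift_int[OF inv x])
    moreover have "?e (z - of_int n) = ?e z" for z
      using exp_plus_2pin[of "?c * z" "-n"] by (simp add: algebra_simps)
    ultimately show ?thesis
      using ext_at_add[of "\<lambda>z. f0 z - f0 (z - of_int n)" x "\<lambda>z. f0 (z - of_int n) - F (?e (z - of_int n))"] by simp
  qed
  show ?thesis using that[OF F1 F3] .
qed

text \<open>\<open>F\<close> is split on a thin annulus inside the circle and, through q -> 1/q, on
  one outside it. Subtracting from \<open>F\<close> both parts that continue across the circle
  leaves functions on the whole disc and on its whole exterior; regularity at q = 0 and at infinity
  becomes the two limits.\<close>

lemma periodic_representative:
  assumes hol: "\<And>x. x \<in> \<real> \<Longrightarrow> hol_near f0 x"
    and inv: "\<And>x. x \<in> \<real> \<Longrightarrow> ext_at (\<lambda>z. f0 z - f0 (z - 1)) x"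
  obtains f L1 L2 where "f holomorphic_on -\<real>" "\<And>z. f (z + 1) = f z"
    "(f \<longlongrightarrow> L1) (filtercomap Im at_top)" "(f \<longlongrightarrow> L2) (filtercomap Im at_bot)"
    "\<And>x. x \<in> \<real> \<Longrightarrow> ext_at (\<lambda>z. f0 z - f z) x"
proof -
  let ?c = "2 * of_real pi * \<i> :: complex"
  let ?e = "\<lambda>z. exp (?c * z)"
  obtain F where F: "\<And>q0. norm q0 = 1 \<Longrightarrow> \<forall>\<^sub>F q in nhds q0. norm q \<noteq> 1 \<longrightarrow> F analytic_on {q}"
    and Fext: "\<And>x. x \<in> \<real> \<Longrightarrow> ext_at (\<lambda>z. f0 z - F (?e z)) x"
    using circle_representative[OF hol inv] by blast
  define U where "U = interior {q. norm q \<noteq> 1 \<longrightarrow> F analytic_on {q}}"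
  have "sphere 0 1 \<subseteq> U"
  proof
    fix q0 :: complex assume "q0 \<in> sphere 0 1"
    then have "\<forall>\<^sub>F q in nhds q0. norm q \<noteq> 1 \<longrightarrow> F analytic_on {q}" using F by simp
    then show "q0 \<in> U" unfolding U_def eventually_nhds interior_def by blast
  qed
  \<comment> \<open>Compactness of the circle provides an annulus of uniform width.\<close>
  then obtain \<kappa> where \<kappa>: "\<kappa> > 0" "(\<Union>x\<in>sphere 0 1. ball x \<kappa>) \<subseteq> U"
    using compact_subset_open_imp_ball_epsilon_subset[of "sphere 0 1" U] by (auto simp: U_def)
  have Fan: "F analytic_on {q}" if "\<bar>norm q - 1\<bar> < \<kappa>" "norm q \<noteq> 1" "q \<noteq> 0" for q
  proof -
    have "q / of_real (norm q) \<in> sphere 0 1" using that by (simp add: norm_divide)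
    moreover have "dist (q / of_real (norm q)) q = \<bar>norm q - 1\<bar>"
    proof -
      have "q / of_real (norm q) - q = (q / of_real (norm q)) * of_real (1 - norm q)"
        using that by (simp add: field_simps)
      then have "norm (q / of_real (norm q) - q) = norm (q / of_real (norm q)) * norm (of_real (1 - norm q) :: complex)"
        by (simp only: norm_mult)
      also have "\<dots> = \<bar>1 - norm q\<bar>" using that(3) unfolding norm_of_real by (simp add: norm_divide)
      finally show ?thesis by (simp add: dist_norm)
    qed
    ultimately have "q \<in> U" using \<kappa>(2) that(1) by (metis UN_I mem_ball subsetD)
    then show ?thesis using interior_subset that(2) unfolding U_def by blast
  qed
  \<comment> \<open>The first bound keeps the annulus between the radii \<open>r\<close> and 1
    within distance \<kappa> of the circle, the second does the same for its image under q ->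
    1/q.\<close>
  define r where "r = max (1 - \<kappa>) (1 / (1 + \<kappa>))"
  have r: "0 \<le> r" "r < 1" "1 - \<kappa> \<le> r" "1 / (1 + \<kappa>) \<le> r" using \<kappa>(1) by (auto simp: r_def le_max_iff_disj)
  have an1: "F holomorphic_on {q. r < norm q \<and> norm q < 1}"
  proof -
    have "F analytic_on {q. r < norm q \<and> norm q < 1}"
      unfolding analytic_on_analytic_at[of F "{q. r < norm q \<and> norm q < 1}"]
      by (intro ballI Fan) (use r in auto)
    then show ?thesis by (rule analytic_imp_holomorphic)
  qed
  have an2: "(\<lambda>q. F (1/q)) holomorphic_on {q. r < norm q \<and> norm q < 1}"
  proof -
    have "(\<lambda>q. F (1/q)) analytic_on {q}" if q: "r < norm q" "norm q < 1" for q
    proof -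
      have q0: "q \<noteq> 0" "norm q > 0" using q r by auto
      have "1 / (1 + \<kappa>) < norm q" using q r by linarith
      then have "norm (1/q) < 1 + \<kappa>" using \<kappa>(1) q0 by (simp add: norm_divide field_simps)
      moreover have "norm (1/q) > 1" using q q0 by (simp add: norm_divide)
      ultimately have "F analytic_on {1/q}" using q0 by (intro Fan) auto
      then show ?thesis
        by - (rule analytic_at_compose[of "\<lambda>q. 1/q" q F], use q0 in \<open>auto intro!: analytic_intros\<close>)
    qed
    then have "(\<lambda>q. F (1/q)) analytic_on {q. r < norm q \<and> norm q < 1}"
      unfolding analytic_on_analytic_at[of _ "{q. r < norm q \<and> norm q < 1}"] by blast
    then show ?thesis by (rule analytic_imp_holomorphic)
  qed
  obtain r1 A B where A: "r < r1" "r1 < 1" "A holomorphic_on ball 0 1" "B holomorphic_on {q. r1 < norm q}"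
    "(B \<longlongrightarrow> 0) at_infinity" "\<And>q. r1 < norm q \<Longrightarrow> norm q < 1 \<Longrightarrow> F q = A q + B q"
    using annulus_splitting[OF an1 r(1,2)] by blast
  obtain r2 C D where C: "r < r2" "r2 < 1" "C holomorphic_on ball 0 1" "D holomorphic_on {q. r2 < norm q}"
    "(D \<longlongrightarrow> 0) at_infinity" "\<And>q. r2 < norm q \<Longrightarrow> norm q < 1 \<Longrightarrow> F (1/q) = C q + D q"
    using annulus_splitting[OF an2 r(1,2)] by blast
  have op: "open {q::complex. t < norm q}" for t by (intro open_Collect_less continuous_intros)
  have Aan: "A analytic_on {q}" "C analytic_on {q}" if "norm q < 1" for q
    using A(3) C(3) that by (auto intro!: holomorphic_on_imp_analytic_at[of _ "ball 0 1"])
  have Ban: "B analytic_on {q}" if "norm q > r1" for q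
    using A(4) that op by (auto intro!: holomorphic_on_imp_analytic_at[of _ "{q. r1 < norm q}"])
  have Dan: "D analytic_on {q}" if "norm q > r2" for q
    using C(4) that op by (auto intro!: holomorphic_on_imp_analytic_at[of _ "{q. r2 < norm q}"])
  define E where "E = (\<lambda>q. 1 / q :: complex)"
  have Ean: "E analytic_on {q}" if "q \<noteq> 0" for q using that unfolding E_def by (auto intro!: analytic_intros)
  \<comment> \<open>On either side of the line, close to it, this is \<open>F q\<close> minus
    \<open>B q + D (1/q)\<close>, which is analytic near the circle; the form chosen makes sense on
    the whole half plane.\<close>
  define f where "f = (\<lambda>z. if Im z > 0 then A (?e z) - D (E (?e z)) else C (E (?e z)) - B (?e z))"
  have ean: "?e analytic_on {z}" for z by (intro analytic_intros)
  have Eean: "(\<lambda>z. E (?e z)) analytic_on {z}" for z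
    by (rule analytic_at_compose[OF ean Ean]) simp
  have nE: "norm (E q) = 1 / norm q" for q by (simp add: E_def norm_divide)
  have "f analytic_on {z}" if "z \<notin> \<real>" for z
  proof (cases "Im z > 0")
    case True
    then have q: "norm (?e z) < 1" "norm (E (?e z)) > 1"
      using norm_exp_2pi_i_less_1(1)[of z] nE[of "?e z"] by auto
    have "(\<lambda>z. A (?e z) - D (E (?e z))) analytic_on {z}"
      by (rule analytic_on_diff[OF analytic_at_compose[OF ean Aan(1)] analytic_at_compose[OF Eean Dan]]) (use q C(2) in linarith)+
    moreover have "\<forall>\<^sub>F w in nhds z. w \<in> {w. Im w > 0}"
      using True by (intro eventually_nhds_in_open open_Collect_less continuous_intros) auto
    then have "\<forall>\<^sub>F w in nhds z. f w = A (?e w) - D (E (?e w))" by eventually_elim (auto simp: f_def)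
    ultimately show ?thesis by (rule iffD2[OF analytic_on_cong_nhds, rotated])
  next
    case False
    then have im: "Im z < 0" using that by (simp add: complex_is_Real_iff)
    then have q: "norm (?e z) > 1" "norm (E (?e z)) < 1"
      using norm_exp_2pi_i_less_1(2)[of z] nE[of "?e z"] by auto
    have "(\<lambda>z. C (E (?e z)) - B (?e z)) analytic_on {z}"
      by (rule analytic_on_diff[OF analytic_at_compose[OF Eean Aan(2)] analytic_at_compose[OF ean Ban]]) (use q A(2) in linarith)+
    moreover have "\<forall>\<^sub>F w in nhds z. w \<in> {w. Im w < 0}"
      using im by (intro eventually_nhds_in_open open_Collect_less continuous_intros) auto
    then have "\<forall>\<^sub>F w in nhds z. f w = C (E (?e w)) - B (?e w)" by eventually_elim (auto simp: f_def)
    ultimately show ?thesis by (rule iffD2[OF analytic_on_cong_nhds, rotated])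
  qed
  then have f1: "f holomorphic_on -\<real>"
    using analytic_on_analytic_at[of f "-\<real>"] analytic_imp_holomorphic by blast
  have f2: "f (z + 1) = f z" for z
    by (simp add: f_def ring_distribs exp_add)
  have lim_e: "(?e \<longlongrightarrow> 0) (filtercomap Im at_top)"
  proof (rule tendsto_norm_zero_cancel)
    have "((\<lambda>t::real. exp (- 2 * pi * t)) \<longlongrightarrow> 0) at_top" by real_asymp
    then have "((\<lambda>z. exp (- 2 * pi * Im z)) \<longlongrightarrow> 0) (filtercomap Im at_top)"
      by (rule filterlim_compose[OF _ filterlim_filtercomap])
    then show "((\<lambda>z. norm (?e z)) \<longlongrightarrow> 0) (filtercomap Im at_top)" by (simp only: norm_exp_2pi_i)
  qed
  have lim_E: "((\<lambda>z. E (?e z)) \<longlongrightarrow> 0) (filtercomap Im at_bot)"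
  proof (rule tendsto_norm_zero_cancel)
    have "((\<lambda>t::real. 1 / exp (- 2 * pi * t)) \<longlongrightarrow> 0) at_bot" by real_asymp
    then have "((\<lambda>z. 1 / exp (- 2 * pi * Im z)) \<longlongrightarrow> 0) (filtercomap Im at_bot)"
      by (rule filterlim_compose[OF _ filterlim_filtercomap])
    then show "((\<lambda>z. norm (E (?e z))) \<longlongrightarrow> 0) (filtercomap Im at_bot)" by (simp only: norm_exp_2pi_i nE)
  qed
  have inf: "filterlim (\<lambda>z. E (g z)) at_infinity G" if "(g \<longlongrightarrow> 0) G" "\<And>z. g z \<noteq> 0" for g :: "complex \<Rightarrow> complex" and G
    unfolding E_def divide_inverse mult_1
    by (rule filterlim_compose[OF filterlim_inverse_at_infinity]) (use that in \<open>auto simp: filterlim_at\<close>)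
  have f3: "(f \<longlongrightarrow> A 0) (filtercomap Im at_top)"
  proof -
    have "((\<lambda>z. A (?e z)) \<longlongrightarrow> A 0) (filtercomap Im at_top)"
      by (rule filterlim_compose[OF analytic_at_imp_tendsto_nhds[OF Aan(1)] lim_e]) simp
    moreover have "((\<lambda>z. D (E (?e z))) \<longlongrightarrow> 0) (filtercomap Im at_top)"
      by (rule filterlim_compose[OF C(5) inf[OF lim_e]]) simp
    ultimately have "((\<lambda>z. A (?e z) - D (E (?e z))) \<longlongrightarrow> A 0 - 0) (filtercomap Im at_top)"
      by (rule tendsto_diff)
    moreover have "\<forall>\<^sub>F z in filtercomap Im at_top. f z = A (?e z) - D (E (?e z))"
      unfolding eventually_filtercomap
      by (rule exI[of _ "\<lambda>t. t > 0"]) (auto simp: f_def eventually_gt_at_top)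
    ultimately show ?thesis by (simp add: tendsto_cong)
  qed
  have f4: "(f \<longlongrightarrow> C 0) (filtercomap Im at_bot)"
  proof -
    have "((\<lambda>z. C (E (?e z))) \<longlongrightarrow> C 0) (filtercomap Im at_bot)"
      by (rule filterlim_compose[OF analytic_at_imp_tendsto_nhds[OF Aan(2)] lim_E]) simp
    moreover have "filterlim (\<lambda>z. E (E (?e z))) at_infinity (filtercomap Im at_bot)"
      by (rule inf[OF lim_E]) (simp add: E_def)
    then have "((\<lambda>z. B (E (E (?e z)))) \<longlongrightarrow> 0) (filtercomap Im at_bot)"
      by (rule filterlim_compose[OF A(5)])
    then have "((\<lambda>z. B (?e z)) \<longlongrightarrow> 0) (filtercomap Im at_bot)" by (simp add: E_def)
    ultimately have "((\<lambda>z. C (E (?e z)) - B (?e z)) \<longlongrightarrow> C 0 - 0) (filtercomap Im at_bot)"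
      by (rule tendsto_diff)
    moreover have "\<forall>\<^sub>F z in filtercomap Im at_bot. f z = C (E (?e z)) - B (?e z)"
      unfolding eventually_filtercomap
      by (rule exI[of _ "\<lambda>t. t < 0"]) (auto simp: f_def eventually_gt_at_bot)
    ultimately show ?thesis by (simp add: tendsto_cong)
  qed
  have f5: "ext_at (\<lambda>z. f0 z - f z) x" if x: "x \<in> \<real>" for x
  proof -
    have n1: "norm (?e x) = 1" "norm (E (?e x)) = 1" using x unfolding nE norm_exp_2pi_i
      by (simp_all add: complex_is_Real_iff)
    have an: "(\<lambda>z. B (?e z) + D (E (?e z))) analytic_on {x}"
      by (rule analytic_on_add[OF analytic_at_compose[OF ean Ban] analytic_at_compose[OF Eean Dan]]) (use n1 A(2) C(2) in linarith)+
    have ev1: "\<forall>\<^sub>F z in nhds x. norm (?e z) > r1"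
      using order_tendstoD(1)[OF tendsto_norm[OF analytic_at_imp_tendsto_nhds[OF ean]], of r1 x] n1 A(2) by simp
    have ev2: "\<forall>\<^sub>F z in nhds x. norm (E (?e z)) > r2"
      using order_tendstoD(1)[OF tendsto_norm[OF analytic_at_imp_tendsto_nhds[OF Eean]], of r2 x] n1 C(2) by simp
    have "\<forall>\<^sub>F z in at_nonreal x. F (?e z) - f z = B (?e z) + D (E (?e z))"
      unfolding eventually_nonreal_nhds[OF x] using ev1 ev2
    proof eventually_elim
      case (elim z)
      show ?case
      proof
        assume "z \<notin> \<real>"
        then have "Im z \<noteq> 0" by (simp add: complex_is_Real_iff)
        show "F (?e z) - f z = B (?e z) + D (E (?e z))"
        proof (cases "Im z > 0")
          case True
          then have "F (?e z) = A (?e z) + B (?e z)"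
            using A(6) elim(1) norm_exp_2pi_i_less_1(1)[of z] by blast
          then show ?thesis using True by (simp add: f_def)
        next
          case False
          then have "norm (?e z) > 1" using norm_exp_2pi_i_less_1(2)[of z] \<open>Im z \<noteq> 0\<close> by auto
          then have "norm (E (?e z)) < 1" unfolding nE by simp
          then have "F (1 / E (?e z)) = C (E (?e z)) + D (E (?e z))" using C(6) elim(2) by blast
          then show ?thesis using False by (simp add: f_def E_def)
        qed
      qed
    qed
    then have "ext_at (\<lambda>z. F (?e z) - f z) x" by (rule ext_atI[OF an])
    from ext_at_add[OF Fext[OF x] this] show ?thesis by simp
  qed
  show ?thesis using that[OF f1 f2 f3 f4 f5] .
qed

subsection \<open>Period functions and periodic functions\<close>

text \<open>The factor that trivialises the translation cocycle. Its base is positive on the finite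
  real line, where it is analytic and nonzero; its branch cuts run from i and -i along the imaginary
  axis to infinity.\<close>

definition cfac :: "complex \<Rightarrow> complex \<Rightarrow> complex" where
  "cfac \<nu> \<tau> = (1 + \<tau>\<^sup>2) powr ((1 + \<nu>) / 2)"

text \<open>Off the line this is 1 minus the product of the principal powers of \<tau> and -1/\<tau>
  with exponent -1 - \<nu>: a constant on each half plane, by which f is multiplied in the
  symmetrised \<psi>.\<close>

definition branch_factor :: "complex \<Rightarrow> complex \<Rightarrow> complex" where
  "branch_factor \<nu> \<tau> = 1 + (if Im \<tau> > 0 then exp (- (\<i> * of_real pi * \<nu>)) else exp (\<i> * of_real pi * \<nu>))"

definition periodic_part :: "complex \<Rightarrow> (complex \<Rightarrow> complex) \<Rightarrow> complex \<Rightarrow> complex" where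
  "periodic_part \<nu> \<psi> \<tau> = (\<psi> \<tau> + \<tau> powr (-1 - \<nu>) * \<psi> (-1 / \<tau>)) / branch_factor \<nu> \<tau>"

lemma one_plus_exp_nonzero:
  assumes "\<forall>k::int. \<nu> \<noteq> 1 + 2 * of_int k"
  shows "1 + exp (\<i> * of_real pi * \<nu>) \<noteq> 0" "1 + exp (- (\<i> * of_real pi * \<nu>)) \<noteq> 0"
proof -
  have ne: "1 + exp (\<i> * of_real pi * \<nu>) \<noteq> 0" if "\<forall>k::int. \<nu> \<noteq> 1 + 2 * of_int k" for \<nu>
  proof
    assume "1 + exp (\<i> * of_real pi * \<nu>) = 0"
    then have "exp (\<i> * of_real pi * \<nu>) = exp (\<i> * of_real pi)"
      by (simp add: add_eq_0_iff)
    then obtain n :: int where "\<i> * of_real pi * \<nu> = \<i> * of_real pi + of_real (of_int (2 * n) * pi) * \<i>"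
      unfolding exp_eq by blast
    then have "\<i> * of_real pi * \<nu> = \<i> * of_real pi * (1 + 2 * of_int n)" by (simp add: algebra_simps)
    then have "\<nu> = 1 + 2 * of_int n" by (subst (asm) mult_cancel_left) simp
    then show False using that by blast
  qed
  show "1 + exp (\<i> * of_real pi * \<nu>) \<noteq> 0" by (rule ne[OF assms])
  have "\<forall>k::int. - \<nu> \<noteq> 1 + 2 * of_int k"
  proof
    fix k :: int
    show "- \<nu> \<noteq> 1 + 2 * of_int k"
    proof
      assume "- \<nu> = 1 + 2 * of_int k"
      then have "\<nu> = - (1 + 2 * of_int k)" by (metis minus_minus)
      then have "\<nu> = 1 + 2 * of_int (- k - 1)" by simp
      then show False using assms by blast
    qed
  qed
  from ne[OF this] show "1 + exp (- (\<i> * of_real pi * \<nu>)) \<noteq> 0" by simp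
qed

lemma branch_factor_nonzero: "\<forall>k::int. \<nu> \<noteq> 1 + 2 * of_int k \<Longrightarrow> branch_factor \<nu> \<tau> \<noteq> 0"
  using one_plus_exp_nonzero by (auto simp: branch_factor_def)

lemma Im_minus_inverse_sign:
  "Im (-1 / \<tau>) > 0 \<longleftrightarrow> Im \<tau> > 0" "Im (-1 / \<tau>) = 0 \<longleftrightarrow> Im \<tau> = 0"
proof -
  have "Im (-1/\<tau>) = Im \<tau> / ((Re \<tau>)\<^sup>2 + (Im \<tau>)\<^sup>2)" by (simp add: Im_divide)
  moreover have "(Re \<tau>)\<^sup>2 + (Im \<tau>)\<^sup>2 > 0" if "Im \<tau> \<noteq> 0"
    using that by (simp add: sum_power2_gt_zero_iff)
  ultimately show "Im (-1 / \<tau>) > 0 \<longleftrightarrow> Im \<tau> > 0" "Im (-1 / \<tau>) = 0 \<longleftrightarrow> Im \<tau> = 0"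
    by (cases "Im \<tau> = 0"; auto simp: zero_less_divide_iff)+
qed

lemma minus_inverse_nonreal: "\<tau> \<notin> \<real> \<Longrightarrow> -1 / \<tau> \<notin> (\<real> :: complex set)"
  using Im_minus_inverse_sign(2)[of \<tau>] by (simp add: complex_is_Real_iff)

lemma branch_factor_minus_inverse: "branch_factor \<nu> (-1 / \<tau>) = branch_factor \<nu> \<tau>"
  unfolding branch_factor_def Im_minus_inverse_sign ..

text \<open>-1/\<tau> stays in the half plane of \<tau>, so the two principal logarithms add up to i
  \<pi> above and to -i \<pi> below the line.\<close>

lemma powr_minus_inverse:
  assumes "\<tau> \<notin> \<real>"
  shows "\<tau> powr (-1 - \<nu>) * (-1 / \<tau>) powr (-1 - \<nu>) = 1 - branch_factor \<nu> \<tau>"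
proof -
  have im: "Im \<tau> \<noteq> 0" using assms by (simp add: complex_is_Real_iff)
  then have t0: "\<tau> \<noteq> 0" by auto
  have np: "- \<tau> \<notin> \<real>\<^sub>\<le>\<^sub>0" using im by (auto simp: complex_nonpos_Reals_iff)
  have "-1 / \<tau> = inverse (- \<tau>)" by (simp add: divide_inverse)
  then have "Ln (-1 / \<tau>) = - Ln (- \<tau>)" using Ln_inverse[OF np] by simp
  then have L: "Ln \<tau> + Ln (-1 / \<tau>) = (if Im \<tau> > 0 then \<i> * of_real pi else - \<i> * of_real pi)"
    using Ln_minus[OF t0] im by auto
  have "\<tau> powr (-1 - \<nu>) * (-1 / \<tau>) powr (-1 - \<nu>) = exp ((-1 - \<nu>) * (Ln \<tau> + Ln (-1 / \<tau>)))"
    using t0 by (simp add: powr_def exp_add ring_distribs)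
  also have "\<dots> = - (if Im \<tau> > 0 then exp (- (\<i> * of_real pi * \<nu>)) else exp (\<i> * of_real pi * \<nu>))"
  proof -
    have "(-1 - \<nu>) * (\<i> * of_real pi) = - (\<i> * of_real pi * \<nu>) - \<i> * of_real pi"
      "(-1 - \<nu>) * (- \<i> * of_real pi) = \<i> * of_real pi * \<nu> + \<i> * of_real pi" by (simp_all add: algebra_simps)
    then show ?thesis unfolding L by (simp add: exp_diff exp_add)
  qed
  finally show ?thesis by (simp add: branch_factor_def)
qed

lemma Im_Ln_sign:
  assumes "Im z \<noteq> 0"
  shows "Im z > 0 \<Longrightarrow> 0 < Im (Ln z) \<and> Im (Ln z) < pi" "Im z < 0 \<Longrightarrow> - pi < Im (Ln z) \<and> Im (Ln z) < 0"
proof -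
  have z: "z \<noteq> 0" using assms by auto
  show "Im z > 0 \<Longrightarrow> 0 < Im (Ln z) \<and> Im (Ln z) < pi" using Im_Ln_pos_lt_imp[of z] Im_Ln_pos_lt[OF z] by auto
  assume "Im z < 0"
  then have "\<not> (0 \<le> Im (Ln z))" using Im_Ln_pos_le[OF z] Im_Ln_le_pi[OF z] by auto
  then show "- pi < Im (Ln z) \<and> Im (Ln z) < 0" using mpi_less_Im_Ln[OF z] by auto
qed

text \<open>The arguments of \<tau> and \<tau> + 1 lie both in (0, \<pi>) or both in (-\<pi>, 0), so
  their difference is again a principal argument.\<close>

lemma powr_quotient_shift:
  assumes "\<tau> \<notin> \<real>"
  shows "(\<tau> + 1) powr b * (\<tau> / (\<tau> + 1)) powr b = \<tau> powr (b :: complex)"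
proof -
  have im: "Im \<tau> \<noteq> 0" "Im (\<tau> + 1) \<noteq> 0" using assms by (auto simp: complex_is_Real_iff)
  then have nz: "\<tau> \<noteq> 0" "\<tau> + 1 \<noteq> 0" by (metis zero_complex.sel(2))+
  have "\<bar>Im (Ln \<tau>) - Im (Ln (\<tau> + 1))\<bar> < pi"
    using Im_Ln_sign[OF im(1)] Im_Ln_sign[OF im(2)] im(1) by (cases "Im \<tau> > 0") auto
  then have "Ln (exp (Ln \<tau> - Ln (\<tau> + 1))) = Ln \<tau> - Ln (\<tau> + 1)"
    by (intro Ln_exp) auto
  moreover have "exp (Ln \<tau> - Ln (\<tau> + 1)) = \<tau> / (\<tau> + 1)" using nz by (simp add: exp_diff)
  ultimately have "Ln (\<tau> / (\<tau> + 1)) = Ln \<tau> - Ln (\<tau> + 1)" by simp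
  then show ?thesis using nz by (simp add: powr_def flip: exp_add) (simp add: algebra_simps)
qed

text \<open>The modular relations behind the three-term equation: v / (v + 1) and its inversion are
  translates of -1 / (v + 1) and -1 / v, so a periodic function takes the same values there.\<close>

lemma quotient_shift:
  assumes "v \<notin> (\<real> :: complex set)"
  shows "v / (v + 1) = -1 / (v + 1) + 1" "v / (v + 1) \<notin> \<real>" "-1 / (v / (v + 1)) + 1 = -1 / v"
proof -
  have n1: "v + 1 \<notin> \<real>" using assms by (simp add: complex_is_Real_iff)
  then have nz: "v + 1 \<noteq> 0" "v \<noteq> 0" using assms by auto
  have "v / (v + 1) = ((v + 1) - 1) / (v + 1)" by simp
  also have "\<dots> = 1 - 1 / (v + 1)" by (simp only: diff_divide_distrib divide_self[OF nz(1)])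
  finally show e1: "v / (v + 1) = -1 / (v + 1) + 1" by simp
  have "-1 / (v + 1) + 1 \<notin> \<real>" using minus_inverse_nonreal[OF n1] by (simp add: complex_is_Real_iff)
  then show "v / (v + 1) \<notin> \<real>" unfolding e1 .
  show "-1 / (v / (v + 1)) + 1 = -1 / v" using nz by (simp add: field_simps)
qed

lemma slit_iff: "z \<in> slit \<longleftrightarrow> z \<notin> \<real>\<^sub>\<le>\<^sub>0"
  by (auto simp: slit_def nonpos_Reals_def)

lemma open_slit: "open slit"
proof -
  have "slit = - \<real>\<^sub>\<le>\<^sub>0" by (auto simp: slit_iff)
  then show ?thesis using open_Compl[OF closed_nonpos_Reals_complex] by (simp only:)
qed

lemma nonreal_slit: "z \<notin> \<real> \<Longrightarrow> z \<in> slit"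
  using nonpos_Reals_subset_Reals by (auto simp: slit_iff)

lemma slit_moves:
  assumes "\<tau> \<in> slit"
  shows "\<tau> + 1 \<in> slit" "\<tau> + 1 \<noteq> 0" "\<tau> / (\<tau> + 1) \<in> slit"
proof -
  show 1: "\<tau> + 1 \<in> slit" using assms by (auto simp: slit_iff complex_nonpos_Reals_iff)
  then show 2: "\<tau> + 1 \<noteq> 0" by (auto simp: slit_iff)
  show "\<tau> / (\<tau> + 1) \<in> slit"
  proof (rule ccontr)
    assume "\<tau> / (\<tau> + 1) \<notin> slit"
    then obtain y where y: "\<tau> / (\<tau> + 1) = of_real y" "y \<le> 0"
      by (auto simp: slit_iff elim!: nonpos_Reals_cases)
    then have "\<tau> = of_real y * (\<tau> + 1)" using 2 by (simp add: field_simps)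
    then have "\<tau> * of_real (1 - y) = of_real y" by (simp add: algebra_simps)
    then have "\<tau> = of_real (y / (1 - y))" using y(2)
      by (simp add: field_simps)
    then have "\<tau> \<in> \<real>\<^sub>\<le>\<^sub>0" using y(2) divide_nonpos_pos[of y "1 - y"] by (simp only: nonpos_Reals_of_real_iff)
    then show False using assms by (simp add: slit_iff)
  qed
qed

text \<open>The weighted inversion applied twice multiplies by 1 - \<open>branch_factor\<close>, so
  before the division the combination is \<open>branch_factor\<close> times \<psi>. The converse
  \<open>periodic_part_recover\<close> is the same computation.\<close>

lemma periodic_part_diff_eq:
  assumes "\<forall>k::int. \<nu> \<noteq> 1 + 2 * of_int k" "\<tau> \<notin> \<real>"
  shows "periodic_part \<nu> \<psi> \<tau> - \<tau> powr (-1 - \<nu>) * periodic_part \<nu> \<psi> (-1 / \<tau>) = \<psi> \<tau>"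
proof -
  note k = branch_factor_nonzero[OF assms(1), of \<tau>]
  have "\<tau> powr (-1 - \<nu>) * periodic_part \<nu> \<psi> (-1 / \<tau>) =
    (\<tau> powr (-1 - \<nu>) * \<psi> (-1 / \<tau>) + (\<tau> powr (-1 - \<nu>) * (-1 / \<tau>) powr (-1 - \<nu>)) * \<psi> \<tau>) / branch_factor \<nu> \<tau>"
    unfolding periodic_part_def branch_factor_minus_inverse by (simp add: algebra_simps)
  then show ?thesis unfolding powr_minus_inverse[OF assms(2)] periodic_part_def using k by (simp add: field_simps)
qed

lemma periodic_part_recover:
  assumes "\<forall>k::int. \<nu> \<noteq> 1 + 2 * of_int k" "\<tau> \<notin> \<real>"
    and "\<And>\<tau>. \<tau> \<notin> \<real> \<Longrightarrow> \<psi> \<tau> = f \<tau> - \<tau> powr (-1 - \<nu>) * f (-1 / \<tau>)"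
  shows "periodic_part \<nu> \<psi> \<tau> = f \<tau>"
proof -
  note k = branch_factor_nonzero[OF assms(1), of \<tau>]
  have "\<psi> \<tau> + \<tau> powr (-1 - \<nu>) * \<psi> (-1 / \<tau>) =
    f \<tau> - (\<tau> powr (-1 - \<nu>) * (-1 / \<tau>) powr (-1 - \<nu>)) * f \<tau>"
    unfolding assms(3)[OF assms(2)] assms(3)[OF minus_inverse_nonreal[OF assms(2)]]
    by (simp add: algebra_simps)
  then show ?thesis unfolding powr_minus_inverse[OF assms(2)] periodic_part_def using k by (simp add: field_simps)
qed

lemma branch_factor_shift: "branch_factor \<nu> (\<tau> + 1) = branch_factor \<nu> \<tau>"
  by (simp add: branch_factor_def)

text \<open>The three-term equations at \<tau> and at \<sigma> = -1/(\<tau> + 1) both contain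
  \<psi>(\<tau>/(\<tau> + 1)); eliminating it equates the symmetrised \<psi> at \<tau> and at \<tau>
  + 1.\<close>

lemma periodic_part_shift:
  assumes "\<psi> \<in> Psi_mod \<nu>" "\<tau> \<notin> \<real>"
  shows "periodic_part \<nu> \<psi> (\<tau> + 1) = periodic_part \<nu> \<psi> \<tau>"
proof -
  have three: "\<psi> \<tau> = \<psi> (\<tau> + 1) + (\<tau> + 1) powr (-1 - \<nu>) * \<psi> (\<tau> / (\<tau> + 1))" if "\<tau> \<in> slit" for \<tau>
  proof -
    have "\<psi> \<tau> = \<psi> (\<tau> + 1) + (\<tau> + 1) powr (- \<nu> - 1) * \<psi> (\<tau> / (\<tau> + 1))"
      using assms(1) that unfolding Psi_mod_def by blast
    moreover have "- \<nu> - 1 = -1 - \<nu>" by simp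
    ultimately show ?thesis by (simp only:)
  qed
  have n1: "\<tau> + 1 \<notin> \<real>" using assms(2) by (simp add: complex_is_Real_iff)
  then have nz: "\<tau> + 1 \<noteq> 0" "\<tau> \<noteq> 0" using assms(2) by auto
  define \<sigma> where "\<sigma> = -1 / (\<tau> + 1)"
  have \<sigma>: "\<sigma> \<in> slit" unfolding \<sigma>_def by (rule nonreal_slit[OF minus_inverse_nonreal[OF n1]])
  have s1: "\<sigma> + 1 = \<tau> / (\<tau> + 1)" using quotient_shift(1)[OF assms(2)] by (simp add: \<sigma>_def)
  have s2: "\<sigma> / (\<sigma> + 1) = -1 / \<tau>" unfolding s1 unfolding \<sigma>_def using nz by simp
  have "\<psi> \<sigma> = \<psi> (\<tau> / (\<tau> + 1)) + (\<tau> / (\<tau> + 1)) powr (-1 - \<nu>) * \<psi> (-1 / \<tau>)"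
    using three[OF \<sigma>] unfolding s2 unfolding s1 .
  then have "(\<tau> + 1) powr (-1 - \<nu>) * \<psi> \<sigma> = (\<tau> + 1) powr (-1 - \<nu>) * \<psi> (\<tau> / (\<tau> + 1))
    + ((\<tau> + 1) powr (-1 - \<nu>) * (\<tau> / (\<tau> + 1)) powr (-1 - \<nu>)) * \<psi> (-1 / \<tau>)"
    by (simp add: algebra_simps)
  then have "\<psi> (\<tau> + 1) + (\<tau> + 1) powr (-1 - \<nu>) * \<psi> \<sigma> = \<psi> \<tau> + \<tau> powr (-1 - \<nu>) * \<psi> (-1 / \<tau>)"
    unfolding powr_quotient_shift[OF assms(2)] using three[OF nonreal_slit[OF assms(2)]] by simp
  then show ?thesis unfolding periodic_part_def branch_factor_shift \<sigma>_def by simp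
qed

lemma Psi_mod_analytic: "\<psi> \<in> Psi_mod \<nu> \<Longrightarrow> \<tau> \<in> slit \<Longrightarrow> \<psi> analytic_on {\<tau>}"
  unfolding Psi_mod_def using open_slit analytic_at by blast

lemma periodic_part_analytic:
  assumes "\<forall>k::int. \<nu> \<noteq> 1 + 2 * of_int k" "\<psi> \<in> Psi_mod \<nu>" "\<tau> \<notin> \<real>"
  shows "periodic_part \<nu> \<psi> analytic_on {\<tau>}"
proof -
  have t0: "\<tau> \<noteq> 0" using assms by auto
  have an: "(\<lambda>\<tau>. -1 / \<tau>) analytic_on {\<tau>}" using t0 by (auto intro!: analytic_intros)
  have "(\<lambda>\<tau>. \<psi> (-1 / \<tau>)) analytic_on {\<tau>}"
    by (rule analytic_at_compose[OF an Psi_mod_analytic[OF assms(2)]])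
      (rule nonreal_slit[OF minus_inverse_nonreal[OF assms(3)]])
  moreover have "\<tau> \<notin> \<real>\<^sub>\<le>\<^sub>0" using nonreal_slit[OF assms(3)] by (simp add: slit_iff)
  ultimately have *: "(\<lambda>w. (\<psi> w + w powr (-1 - \<nu>) * \<psi> (-1 / w)) / branch_factor \<nu> \<tau>) analytic_on {\<tau>}"
    using Psi_mod_analytic[OF assms(2) nonreal_slit[OF assms(3)]] branch_factor_nonzero[OF assms(1)]
    by (intro analytic_intros) auto
  have "Im \<tau> \<noteq> 0" using assms(3) by (simp add: complex_is_Real_iff)
  \<comment> \<open>A positive product of the imaginary parts means the same half plane, where
    \<open>branch_factor\<close> is constant.\<close>
  then have "\<forall>\<^sub>F w in nhds \<tau>. w \<in> {w. Im w * Im \<tau> > 0}"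
    by (intro eventually_nhds_in_open open_Collect_less continuous_intros) (auto simp: zero_less_mult_iff)
  then have "\<forall>\<^sub>F w in nhds \<tau>. periodic_part \<nu> \<psi> w = (\<psi> w + w powr (-1 - \<nu>) * \<psi> (-1 / w)) / branch_factor \<nu> \<tau>"
    by eventually_elim (auto simp: periodic_part_def branch_factor_def zero_less_mult_iff)
  then show ?thesis using * by (rule iffD2[OF analytic_on_cong_nhds])
qed

text \<open>The positive axis is reached by continuity; outside the slit plane elements of
  \<open>Psi_mod\<close> are 0 by convention.\<close>

lemma Psi_mod_eq_zero:
  assumes "\<psi> \<in> Psi_mod \<nu>" "\<And>\<tau>. \<tau> \<notin> \<real> \<Longrightarrow> \<psi> \<tau> = 0"
  shows "\<psi> = (\<lambda>_. 0)"
proof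
  fix z
  show "\<psi> z = 0"
  proof (cases "z \<in> slit \<and> z \<in> \<real>")
    case True
    then show ?thesis
      using analytic_at_imp_isCont[OF Psi_mod_analytic[OF assms(1)]] assms(2)
      by (intro isCont_eq_nonreal'[of z \<psi> "\<lambda>_. 0"]) auto
  next
    case False
    then show ?thesis using assms by (auto simp: Psi_mod_def)
  qed
qed

lemma filtercomap_Im_nontrivial: "filtercomap Im at_top \<noteq> bot" "filtercomap Im at_bot \<noteq> bot"
proof -
  have "surj Im" by (metis complex.sel(2) surjI)
  then show "filtercomap Im at_top \<noteq> bot" "filtercomap Im at_bot \<noteq> bot"
    using filtercomap_neq_bot_surj[of at_top Im] filtercomap_neq_bot_surj[of at_bot Im] by simp_all
qed

text \<open>The limits bound \<open>G\<close> near both ends, a compact rectangle of width 1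
  together with periodicity bounds it in between, and Liouville's theorem applies.\<close>

lemma entire_periodic_bounded_const:
  assumes an: "\<And>z. G analytic_on {z}" and shift: "\<And>z. G (z + 1) = G z"
    and lim: "(G \<longlongrightarrow> L1) (filtercomap Im at_top)" "(G \<longlongrightarrow> L2) (filtercomap Im at_bot)"
  shows "\<exists>c. \<forall>z. G z = c"
proof -
  have hol: "G holomorphic_on UNIV"
    using an analytic_on_analytic_at[of G UNIV] analytic_imp_holomorphic by blast
  have "\<forall>\<^sub>F z in filtercomap Im at_top. dist (G z) L1 < 1" "\<forall>\<^sub>F z in filtercomap Im at_bot. dist (G z) L2 < 1"
    using lim by (auto simp: tendsto_iff)
  then obtain Y1 Y2 where Y: "\<And>z. Im z \<ge> Y1 \<Longrightarrow> dist (G z) L1 < 1" "\<And>z. Im z \<le> Y2 \<Longrightarrow> dist (G z) L2 < 1"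
    unfolding eventually_filtercomap eventually_at_top_linorder eventually_at_bot_linorder by metis
  have "compact (G ` cbox (Complex 0 Y2) (Complex 1 Y1))"
    using hol by (intro compact_continuous_image) (auto intro: holomorphic_on_imp_continuous_on holomorphic_on_subset)
  then obtain M where M: "\<And>z. z \<in> cbox (Complex 0 Y2) (Complex 1 Y1) \<Longrightarrow> norm (G z) \<le> M"
    using compact_imp_bounded bounded_iff by (metis imageI)
  have pern: "G (z + of_nat n) = G z" for z n
  proof (induction n)
    case (Suc n)
    then show ?case using shift[of "z + of_nat n"] by (simp add: algebra_simps)
  qed simp
  have peri: "G (z + of_int n) = G z" for z n
    using pern[of z "nat n"] pern[of "z + of_int n" "nat (-n)"] by (cases "n \<ge> 0") auto
  have "norm (G z) \<le> max M (max (norm L1 + 1) (norm L2 + 1))" for z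
  proof -
    consider "Im z \<ge> Y1" | "Im z \<le> Y2" | "Y2 \<le> Im z" "Im z \<le> Y1" by linarith
    then show ?thesis
    proof cases
      case 1
      then have "norm (G z - L1) < 1" using Y(1) by (simp add: dist_norm)
      then have "norm (G z) \<le> norm L1 + 1" using norm_triangle_ineq2[of "G z" L1] by linarith
      then show ?thesis by auto
    next
      case 2
      then have "norm (G z - L2) < 1" using Y(2) by (simp add: dist_norm)
      then have "norm (G z) \<le> norm L2 + 1" using norm_triangle_ineq2[of "G z" L2] by linarith
      then show ?thesis by auto
    next
      case 3
      define n where "n = - \<lfloor>Re z\<rfloor>"
      have "z + of_int n \<in> cbox (Complex 0 Y2) (Complex 1 Y1)"
        using 3 unfolding n_def by (auto simp: in_cbox_complex_iff) linarith
      then have "norm (G z) \<le> M" using M peri by metis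
      then show ?thesis by simp
    qed
  qed
  then have "bounded (range G)" unfolding bounded_iff by blast
  then show ?thesis using Liouville_theorem[OF hol] by (auto simp: constant_on_def)
qed

text \<open>A periodic representative is determined up to an additive constant, and the constant is
  fixed by the condition on the two limits because \<open>(1 + exp (i \<pi> \<nu>)) + (1 + exp (- i \<pi> \<nu>))\<close> is the
  product of these two factors.\<close>

lemma Psi_mod_ext_zero:
  assumes nu: "\<forall>k::int. \<nu> \<noteq> 1 + 2 * of_int k" and psi: "\<psi> \<in> Psi_mod \<nu>"
    and ext: "\<And>x. x \<in> \<real> \<Longrightarrow> ext_at (periodic_part \<nu> \<psi>) x"
  shows "\<psi> = (\<lambda>_. 0)"
proof -
  define G where "G = real_fill (periodic_part \<nu> \<psi>)"
  have an: "G analytic_on {z}" for z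
    unfolding G_def using real_fill_analytic[OF ext] real_fill_analytic'[OF periodic_part_analytic[OF nu psi]]
    by (cases "z \<in> \<real>") auto
  have Gper: "G z = periodic_part \<nu> \<psi> z" if "z \<notin> \<real>" for z using that by (simp add: G_def)
  have shift: "G (z + 1) = G z" for z
  proof (cases "z \<in> \<real>")
    case True
    have "(\<lambda>z. G (z + 1)) analytic_on {z}"
      by (rule analytic_at_compose[of "\<lambda>z. z + 1" z G, OF _ an]) (intro analytic_intros)
    then show ?thesis
      using True an periodic_part_shift[OF psi]
      by (intro isCont_eq_nonreal'[of z "\<lambda>z. G (z + 1)" G] analytic_at_imp_isCont always_eventually)
        (auto simp: Gper complex_is_Real_iff)
  next
    case False
    then show ?thesis using periodic_part_shift[OF psi False] by (simp add: Gper complex_is_Real_iff)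
  qed
  let ?ep = "1 + exp (\<i> * of_real pi * \<nu>)" and ?em = "1 + exp (- (\<i> * of_real pi * \<nu>))"
  note nz = one_plus_exp_nonzero[OF nu]
  obtain L1 L2 where L: "((\<lambda>\<tau>. \<psi> \<tau> + \<tau> powr (-1 - \<nu>) * \<psi> (- 1 / \<tau>)) \<longlongrightarrow> L1) (filtercomap Im at_top)"
    "((\<lambda>\<tau>. \<psi> \<tau> + \<tau> powr (-1 - \<nu>) * \<psi> (- 1 / \<tau>)) \<longlongrightarrow> L2) (filtercomap Im at_bot)" "L1 + L2 = 0"
    using psi by (auto simp: Psi_mod_def)
  have "((\<lambda>\<tau>. (\<psi> \<tau> + \<tau> powr (-1 - \<nu>) * \<psi> (- 1 / \<tau>)) / ?em) \<longlongrightarrow> L1 / ?em) (filtercomap Im at_top)"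
    "((\<lambda>\<tau>. (\<psi> \<tau> + \<tau> powr (-1 - \<nu>) * \<psi> (- 1 / \<tau>)) / ?ep) \<longlongrightarrow> L2 / ?ep) (filtercomap Im at_bot)"
    using L nz by (intro tendsto_divide tendsto_const; simp)+
  moreover have "\<forall>\<^sub>F z in filtercomap Im at_top. G z = (\<psi> z + z powr (-1 - \<nu>) * \<psi> (- 1 / z)) / ?em"
    unfolding eventually_filtercomap
    by (rule exI[of _ "\<lambda>t. t > 0"]) (auto simp: Gper periodic_part_def branch_factor_def eventually_gt_at_top complex_is_Real_iff)
  moreover have "\<forall>\<^sub>F z in filtercomap Im at_bot. G z = (\<psi> z + z powr (-1 - \<nu>) * \<psi> (- 1 / z)) / ?ep"
    unfolding eventually_filtercomap
    by (rule exI[of _ "\<lambda>t. t < 0"]) (auto simp: Gper periodic_part_def branch_factor_def eventually_gt_at_bot complex_is_Real_iff)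
  ultimately have lim: "(G \<longlongrightarrow> L1 / ?em) (filtercomap Im at_top)" "(G \<longlongrightarrow> L2 / ?ep) (filtercomap Im at_bot)"
    by (simp_all add: tendsto_cong)
  obtain c where c: "\<And>z. G z = c" using entire_periodic_bounded_const[OF an shift lim] by blast
  have "L1 / ?em = c" "L2 / ?ep = c"
    using lim unfolding c using tendsto_unique[OF _ _ tendsto_const] filtercomap_Im_nontrivial by blast+
  then have "L1 = ?em * c" "L2 = ?ep * c" using nz by (auto simp: field_simps)
  then have "(?em + ?ep) * c = 0" using L(3) by (simp add: algebra_simps)
  moreover have "?em + ?ep = ?em * ?ep" by (simp add: algebra_simps flip: exp_add)
  ultimately have "c = 0" using nz by auto
  then have "periodic_part \<nu> \<psi> z = 0" if "z \<notin> \<real>" for z using c[of z] Gper[OF that] by simp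
  then have "\<psi> \<tau> = 0" if "\<tau> \<notin> \<real>" for \<tau>
    using periodic_part_diff_eq[OF nu that, of \<psi>] that minus_inverse_nonreal[OF that] by simp
  then show ?thesis by (rule Psi_mod_eq_zero[OF psi])
qed

subsection \<open>From automorphic hyperfunctions to period functions\<close>

lemma ext_at_transfer:
  assumes "ext_at u x" "\<forall>\<^sub>F z in at_nonreal x. u z = v z"
  shows "ext_at v x"
  using assms(1) ext_at_cong[OF assms(2)] by simp

text \<open>On the finite line h and \<open>cfac\<close> times the periodic part are to be the same
  hyperfunction. Infinity is left out because of the branch of \<open>cfac\<close>; invariance under
  \<open>mS\<close> recovers it in \<open>represents_injective\<close>.\<close>

definition represents :: "complex \<Rightarrow> (complex \<Rightarrow> complex) \<Rightarrow> (complex \<Rightarrow> complex) \<Rightarrow> bool" where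
  "represents \<nu> h \<psi> \<longleftrightarrow> (\<forall>x\<in>\<real>. ext_at (\<lambda>z. h z / cfac \<nu> z - periodic_part \<nu> \<psi> z) x)"

lemma cfac_analytic:
  assumes "x \<in> \<real>"
  shows "cfac \<nu> analytic_on {x}" "(\<lambda>z. inverse (cfac \<nu> z)) analytic_on {x}"
proof -
  have pos: "Re (1 + x\<^sup>2) > 0" by (rule one_plus_square_Re_pos[OF assms])
  have "(\<lambda>z. 1 + z\<^sup>2) analytic_on {x}" by (intro analytic_intros)
  then show 1: "cfac \<nu> analytic_on {x}" unfolding cfac_def[abs_def] using pos by (rule analytic_powr_pos)
  have "1 + x\<^sup>2 \<noteq> 0" using pos by (metis less_irrefl zero_complex.sel(1))
  then have "cfac \<nu> x \<noteq> 0" by (simp add: cfac_def)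
  with 1 show "(\<lambda>z. inverse (cfac \<nu> z)) analytic_on {x}" by (intro analytic_intros) auto
qed

lemma cfac_nonzero: "1 + z\<^sup>2 \<noteq> 0 \<Longrightarrow> cfac \<nu> z \<noteq> 0"
  by (simp add: cfac_def)

lemma eventually_nonreal: "\<forall>\<^sub>F z in at_nonreal x. z \<notin> (\<real> :: complex set)"
  by (simp add: eventually_at_filter)

text \<open>Division by \<open>cfac\<close> turns the translation factor into 1, so that invariance
  under \<open>mT 1\<close> becomes periodicity up to analytic functions.\<close>

lemma cfac_shift:
  assumes "x \<in> \<real>"
  shows "\<forall>\<^sub>F z in at_nonreal x. ((1 + z\<^sup>2) / (1 + (z - 1)\<^sup>2)) powr ((1 + \<nu>) / 2) * cfac \<nu> (z - 1) = cfac \<nu> z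
    \<and> cfac \<nu> z \<noteq> 0 \<and> cfac \<nu> (z - 1) \<noteq> 0"
proof -
  have "\<forall>\<^sub>F z in at_nonreal x. Re (jfac (mT 1) z) > 0"
    by (intro eventually_Re_pos jfac_analytic mS_mT_PSL2R assms)
  moreover have "\<forall>\<^sub>F z in at_nonreal x. Re (1 + (z - 1)\<^sup>2) > 0"
    by (rule eventually_Re_pos, intro analytic_intros, rule one_plus_square_Re_pos) (use assms in simp)
  ultimately show ?thesis using eventually_one_plus_square(1)[OF assms]
  proof eventually_elim
    case (elim z)
    have j: "Re ((1 + z\<^sup>2) / (1 + (z - 1)\<^sup>2)) > 0" using elim(1) by (simp add: mT_def)
    have nz: "1 + (z - 1)\<^sup>2 \<noteq> 0" using elim(2) by (metis less_irrefl zero_complex.sel(1))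
    have "(1 + z\<^sup>2) / (1 + (z - 1)\<^sup>2) * (1 + (z - 1)\<^sup>2) = 1 + z\<^sup>2" using nz by simp
    then have "((1 + z\<^sup>2) / (1 + (z - 1)\<^sup>2)) powr ((1 + \<nu>) / 2) * cfac \<nu> (z - 1) = cfac \<nu> z"
      using powr_mult_Re_pos[OF j elim(2), of "(1 + \<nu>) / 2"] by (simp only: cfac_def)
    then show ?case using cfac_nonzero[OF nz] cfac_nonzero[OF elim(3)] by simp
  qed
qed

text \<open>From 1 + z^2 = z z (1 + (-1/z)^2). Splitting the power needs z itself in the right half
  plane, hence the restriction to \<open>Re x > 0\<close>.\<close>

lemma cfac_minus_inverse:
  assumes "x \<in> \<real>" "Re x > 0"
  shows "\<forall>\<^sub>F z in at_nonreal x. cfac \<nu> (-1 / z) = cfac \<nu> z * z powr (-1 - \<nu>) \<and> cfac \<nu> z \<noteq> 0 \<and> z \<noteq> 0"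
proof -
  have x0: "x \<noteq> 0" using assms(2) by auto
  have "\<forall>\<^sub>F z in at_nonreal x. Re z > 0"
    by (rule eventually_Re_pos) (use assms in \<open>auto intro!: analytic_intros\<close>)
  moreover have "Re (x * x) > 0" using assms by (simp add: complex_is_Real_iff)
  then have "\<forall>\<^sub>F z in at_nonreal x. Re (z * z) > 0"
    by (rule eventually_Re_pos[rotated]) (intro analytic_intros)
  moreover have "\<forall>\<^sub>F z in at_nonreal x. Re (1 + (-1 / z)\<^sup>2) > 0"
    by (rule eventually_Re_pos, use x0 in \<open>force intro!: analytic_intros\<close>, rule one_plus_square_Re_pos) (use assms in simp)
  ultimately show ?thesis using eventually_one_plus_square(1)[OF assms(1)]
  proof eventually_elim
    case (elim z)
    have z0: "z \<noteq> 0" using elim(1) by auto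
    have "cfac \<nu> z = (z * z * (1 + (-1 / z)\<^sup>2)) powr ((1 + \<nu>) / 2)"
    proof -
      have "z * z * (1 + (-1 / z)\<^sup>2) = 1 + z\<^sup>2" using z0 by (simp add: field_simps power2_eq_square)
      then show ?thesis by (simp only: cfac_def)
    qed
    also have "\<dots> = z powr ((1 + \<nu>) / 2) * z powr ((1 + \<nu>) / 2) * cfac \<nu> (-1 / z)"
      unfolding powr_mult_Re_pos[OF elim(2,3)] powr_mult_Re_pos[OF elim(1,1)] cfac_def ..
    also have "z powr ((1 + \<nu>) / 2) * z powr ((1 + \<nu>) / 2) = z powr (1 + \<nu>)"
      by (simp flip: powr_add)
    finally have "cfac \<nu> z * z powr (-1 - \<nu>) = (z powr (1 + \<nu>) * z powr (-1 - \<nu>)) * cfac \<nu> (-1 / z)" by (simp add: mult_ac)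
    also have "z powr (1 + \<nu>) * z powr (-1 - \<nu>) = 1" using z0 by (simp flip: powr_add)
    finally show ?case using z0 cfac_nonzero[OF elim(4)] by simp
  qed
qed

lemma automorphic_imp_defect:
  assumes "hf_equiv (pi_rep \<nu> mS h) h" "x \<in> \<real>" "x \<noteq> 0"
  shows "ext_at (\<lambda>z. h z - h (-1 / z)) x"
proof -
  have "ext_at (\<lambda>z. - (pi_rep \<nu> mS h z - h z)) x"
    using assms by (intro ext_at_minus) (simp add: hf_equiv_iff)
  moreover have "\<forall>\<^sub>F z in at_nonreal x. - (pi_rep \<nu> mS h z - h z) = h z - h (-1 / z)"
    using eventually_one_plus_square(1)[OF assms(2)] by eventually_elim (simp add: pi_rep_mS)
  ultimately show ?thesis by (rule ext_at_transfer)
qed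

lemma minus_inverse_analytic: "x \<noteq> 0 \<Longrightarrow> (\<lambda>z::complex. -1 / z) analytic_on {x}"
  by (auto intro!: analytic_intros)

lemma automorphic_imp_Psi_mod:
  assumes nu: "\<forall>k::int. \<nu> \<noteq> 1 + 2 * of_int k" and h: "hf_rep h"
    and S: "hf_equiv (pi_rep \<nu> mS h) h" and T: "hf_equiv (pi_rep \<nu> (mT 1) h) h"
  obtains \<psi> where "\<psi> \<in> Psi_mod \<nu>" "represents \<nu> h \<psi>"
proof -
  define f0 where "f0 = (\<lambda>z. h z / cfac \<nu> z)"
  have hol: "hol_near f0 x" if "x \<in> \<real>" for x
    unfolding f0_def divide_inverse
    by (rule hol_near_mult[OF _ hol_near_analytic[OF cfac_analytic(2)[OF that]]]) (use h that in \<open>auto simp: hf_rep_iff\<close>)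
  have inv: "ext_at (\<lambda>z. f0 z - f0 (z - 1)) x" if x: "x \<in> \<real>" for x
  proof -
    have "ext_at (\<lambda>z. - (inverse (cfac \<nu> z) * (pi_rep \<nu> (mT 1) h z - h z))) x"
      by (rule ext_at_minus[OF ext_at_mult[OF ext_at_analytic[OF cfac_analytic(2)[OF x]]]])
        (use T x in \<open>auto simp: hf_equiv_iff\<close>)
    moreover have "\<forall>\<^sub>F z in at_nonreal x. - (inverse (cfac \<nu> z) * (pi_rep \<nu> (mT 1) h z - h z)) = f0 z - f0 (z - 1)"
      using cfac_shift[OF x, of \<nu>]
    proof eventually_elim
      case (elim z)
      define J where "J = ((1 + z\<^sup>2) / (1 + (z - 1)\<^sup>2)) powr ((1 + \<nu>) / 2)"
      have e: "J * cfac \<nu> (z - 1) = cfac \<nu> z" "cfac \<nu> z \<noteq> 0" "cfac \<nu> (z - 1) \<noteq> 0" using elim by (auto simp: J_def)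
      then have J: "J / cfac \<nu> z = 1 / cfac \<nu> (z - 1)" by (simp add: field_simps)
      have "pi_rep \<nu> (mT 1) h z = J * h (z - 1)" by (simp add: pi_rep_mT J_def)
      then have "- (inverse (cfac \<nu> z) * (pi_rep \<nu> (mT 1) h z - h z)) = h z / cfac \<nu> z - (J / cfac \<nu> z) * h (z - 1)"
        by (simp add: divide_inverse algebra_simps)
      then show ?case unfolding J by (simp add: f0_def)
    qed
    ultimately show ?thesis by (rule ext_at_transfer)
  qed
  obtain g L1 L2 where g: "g holomorphic_on -\<real>" "\<And>z. g (z + 1) = g z"
    "(g \<longlongrightarrow> L1) (filtercomap Im at_top)" "(g \<longlongrightarrow> L2) (filtercomap Im at_bot)"
    "\<And>x. x \<in> \<real> \<Longrightarrow> ext_at (\<lambda>z. f0 z - g z) x"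
    using periodic_representative[OF hol inv] by blast
  let ?ep = "1 + exp (\<i> * of_real pi * \<nu>)" and ?em = "1 + exp (- (\<i> * of_real pi * \<nu>))"
  note nz = one_plus_exp_nonzero[OF nu]
  have epm: "?em + ?ep = ?em * ?ep" by (simp add: algebra_simps flip: exp_add)
  \<comment> \<open>The solution of \<open>?em (L1 + c) + ?ep (L2 + c) = 0\<close>: the coefficient
    of c is the sum of \<open>?em\<close> and \<open>?ep\<close>, which equals their product and is
    nonzero.\<close>
  define c where "c = - (?em * L1 + ?ep * L2) / (?em * ?ep)"
  define f where "f = (\<lambda>z. g z + c)"
  have c: "?em * (L1 + c) + ?ep * (L2 + c) = 0"
  proof -
    have "?em * (L1 + c) + ?ep * (L2 + c) = ?em * L1 + ?ep * L2 + (?em + ?ep) * c" by (simp add: algebra_simps)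
    also have "\<dots> = 0" unfolding epm c_def using nz by simp
    finally show ?thesis .
  qed
  have fshift: "f (z + 1) = f z" for z using g(2) by (simp add: f_def)
  have fan: "f analytic_on {z}" if "z \<notin> \<real>" for z
    unfolding f_def using g(1) that
    by (intro analytic_on_add analytic_on_const)
      (auto intro!: holomorphic_on_imp_analytic_at[of _ "-\<real>"] simp: open_Compl closed_complex_Reals)
  have fext: "ext_at (\<lambda>z. f0 z - f z) x" if "x \<in> \<real>" for x
    using ext_at_diff[OF g(5)[OF that] ext_at_analytic[of "\<lambda>_. c"]] by (simp add: f_def algebra_simps)
  let ?b = "-1 - \<nu>"
  define \<psi>0 where "\<psi>0 = (\<lambda>z. f z - z powr ?b * f (-1 / z))"
  define \<psi> where "\<psi> = (\<lambda>z. if z \<in> slit then real_fill \<psi>0 z else 0)"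
  have psi_nonreal: "\<psi> z = f z - z powr ?b * f (-1 / z)" if "z \<notin> \<real>" for z
    using that nonreal_slit by (simp add: \<psi>_def \<psi>0_def)
  have ext0: "ext_at \<psi>0 x" if x: "x \<in> \<real>" "Re x > 0" for x
  proof -
    have x0: "x \<noteq> 0" using x by auto
    have pw: "(\<lambda>z. z powr ?b) analytic_on {x}" using x by (intro analytic_powr_pos) auto
    have d: "ext_at (\<lambda>z. f0 (-1 / z) - f (-1 / z)) x"
      by (rule ext_at_compose[of "\<lambda>z. f0 z - f z" "\<lambda>z. -1 / z", OF fext minus_inverse_analytic[OF x0]])
        (use x minus_inverse_nonreal in auto)
    \<comment> \<open>With f = f0 - (f0 - f), the part from f0 combines to (h(z) - h(-1/z)) /
      \<open>cfac\<close>, which extends by invariance under \<open>mS\<close>; the rest extends by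
      the choice of f.\<close>
    have "ext_at (\<lambda>z. inverse (cfac \<nu> z) * (h z - h (-1 / z)) - (f0 z - f z) + z powr ?b * (f0 (-1 / z) - f (-1 / z))) x"
      by (rule ext_at_add[OF ext_at_diff[OF ext_at_mult[OF ext_at_analytic[OF cfac_analytic(2)[OF x(1)]]
            automorphic_imp_defect[OF S x(1) x0]] fext[OF x(1)]] ext_at_mult[OF ext_at_analytic[OF pw] d]])
    moreover have "\<forall>\<^sub>F z in at_nonreal x. inverse (cfac \<nu> z) * (h z - h (-1 / z)) - (f0 z - f z) + z powr ?b * (f0 (-1 / z) - f (-1 / z)) = \<psi>0 z"
      using cfac_minus_inverse[OF x, of \<nu>]
    proof eventually_elim
      case (elim z)
      then have e: "cfac \<nu> (-1 / z) = cfac \<nu> z * z powr ?b" "cfac \<nu> z \<noteq> 0" "z powr ?b \<noteq> 0" by auto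
      have "f0 (-1 / z) = h (-1 / z) / (cfac \<nu> z * z powr ?b)" by (simp only: f0_def e(1))
      then have "z powr ?b * f0 (-1 / z) = h (-1 / z) / cfac \<nu> z" using e by simp
      moreover have "inverse (cfac \<nu> z) * (h z - h (-1 / z)) = f0 z - h (-1 / z) / cfac \<nu> z"
        by (simp add: f0_def divide_inverse algebra_simps)
      ultimately show ?case unfolding \<psi>0_def by (simp only: right_diff_distrib) simp
    qed
    ultimately show ?thesis by (rule ext_at_transfer)
  qed
  have an: "\<psi> analytic_on {z}" if z: "z \<in> slit" for z
  proof -
    have "real_fill \<psi>0 analytic_on {z}"
    proof (cases "z \<in> \<real>")
      case True
      then have "Re z > 0" using z by (auto simp: slit_iff complex_nonpos_Reals_iff complex_is_Real_iff)
      then show ?thesis using real_fill_analytic[OF ext0] True by blast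
    next
      case False
      have z0: "z \<noteq> 0" using False by auto
      have pw: "(\<lambda>z. z powr ?b) analytic_on {z}" using z by (intro analytic_intros) (auto simp: slit_iff)
      have "(\<lambda>z. f (-1 / z)) analytic_on {z}"
        by (rule analytic_at_compose[OF minus_inverse_analytic[OF z0] fan[OF minus_inverse_nonreal[OF False]]])
      then have "\<psi>0 analytic_on {z}" unfolding \<psi>0_def using fan[OF False] pw
        by (intro analytic_on_diff analytic_on_mult)
      then show ?thesis using real_fill_analytic' False by blast
    qed
    moreover have "\<forall>\<^sub>F w in nhds z. w \<in> slit" using z open_slit by (intro eventually_nhds_in_open) auto
    then have "\<forall>\<^sub>F w in nhds z. \<psi> w = real_fill \<psi>0 w" by eventually_elim (simp add: \<psi>_def)
    ultimately show ?thesis by (rule iffD2[OF analytic_on_cong_nhds, rotated])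
  qed
  have three0: "\<psi> z = \<psi> (z + 1) + (z + 1) powr ?b * \<psi> (z / (z + 1))" if z: "z \<notin> \<real>" for z
  proof -
    have n1: "z + 1 \<notin> \<real>" using z by (simp add: complex_is_Real_iff)
    note e1 = quotient_shift(1)[OF z] and n2 = quotient_shift(2)[OF z] and e2 = quotient_shift(3)[OF z]
    have f1: "f (z / (z + 1)) = f (-1 / (z + 1))" unfolding e1 fshift ..
    have f2: "f (-1 / (z / (z + 1))) = f (-1 / z)" using fshift[of "-1 / (z / (z + 1))"] unfolding e2 by simp
    have "(z + 1) powr ?b * \<psi> (z / (z + 1)) = (z + 1) powr ?b * f (-1 / (z + 1)) -
        ((z + 1) powr ?b * (z / (z + 1)) powr ?b) * f (-1 / z)"
      unfolding psi_nonreal[OF n2] f1 f2 by (simp only: right_diff_distrib mult.assoc)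
    then show ?thesis unfolding powr_quotient_shift[OF z] psi_nonreal[OF z] psi_nonreal[OF n1] fshift by simp
  qed
  have three: "\<psi> z = \<psi> (z + 1) + (z + 1) powr ?b * \<psi> (z / (z + 1))" if z: "z \<in> slit" for z
  proof (cases "z \<in> \<real>")
    \<comment> \<open>On the positive axis the equation is the limit of the one at nonreal
      points.\<close>
    case True
    have a1: "(\<lambda>z. \<psi> (z + 1)) analytic_on {z}"
      by (rule analytic_at_compose[of "\<lambda>z. z + 1" z \<psi>, OF _ an[OF slit_moves(1)[OF z]]]) (intro analytic_intros)
    have q: "(\<lambda>z. z / (z + 1)) analytic_on {z}" using slit_moves(2)[OF z] by (auto intro!: analytic_intros)
    have a2: "(\<lambda>z. \<psi> (z / (z + 1))) analytic_on {z}"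
      by (rule analytic_at_compose[OF q an[OF slit_moves(3)[OF z]]])
    have pw: "(\<lambda>z. (z + 1) powr ?b) analytic_on {z}" using slit_moves(1)[OF z] by (intro analytic_intros) (auto simp: slit_iff)
    show ?thesis
      using a1 a2 pw an[OF z] True
      by (intro isCont_eq_nonreal'[of z \<psi> "\<lambda>z. \<psi> (z + 1) + (z + 1) powr ?b * \<psi> (z / (z + 1))"]
          analytic_at_imp_isCont analytic_on_add analytic_on_mult always_eventually) (auto simp: three0)
  qed (rule three0)
  have recover: "periodic_part \<nu> \<psi> z = f z" if "z \<notin> \<real>" for z
    by (rule periodic_part_recover[OF nu that psi_nonreal])
  have sum: "\<psi> z + z powr ?b * \<psi> (-1 / z) = branch_factor \<nu> z * f z" if "z \<notin> \<real>" for z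
    using recover[OF that] branch_factor_nonzero[OF nu, of z] by (simp add: periodic_part_def field_simps)
  have sum1: "\<psi> z + z powr ?b * \<psi> (-1 / z) = ?em * f z" if "Im z > 0" for z
    using sum[of z] that by (simp only: branch_factor_def complex_is_Real_iff) simp
  have sum2: "\<psi> z + z powr ?b * \<psi> (-1 / z) = ?ep * f z" if "Im z < 0" for z
    using sum[of z] that by (simp only: branch_factor_def complex_is_Real_iff) simp
  have lim1: "((\<lambda>z. \<psi> z + z powr ?b * \<psi> (-1 / z)) \<longlongrightarrow> ?em * (L1 + c)) (filtercomap Im at_top)"
  proof -
    have "((\<lambda>z. ?em * f z) \<longlongrightarrow> ?em * (L1 + c)) (filtercomap Im at_top)"
      unfolding f_def using g(3) by (intro tendsto_intros)
    moreover have "\<forall>\<^sub>F z in filtercomap Im at_top. \<psi> z + z powr ?b * \<psi> (-1 / z) = ?em * f z"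
      unfolding eventually_filtercomap
      by (rule exI[of _ "\<lambda>t. t > 0"]) (use sum1 in \<open>auto simp: eventually_gt_at_top\<close>)
    ultimately show ?thesis by (rule iffD2[OF tendsto_cong, rotated])
  qed
  have lim2: "((\<lambda>z. \<psi> z + z powr ?b * \<psi> (-1 / z)) \<longlongrightarrow> ?ep * (L2 + c)) (filtercomap Im at_bot)"
  proof -
    have "((\<lambda>z. ?ep * f z) \<longlongrightarrow> ?ep * (L2 + c)) (filtercomap Im at_bot)"
      unfolding f_def using g(4) by (intro tendsto_intros)
    moreover have "\<forall>\<^sub>F z in filtercomap Im at_bot. \<psi> z + z powr ?b * \<psi> (-1 / z) = ?ep * f z"
      unfolding eventually_filtercomap
      by (rule exI[of _ "\<lambda>t. t < 0"]) (use sum2 in \<open>auto simp: eventually_gt_at_bot\<close>)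
    ultimately show ?thesis by (rule iffD2[OF tendsto_cong, rotated])
  qed
  have hol_slit: "\<psi> holomorphic_on slit"
    using an analytic_on_analytic_at[of \<psi> slit] analytic_imp_holomorphic by blast
  have zero: "\<forall>z. z \<notin> slit \<longrightarrow> \<psi> z = 0" by (simp add: \<psi>_def)
  have b: "- \<nu> - 1 = ?b" by simp
  have "\<psi> \<in> Psi_mod \<nu>"
    unfolding Psi_mod_def b using hol_slit zero three lim1 lim2 c by blast
  moreover have "represents \<nu> h \<psi>"
    unfolding represents_def
  proof
    fix x :: complex assume x: "x \<in> \<real>"
    have "\<forall>\<^sub>F z in at_nonreal x. f0 z - f z = h z / cfac \<nu> z - periodic_part \<nu> \<psi> z"
      using eventually_nonreal by eventually_elim (simp add: recover f0_def)
    then show "ext_at (\<lambda>z. h z / cfac \<nu> z - periodic_part \<nu> \<psi> z) x"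
      by (rule ext_at_transfer[OF fext[OF x]])
  qed
  ultimately show ?thesis by (rule that)
qed

section \<open>Linearity, uniqueness and injectivity of the correspondence\<close>

lemma represents_cong:
  assumes "hf_equiv h h'" "represents \<nu> h \<psi>"
  shows "represents \<nu> h' \<psi>"
  unfolding represents_def
proof
  fix x :: complex assume x: "x \<in> \<real>"
  have "ext_at (\<lambda>z. h z / cfac \<nu> z - periodic_part \<nu> \<psi> z - (h z - h' z) * inverse (cfac \<nu> z)) x"
    by (rule ext_at_diff[OF _ ext_at_mult[OF _ ext_at_analytic[OF cfac_analytic(2)[OF x]]]])
      (use assms x in \<open>auto simp: hf_equiv_iff represents_def\<close>)
  then show "ext_at (\<lambda>z. h' z / cfac \<nu> z - periodic_part \<nu> \<psi> z) x"
    by (simp add: divide_inverse algebra_simps)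
qed

lemma periodic_part_add: "periodic_part \<nu> (\<lambda>z. \<psi>1 z + \<psi>2 z) \<tau> = periodic_part \<nu> \<psi>1 \<tau> + periodic_part \<nu> \<psi>2 \<tau>"
  by (simp add: periodic_part_def algebra_simps add_divide_distrib)

lemma periodic_part_scale: "periodic_part \<nu> (\<lambda>z. c * \<psi> z) \<tau> = c * periodic_part \<nu> \<psi> \<tau>"
  by (simp add: periodic_part_def algebra_simps)

lemma represents_add:
  assumes "represents \<nu> h1 \<psi>1" "represents \<nu> h2 \<psi>2"
  shows "represents \<nu> (\<lambda>z. h1 z + h2 z) (\<lambda>z. \<psi>1 z + \<psi>2 z)"
  unfolding represents_def periodic_part_add
proof
  fix x :: complex assume "x \<in> \<real>"
  then have "ext_at (\<lambda>z. (h1 z / cfac \<nu> z - periodic_part \<nu> \<psi>1 z) + (h2 z / cfac \<nu> z - periodic_part \<nu> \<psi>2 z)) x"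
    using assms by (intro ext_at_add) (auto simp: represents_def)
  then show "ext_at (\<lambda>z. (h1 z + h2 z) / cfac \<nu> z - (periodic_part \<nu> \<psi>1 z + periodic_part \<nu> \<psi>2 z)) x"
    by (simp add: add_divide_distrib algebra_simps)
qed

lemma represents_scale:
  assumes "represents \<nu> h \<psi>"
  shows "represents \<nu> (\<lambda>z. c * h z) (\<lambda>z. c * \<psi> z)"
  unfolding represents_def periodic_part_scale
proof
  fix x :: complex assume x: "x \<in> \<real>"
  have "ext_at (\<lambda>z. c * (h z / cfac \<nu> z - periodic_part \<nu> \<psi> z)) x"
    by (rule ext_at_mult[OF ext_at_analytic[OF analytic_on_const]]) (use assms x in \<open>auto simp: represents_def\<close>)
  then show "ext_at (\<lambda>z. c * h z / cfac \<nu> z - c * periodic_part \<nu> \<psi> z) x"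
    by (simp add: algebra_simps)
qed

lemma Psi_mod_add:
  assumes "\<psi>1 \<in> Psi_mod \<nu>" "\<psi>2 \<in> Psi_mod \<nu>"
  shows "(\<lambda>z. \<psi>1 z + \<psi>2 z) \<in> Psi_mod \<nu>"
proof -
  let ?S = "\<lambda>\<psi> \<tau>. \<psi> \<tau> + \<tau> powr (-1 - \<nu>) * \<psi> (- 1 / \<tau>)"
  obtain L1 L2 M1 M2 where L: "(?S \<psi>1 \<longlongrightarrow> L1) (filtercomap Im at_top)" "(?S \<psi>1 \<longlongrightarrow> L2) (filtercomap Im at_bot)" "L1 + L2 = 0"
    and M: "(?S \<psi>2 \<longlongrightarrow> M1) (filtercomap Im at_top)" "(?S \<psi>2 \<longlongrightarrow> M2) (filtercomap Im at_bot)" "M1 + M2 = 0"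
    using assms unfolding Psi_mod_def by blast
  have "?S (\<lambda>z. \<psi>1 z + \<psi>2 z) = (\<lambda>\<tau>. ?S \<psi>1 \<tau> + ?S \<psi>2 \<tau>)" by (simp add: fun_eq_iff algebra_simps)
  then have lim: "(?S (\<lambda>z. \<psi>1 z + \<psi>2 z) \<longlongrightarrow> L1 + M1) (filtercomap Im at_top)"
    "(?S (\<lambda>z. \<psi>1 z + \<psi>2 z) \<longlongrightarrow> L2 + M2) (filtercomap Im at_bot)"
    using tendsto_add[OF L(1) M(1)] tendsto_add[OF L(2) M(2)] by simp_all
  have LM: "(L1 + M1) + (L2 + M2) = 0" using L(3) M(3) by (simp add: algebra_simps add_eq_0_iff)
  have hol: "(\<lambda>z. \<psi>1 z + \<psi>2 z) holomorphic_on slit" using assms by (intro holomorphic_intros) (auto simp: Psi_mod_def)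
  have zero: "\<forall>z. z \<notin> slit \<longrightarrow> \<psi>1 z + \<psi>2 z = 0" using assms by (simp add: Psi_mod_def)
  have "\<psi>1 \<tau> + \<psi>2 \<tau> = \<psi>1 (\<tau> + 1) + \<psi>2 (\<tau> + 1) + (\<tau> + 1) powr (- \<nu> - 1) * (\<psi>1 (\<tau> / (\<tau> + 1)) + \<psi>2 (\<tau> / (\<tau> + 1)))"
    if "\<tau> \<in> slit" for \<tau>
  proof -
    have "\<psi>1 \<tau> = \<psi>1 (\<tau> + 1) + (\<tau> + 1) powr (- \<nu> - 1) * \<psi>1 (\<tau> / (\<tau> + 1))"
      "\<psi>2 \<tau> = \<psi>2 (\<tau> + 1) + (\<tau> + 1) powr (- \<nu> - 1) * \<psi>2 (\<tau> / (\<tau> + 1))"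
      using assms that unfolding Psi_mod_def by blast+
    then show ?thesis by (simp only: distrib_left add_ac)
  qed
  with hol zero lim LM show ?thesis unfolding Psi_mod_def by blast
qed

lemma Psi_mod_scale:
  assumes "\<psi> \<in> Psi_mod \<nu>"
  shows "(\<lambda>z. c * \<psi> z) \<in> Psi_mod \<nu>"
proof -
  let ?S = "\<lambda>\<psi> \<tau>. \<psi> \<tau> + \<tau> powr (-1 - \<nu>) * \<psi> (- 1 / \<tau>)"
  obtain L1 L2 where L: "(?S \<psi> \<longlongrightarrow> L1) (filtercomap Im at_top)" "(?S \<psi> \<longlongrightarrow> L2) (filtercomap Im at_bot)" "L1 + L2 = 0"
    using assms unfolding Psi_mod_def by blast
  have "?S (\<lambda>z. c * \<psi> z) = (\<lambda>\<tau>. c * ?S \<psi> \<tau>)" by (simp add: fun_eq_iff algebra_simps)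
  then have lim: "(?S (\<lambda>z. c * \<psi> z) \<longlongrightarrow> c * L1) (filtercomap Im at_top)"
    "(?S (\<lambda>z. c * \<psi> z) \<longlongrightarrow> c * L2) (filtercomap Im at_bot)"
    using tendsto_mult_left[OF L(1), of c] tendsto_mult_left[OF L(2), of c] by simp_all
  have LM: "c * L1 + c * L2 = 0" using L(3) by (simp flip: distrib_left)
  have hol: "(\<lambda>z. c * \<psi> z) holomorphic_on slit" using assms by (intro holomorphic_intros) (auto simp: Psi_mod_def)
  have zero: "\<forall>z. z \<notin> slit \<longrightarrow> c * \<psi> z = 0" using assms by (simp add: Psi_mod_def)
  have "c * \<psi> \<tau> = c * \<psi> (\<tau> + 1) + (\<tau> + 1) powr (- \<nu> - 1) * (c * \<psi> (\<tau> / (\<tau> + 1)))"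
    if "\<tau> \<in> slit" for \<tau>
  proof -
    have "\<psi> \<tau> = \<psi> (\<tau> + 1) + (\<tau> + 1) powr (- \<nu> - 1) * \<psi> (\<tau> / (\<tau> + 1))"
      using assms that unfolding Psi_mod_def by blast
    then have "c * \<psi> \<tau> = c * (\<psi> (\<tau> + 1) + (\<tau> + 1) powr (- \<nu> - 1) * \<psi> (\<tau> / (\<tau> + 1)))" by (rule arg_cong)
    then show ?thesis by (simp only: distrib_left mult.left_commute)
  qed
  with hol zero lim LM show ?thesis unfolding Psi_mod_def by blast
qed

text \<open>By linearity the difference represents h - h = 0, so its periodic part extends across
  the line and \<open>Psi_mod_ext_zero\<close> applies.\<close>

lemma represents_unique:
  assumes nu: "\<forall>k::int. \<nu> \<noteq> 1 + 2 * of_int k"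
    and "represents \<nu> h \<psi>1" "represents \<nu> h \<psi>2" "\<psi>1 \<in> Psi_mod \<nu>" "\<psi>2 \<in> Psi_mod \<nu>"
  shows "\<psi>1 = \<psi>2"
proof -
  let ?d = "\<lambda>z. \<psi>1 z + (-1) * \<psi>2 z"
  have d: "?d \<in> Psi_mod \<nu>" using assms by (intro Psi_mod_add Psi_mod_scale)
  have "represents \<nu> (\<lambda>z. h z + (-1) * h z) ?d" using assms by (intro represents_add represents_scale)
  then have "ext_at (\<lambda>z. - periodic_part \<nu> ?d z) x" if "x \<in> \<real>" for x using that by (simp add: represents_def)
  then have "ext_at (periodic_part \<nu> ?d) x" if "x \<in> \<real>" for x using that ext_at_minus by fastforce
  from Psi_mod_ext_zero[OF nu d this] show ?thesis by (simp add: fun_eq_iff)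
qed

lemma represents_injective:
  assumes h: "hf_rep h1" "hf_rep h2" and r: "represents \<nu> h1 \<psi>" "represents \<nu> h2 \<psi>"
    and S: "hf_equiv (pi_rep \<nu> mS h1) h1" "hf_equiv (pi_rep \<nu> mS h2) h2"
  shows "hf_equiv h1 h2"
proof (rule hf_equiv_rep[OF h(2)])
  show ext: "ext_at (\<lambda>z. h1 z - h2 z) x" if x: "x \<in> \<real>" for x
  proof -
    have "ext_at (\<lambda>z. cfac \<nu> z * ((h1 z / cfac \<nu> z - periodic_part \<nu> \<psi> z) - (h2 z / cfac \<nu> z - periodic_part \<nu> \<psi> z))) x"
      by (rule ext_at_mult[OF ext_at_analytic[OF cfac_analytic(1)[OF x]] ext_at_diff]) (use r x in \<open>auto simp: represents_def\<close>)
    moreover have "\<forall>\<^sub>F z in at_nonreal x. cfac \<nu> z * ((h1 z / cfac \<nu> z - periodic_part \<nu> \<psi> z) - (h2 z / cfac \<nu> z - periodic_part \<nu> \<psi> z)) = h1 z - h2 z"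
      using eventually_one_plus_square(1)[OF x]
      by eventually_elim (auto simp: right_diff_distrib dest: cfac_nonzero)
    ultimately show ?thesis by (rule ext_at_transfer)
  qed
  \<comment> \<open>Only infinity is left. Inversion carries 1/w to -w, so the difference there is
    the one at 0 up to the two defects of invariance under \<open>mS\<close>.\<close>
  have "ext_at (\<lambda>w. h1 (- w) - h2 (- w)) 0"
    by (rule ext_at_compose[of "\<lambda>z. h1 z - h2 z" uminus]) (auto intro!: ext analytic_intros)
  then have "ext_at (\<lambda>w. (h1 (- w) - h2 (- w)) - (pi_rep \<nu> mS h1 (1/w) - h1 (1/w)) + (pi_rep \<nu> mS h2 (1/w) - h2 (1/w))) 0"
    by (rule ext_at_add[OF ext_at_diff]) (use S in \<open>auto simp: hf_equiv_iff\<close>)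
  moreover have "\<forall>\<^sub>F w in at_nonreal 0. (h1 (- w) - h2 (- w)) - (pi_rep \<nu> mS h1 (1/w) - h1 (1/w)) + (pi_rep \<nu> mS h2 (1/w) - h2 (1/w)) = h1 (1/w) - h2 (1/w)"
    using eventually_one_plus_square(2) by eventually_elim (simp add: pi_rep_mS)
  ultimately show "ext_at (\<lambda>w. h1 (1/w) - h2 (1/w)) 0" by (rule ext_at_transfer)
qed

subsection \<open>From period functions to automorphic hyperfunctions\<close>

text \<open>In the coordinate v = -1/\<tau> at infinity the translation \<tau> -> \<tau> - 1 is v ->
  v / (1 + v), and the base of the first power is the factor of \<open>mT 1\<close>. The rule rests
  on (1 + (v/(1 + v))^2) (1 + v)^2 = v^2 + (1 + v)^2.\<close>

lemma cfac_at_zero: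
  "\<forall>\<^sub>F v in at_nonreal 0. ((v\<^sup>2 + 1) / (v\<^sup>2 + (1 + v)\<^sup>2)) powr ((1 + \<nu>) / 2) * cfac \<nu> (v / (1 + v)) = cfac \<nu> v * (1 + v) powr (-1 - \<nu>)"
proof -
  let ?s = "(1 + \<nu>) / 2"
  let ?J = "\<lambda>v::complex. (v\<^sup>2 + 1) / (v\<^sup>2 + (1 + v)\<^sup>2)"
  have "\<forall>\<^sub>F v in at_nonreal 0. Re (?J v) > 0"
    by (rule eventually_Re_pos) (auto intro!: analytic_intros)
  moreover have "\<forall>\<^sub>F v in at_nonreal (0::complex). Re (1 + v) > 0"
    by (rule eventually_Re_pos) (auto intro!: analytic_intros)
  moreover have "\<forall>\<^sub>F v in at_nonreal (0::complex). Re ((1 + v) * (1 + v)) > 0"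
    by (rule eventually_Re_pos) (auto intro!: analytic_intros)
  moreover have "\<forall>\<^sub>F v in at_nonreal (0::complex). Re (1 + (v / (1 + v))\<^sup>2) > 0"
    by (rule eventually_Re_pos) (auto intro!: analytic_intros)
  moreover have "\<forall>\<^sub>F v in at_nonreal (0::complex). Re ((1 + (v / (1 + v))\<^sup>2) * ((1 + v) * (1 + v))) > 0"
    by (rule eventually_Re_pos) (auto intro!: analytic_intros)
  moreover have "\<forall>\<^sub>F v in at_nonreal (0::complex). Re (v\<^sup>2 + (1 + v)\<^sup>2) > 0"
    by (rule eventually_Re_pos) (auto intro!: analytic_intros)
  ultimately show ?thesis
  proof eventually_elim
    case (elim v)
    have nz: "1 + v \<noteq> 0" "v\<^sup>2 + (1 + v)\<^sup>2 \<noteq> 0" using elim(2,6) by (metis less_irrefl zero_complex.sel(1))+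
    have "(1 + (v / (1 + v))\<^sup>2) * ((1 + v) * (1 + v)) = v\<^sup>2 + (1 + v)\<^sup>2"
    proof -
      define t where "t = v / (1 + v)"
      have "t * (1 + v) = v" using nz(1) by (simp add: t_def)
      then have "v\<^sup>2 + (1 + v)\<^sup>2 = (t * (1 + v))\<^sup>2 + (1 + v)\<^sup>2" by simp
      also have "\<dots> = (1 + t\<^sup>2) * ((1 + v) * (1 + v))" by (simp add: power2_eq_square algebra_simps)
      finally show ?thesis by (simp add: t_def)
    qed
    then have "?J v * ((1 + (v / (1 + v))\<^sup>2) * ((1 + v) * (1 + v))) = 1 + v\<^sup>2"
      using nz(2) by (simp add: add.commute)
    then have "cfac \<nu> v = (?J v * ((1 + (v / (1 + v))\<^sup>2) * ((1 + v) * (1 + v)))) powr ?s"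
      by (simp only: cfac_def)
    also have "\<dots> = ?J v powr ?s * (cfac \<nu> (v / (1 + v)) * ((1 + v) powr ?s * (1 + v) powr ?s))"
      unfolding powr_mult_Re_pos[OF elim(1,5)] powr_mult_Re_pos[OF elim(4,3)] powr_mult_Re_pos[OF elim(2,2)] cfac_def ..
    also have "(1 + v) powr ?s * (1 + v) powr ?s = (1 + v) powr (1 + \<nu>)"
      by (simp flip: powr_add)
    finally have "cfac \<nu> v * (1 + v) powr (-1 - \<nu>) =
      (?J v powr ?s * cfac \<nu> (v / (1 + v))) * ((1 + v) powr (1 + \<nu>) * (1 + v) powr (-1 - \<nu>))" by (simp only: mult_ac)
    also have "(1 + v) powr (1 + \<nu>) * (1 + v) powr (-1 - \<nu>) = 1" using nz(1) by (simp flip: powr_add)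
    finally show ?case by simp
  qed
qed

text \<open>The map v / (1 + v) is a translation conjugated by inversion. Expressing both values of
  the periodic part through \<psi> produces, by periodicity, the same term in -1/v; it cancels, and
  the three-term equation leaves \<psi>(v + 1).\<close>

lemma periodic_part_parabolic:
  assumes nu: "\<forall>k::int. \<nu> \<noteq> 1 + 2 * of_int k" and psi: "\<psi> \<in> Psi_mod \<nu>" and v: "v \<notin> \<real>"
  shows "periodic_part \<nu> \<psi> v - (1 + v) powr (-1 - \<nu>) * periodic_part \<nu> \<psi> (v / (1 + v)) = \<psi> (v + 1)"
proof -
  let ?b = "-1 - \<nu>" and ?f = "periodic_part \<nu> \<psi>"
  note n2 = quotient_shift(2)[OF v] and e2 = quotient_shift(3)[OF v]
  have f2: "?f (-1 / (v / (v + 1))) = ?f (-1 / v)"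
    using periodic_part_shift[OF psi minus_inverse_nonreal[OF n2]] unfolding e2 by simp
  have "(v + 1) powr ?b * ?f (v / (v + 1)) = (v + 1) powr ?b * \<psi> (v / (v + 1)) + v powr ?b * ?f (-1 / v)"
  proof -
    have "?f (v / (v + 1)) = \<psi> (v / (v + 1)) + (v / (v + 1)) powr ?b * ?f (-1 / v)"
      using periodic_part_diff_eq[OF nu n2, of \<psi>] unfolding f2 by (simp add: algebra_simps)
    then have "(v + 1) powr ?b * ?f (v / (v + 1)) = (v + 1) powr ?b * \<psi> (v / (v + 1)) +
      ((v + 1) powr ?b * (v / (v + 1)) powr ?b) * ?f (-1 / v)" by (simp only: distrib_left mult.assoc)
    then show ?thesis unfolding powr_quotient_shift[OF v] .
  qed
  moreover have "?f v = \<psi> v + v powr ?b * ?f (-1 / v)"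
    using periodic_part_diff_eq[OF nu v, of \<psi>] by (simp add: algebra_simps)
  moreover have "\<psi> v = \<psi> (v + 1) + (v + 1) powr ?b * \<psi> (v / (v + 1))"
  proof -
    have "\<psi> v = \<psi> (v + 1) + (v + 1) powr (- \<nu> - 1) * \<psi> (v / (v + 1))"
      using psi nonreal_slit[OF v] unfolding Psi_mod_def by blast
    moreover have "- \<nu> - 1 = ?b" by simp
    ultimately show ?thesis by (simp only:)
  qed
  ultimately show ?thesis by (simp add: add.commute)
qed

text \<open>The representative is \<open>cfac * periodic_part\<close> near \<open>[-1, 1]\<close> and its image under \<open>\<tau> \<mapsto> -1 / \<tau>\<close> near the
  rest of the circle, each corrected by the splitting of their difference \<open>cfac * \<psi>\<close> at the point 1.
  At the parabolic fixed point \<open>\<infinity>\<close> the invariance is the analyticity of \<open>\<psi> (v + 1)\<close> at 0.\<close>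

lemma Psi_mod_imp_automorphic:
  assumes nu: "\<forall>k::int. \<nu> \<noteq> 1 + 2 * of_int k" and psi: "\<psi> \<in> Psi_mod \<nu>"
  obtains h where "hf_rep h" "hf_equiv (pi_rep \<nu> mS h) h" "hf_equiv (pi_rep \<nu> (mT 1) h) h" "represents \<nu> h \<psi>"
proof -
  define f where "f = periodic_part \<nu> \<psi>"
  define h1 where "h1 = (\<lambda>z. cfac \<nu> z * f z)"
  define \<iota> where "\<iota> = (\<lambda>z::complex. -1 / z)"
  have ii: "\<iota> (\<iota> z) = z" for z by (simp add: \<iota>_def)
  have inr: "\<iota> z \<notin> \<real>" if "z \<notin> \<real>" for z using minus_inverse_nonreal[OF that] by (simp add: \<iota>_def)
  have ir: "\<iota> z \<in> \<real>" if "z \<in> \<real>" for z using that by (simp add: \<iota>_def)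
  have ian: "\<iota> analytic_on {x}" if "x \<noteq> 0" for x using minus_inverse_analytic[OF that] by (simp add: \<iota>_def)
  have inorm: "norm (\<iota> z) = 1 / norm z" for z by (simp add: \<iota>_def norm_divide)
  have Re\<iota>: "Re (\<iota> x) = - 1 / Re x" if "x \<in> \<real>" for x using that by (auto simp: \<iota>_def elim!: Reals_cases)
  have ilim: "filterlim \<iota> (at_nonreal (\<iota> x)) (at_nonreal x)" if "x \<in> \<real>" "x \<noteq> 0" for x
    by (rule filterlim_nonreal[OF analytic_at_imp_isCont[OF ian] _ _ inr]) (use that ir in auto)
  have U: "\<forall>\<^sub>F z in at_nonreal x. h1 z - h1 (\<iota> z) = cfac \<nu> z * \<psi> z" if "x \<in> \<real>" "Re x > 0" for x
    using cfac_minus_inverse[OF that, of \<nu>] eventually_nonreal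
  proof eventually_elim
    case (elim z)
    have "h1 z - h1 (\<iota> z) = cfac \<nu> z * (f z - z powr (-1 - \<nu>) * f (-1 / z))"
      using elim(1) by (simp add: h1_def \<iota>_def algebra_simps)
    then show ?case using periodic_part_diff_eq[OF nu elim(2), of \<psi>] by (simp add: f_def)
  qed
  have uan: "(\<lambda>z. cfac \<nu> z * \<psi> z) analytic_on {x}" if "x \<in> \<real>" "Re x > 0" for x
    by (rule analytic_on_mult[OF cfac_analytic(1)[OF that(1)] Psi_mod_analytic[OF psi]])
      (use that in \<open>auto simp: slit_iff complex_nonpos_Reals_iff\<close>)
  obtain \<eta> eL eR where \<eta>: "\<eta> > 0" "\<eta> < 1/2"
    and eR: "\<And>z. \<bar>Im (z - 1)\<bar> > \<eta> \<or> \<bar>Re (z - 1)\<bar> > \<eta> \<or> (\<bar>Im (z - 1)\<bar> < \<eta> \<and> Re (z - 1) < \<eta>) \<Longrightarrow> eR analytic_on {z}"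
    and eL: "\<And>z. \<bar>Im (z - 1)\<bar> > \<eta> \<or> \<bar>Re (z - 1)\<bar> > \<eta> \<or> Re (z - 1) > - \<eta> \<Longrightarrow> eL analytic_on {z}"
    and jump: "\<And>z. \<bar>Im (z - 1)\<bar> < \<eta> \<Longrightarrow> \<bar>Re (z - 1)\<bar> < \<eta> \<Longrightarrow> eR z - eL z = cfac \<nu> z * \<psi> z"
    and out: "\<And>z. \<bar>Im (z - 1)\<bar> > \<eta> \<or> \<bar>Re (z - 1)\<bar> > \<eta> \<Longrightarrow> eR z = eL z"
    and eLlim: "(eL \<longlongrightarrow> 0) at_infinity"
    by (rule local_splitting[of "\<lambda>z. cfac \<nu> z * \<psi> z" 1 "1/2"]) (use uan[of 1] in auto)
  \<comment> \<open>\<open>a z - a (\<iota> z)\<close> is \<open>eR - eL\<close> at \<open>z\<close>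
    minus \<open>eR - eL\<close> at \<open>\<iota> z\<close>, and near 1 the second term vanishes
    because \<open>\<iota> z\<close> is near -1. Along [-1, 1] \<open>a\<close> extends
    analytically, since \<iota> sends this interval to points where \<open>eL\<close> is regular,
    with 0 going to infinity.\<close>
  define a where "a = (\<lambda>z. eR z + eL (\<iota> z))"
  \<comment> \<open>As z tends to 0 its inversion tends to infinity, where \<open>eL\<close> decays;
    so the singularity is removable.\<close>
  have eL0: "ext_at (\<lambda>z. eL (\<iota> z)) 0"
  proof -
    have an: "(\<lambda>z. eL (\<iota> z)) analytic_on {z}" if "z \<noteq> 0" "norm z < 1/4" for z
    proof (rule analytic_at_compose[OF ian[OF that(1)] eL])
      have "norm (\<iota> z) > 4" using that unfolding inorm by (simp add: field_simps)
      then have "norm (\<iota> z - 1) > 3" using norm_triangle_ineq2[of "\<iota> z" 1] by simp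
      then have "\<bar>Re (\<iota> z - 1)\<bar> + \<bar>Im (\<iota> z - 1)\<bar> > 3" using cmod_le[of "\<iota> z - 1"] by linarith
      then show "\<bar>Im (\<iota> z - 1)\<bar> > \<eta> \<or> \<bar>Re (\<iota> z - 1)\<bar> > \<eta> \<or> Re (\<iota> z - 1) > - \<eta>" using \<eta> by linarith
    qed
    have "isolated_singularity_at (\<lambda>z. eL (\<iota> z)) 0"
      unfolding isolated_singularity_at_def
    proof (intro exI[of _ "1/4"] conjI)
      show "(\<lambda>z. eL (\<iota> z)) analytic_on ball 0 (1/4) - {0}"
        unfolding analytic_on_analytic_at[of _ "ball 0 (1/4) - {0}"] by (auto intro!: an)
    qed simp
    moreover have "((\<lambda>z. eL (\<iota> z)) \<longlongrightarrow> 0) (at 0)"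
    proof (rule filterlim_compose[OF eLlim])
      have "filterlim (\<lambda>z::complex. inverse (- z)) at_infinity (at 0)"
        by (rule filterlim_compose[OF filterlim_inverse_at_infinity]) (auto simp: filterlim_at eventually_at_filter intro!: tendsto_eq_intros)
      then show "filterlim \<iota> at_infinity (at 0)" by (simp add: \<iota>_def divide_inverse)
    qed
    ultimately have "(\<lambda>z. if z = 0 then 0 else eL (\<iota> z)) analytic_on {0}" by (rule removable_singularity')
    then show ?thesis by (rule ext_atI) (auto simp: eventually_at_filter)
  qed
  have aext: "ext_at a x" if x: "x \<in> \<real>" "norm x \<le> 1" for x
  proof -
    have im: "Im x = 0" using x by (simp add: complex_is_Real_iff)
    have re: "\<bar>Re x\<bar> \<le> 1" using x abs_Re_le_cmod[of x] by linarith
    have "eR analytic_on {x}" using im re \<eta> by (intro eR) auto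
    moreover have "ext_at (\<lambda>z. eL (\<iota> z)) x"
    proof (cases "x = 0")
      case False
      have r: "Re x \<noteq> 0" using False im by (simp add: complex_eq_iff)
      have "\<bar>Re (\<iota> x)\<bar> \<ge> 1" unfolding Re\<iota>[OF x(1)] using re r by (simp add: field_simps)
      then have "\<bar>Re (\<iota> x - 1)\<bar> > \<eta> \<or> Re (\<iota> x - 1) > - \<eta>" using \<eta> by auto
      then have "eL analytic_on {\<iota> x}" by (intro eL) auto
      from analytic_at_compose[OF ian[OF False] this] show ?thesis by (rule ext_at_analytic)
    qed (simp add: eL0)
    ultimately show ?thesis unfolding a_def by (intro ext_at_add ext_at_analytic[of eR])
  qed
  define k where "k = (\<lambda>z. h1 z - a z)"
  have K1: "\<forall>\<^sub>F z in at_nonreal 1. k z = k (\<iota> z)"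
  proof -
    have "\<forall>\<^sub>F z in nhds (1::complex). z \<in> box (1 - Complex \<eta> \<eta>) (1 + Complex \<eta> \<eta>)"
      using \<eta> by (intro eventually_nhds_in_open) (auto simp: in_box_complex_iff)
    then have "\<forall>\<^sub>F z in at_nonreal (1::complex). z \<in> box (1 - Complex \<eta> \<eta>) (1 + Complex \<eta> \<eta>)"
      by (simp add: eventually_at_filter eventually_mono)
    moreover have "\<forall>\<^sub>F z in at_nonreal 1. Re (- \<iota> z) > 0"
    proof (rule eventually_Re_pos)
      show "(\<lambda>z. - \<iota> z) analytic_on {1}" by (intro analytic_on_neg ian) simp
    qed (simp add: \<iota>_def)
    moreover have "\<forall>\<^sub>F z in at_nonreal 1. h1 z - h1 (\<iota> z) = cfac \<nu> z * \<psi> z" by (rule U) auto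
    ultimately show ?thesis
    proof eventually_elim
      case (elim z)
      have "eR z - eL z = cfac \<nu> z * \<psi> z" using elim(1) by (intro jump) (auto simp: in_box_complex_iff)
      moreover have "eR (\<iota> z) = eL (\<iota> z)" using elim(2) \<eta> by (intro out) auto
      moreover have "h1 z - h1 (\<iota> z) = cfac \<nu> z * \<psi> z" using elim(3) by simp
      ultimately have "h1 z - h1 (\<iota> z) = a z - a (\<iota> z)" by (simp add: a_def ii)
      then show ?case unfolding k_def by algebra
    qed
  qed
  have K2: "\<forall>\<^sub>F z in at_nonreal (-1). k z = k (\<iota> z)"
  proof -
    have "\<forall>\<^sub>F z in at_nonreal (-1). k (\<iota> z) = k (\<iota> (\<iota> z))"
      by (rule eventually_compose_filterlim[OF K1]) (use ilim[of "-1"] in \<open>auto simp: \<iota>_def\<close>)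
    then show ?thesis unfolding ii by eventually_elim simp
  qed
  have K: "\<forall>\<^sub>F z in at_nonreal x. k z = k (\<iota> z)" if "x \<in> \<real>" "norm x = 1" for x
  proof -
    obtain t where t: "x = of_real t" using \<open>x \<in> \<real>\<close> by (auto elim: Reals_cases)
    then have "t = 1 \<or> t = -1" using \<open>norm x = 1\<close> by auto
    then have "x = 1 \<or> x = -1" using t by auto
    then show ?thesis using K1 K2 by auto
  qed
  \<comment> \<open>The unit circle is only a dividing line. It meets the real line at 1 and -1,
    where both definitions agree by \<open>K\<close>; as the outer one is the inversion of the inner
    one, invariance under \<open>mS\<close> is built in.\<close>
  define h where "h = (\<lambda>z. if norm z < 1 then k z else k (\<iota> z))"
  have ev_less: "\<forall>\<^sub>F z in at_nonreal x. norm z < 1" if "norm x < 1" for x :: complex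
    using order_tendstoD(2)[OF tendsto_norm[OF tendsto_ident_at[of x "-\<real>"]] that] .
  have ev_gt: "\<forall>\<^sub>F z in at_nonreal x. norm z > 1" if "norm x > 1" for x :: complex
    using order_tendstoD(1)[OF tendsto_norm[OF tendsto_ident_at[of x "-\<real>"]] that] .
  have H1: "\<forall>\<^sub>F z in at_nonreal x. h z = k z" if x: "x \<in> \<real>" "norm x \<le> 1" for x
  proof (cases "norm x = 1")
    case True
    show ?thesis using K[OF x(1) True] by eventually_elim (simp add: h_def)
  next
    case False
    then have "norm x < 1" using x by simp
    from ev_less[OF this] show ?thesis by eventually_elim (simp add: h_def)
  qed
  have H2: "\<forall>\<^sub>F z in at_nonreal x. h z = k (\<iota> z)" if x: "x \<in> \<real>" "norm x \<ge> 1" for x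
  proof (cases "norm x = 1")
    case True
    show ?thesis using K[OF x(1) True] by eventually_elim (simp add: h_def)
  next
    case False
    then have "norm x > 1" using x by simp
    from ev_gt[OF this] show ?thesis by eventually_elim (simp add: h_def)
  qed
  have fnear: "hol_near f x" for x
    unfolding hol_near_def using eventually_nonreal[of x]
    by eventually_elim (simp add: f_def periodic_part_analytic[OF nu psi])
  have knear: "hol_near k x" if x: "x \<in> \<real>" "norm x \<le> 1" for x
    unfolding k_def h1_def
    by (rule hol_near_diff[OF hol_near_mult[OF hol_near_analytic[OF cfac_analytic(1)[OF x(1)]] fnear]
          ext_at_imp_hol_near[OF aext[OF x] x(1)]])
  have inv_real: "norm (\<iota> x) \<le> 1" "x \<noteq> 0" if "norm x \<ge> 1" for x
    using that unfolding inorm by (auto simp: divide_le_eq_1)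
  have near0: "\<forall>\<^sub>F w in at_nonreal (0::complex). w \<noteq> 0 \<and> norm w < 1"
  proof -
    have "norm (0::complex) < 1" by simp
    from ev_less[OF this] eventually_nonreal show ?thesis by eventually_elim auto
  qed
  have hinf: "h (1 / w) = k (- w)" if "w \<noteq> 0" "norm w < 1" for w
  proof -
    have "norm (1 / w) > 1" using that by (simp add: norm_divide)
    then show ?thesis by (simp add: h_def \<iota>_def)
  qed
  have rep: "hf_rep h"
    unfolding hf_rep_iff
  proof (intro conjI ballI)
    fix x :: complex assume x: "x \<in> \<real>"
    show "hol_near h x"
    proof (cases "norm x \<le> 1")
      case True
      have "\<forall>\<^sub>F z in at_nonreal x. k z = h z" using H1[OF x True] by eventually_elim simp
      from hol_near_cong[OF x this knear[OF x True]] show ?thesis .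
    next
      case False
      then have nx: "norm x \<ge> 1" by simp
      have "hol_near (\<lambda>z. k (\<iota> z)) x"
        by (rule hol_near_compose[OF knear[OF ir[OF x] inv_real(1)[OF nx]] ian[OF inv_real(2)[OF nx]] x ir[OF x] inr])
      moreover have "\<forall>\<^sub>F z in at_nonreal x. k (\<iota> z) = h z" using H2[OF x nx] by eventually_elim simp
      ultimately show ?thesis by (rule hol_near_cong[OF x, rotated])
    qed
  next
    have k0: "hol_near k (- 0)" using knear[of 0] by simp
    have "hol_near (\<lambda>w. k (- w)) 0"
      by (rule hol_near_compose[of k uminus, OF k0]) (auto intro!: analytic_intros)
    moreover have "\<forall>\<^sub>F w in at_nonreal 0. k (- w) = h (1 / w)"
      using near0 by eventually_elim (simp add: hinf)
    ultimately show "hol_near (\<lambda>w. h (1 / w)) 0" by (rule hol_near_cong[OF Reals_0, rotated])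
  qed
  have hS: "h (\<iota> z) = h z" if "norm z < 1" "z \<noteq> 0" for z
  proof -
    have "norm (\<iota> z) > 1" unfolding inorm using that by simp
    then show ?thesis using that by (simp add: h_def ii)
  qed
  have invS: "hf_equiv (pi_rep \<nu> mS h) h"
  proof (rule hf_equiv_eventually[OF rep])
    fix x :: complex assume x: "x \<in> \<real>"
    have "\<forall>\<^sub>F z in at_nonreal x. h (\<iota> z) = h z"
    proof (cases "norm x < 1")
      case True
      show ?thesis using ev_less[OF True] eventually_nonreal by eventually_elim (rule hS, auto)
    next
      case False
      then have nx: "norm x \<ge> 1" by simp
      have "\<forall>\<^sub>F z in at_nonreal x. h (\<iota> z) = k (\<iota> z)"
        by (rule eventually_compose_filterlim[OF H1[OF ir[OF x] inv_real(1)[OF nx]] ilim[OF x inv_real(2)[OF nx]]])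
      with H2[OF x nx] show ?thesis by eventually_elim simp
    qed
    with eventually_one_plus_square(1)[OF x]
    show "\<forall>\<^sub>F z in at_nonreal x. pi_rep \<nu> mS h z = h z"
      by eventually_elim (simp add: pi_rep_mS \<iota>_def)
  next
    show "\<forall>\<^sub>F w in at_nonreal 0. pi_rep \<nu> mS h (1 / w) = h (1 / w)"
      using eventually_one_plus_square(2) near0
    proof eventually_elim
      case (elim w)
      have "pi_rep \<nu> mS h (1 / w) = h (- w)" using pi_rep_mS[OF elim(1)] by simp
      also have "\<dots> = k (- w)" using elim(2) by (simp add: h_def)
      finally show ?case using hinf elim(2) by simp
    qed
  qed
  \<comment> \<open>Used beyond [-1, 1], where h is built from \<open>h1 (\<iota> z)\<close> instead
    of \<open>h1 z\<close>. For negative \<open>x\<close> the inversion moves the point to the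
    positive axis.\<close>
  have swap: "ext_at (\<lambda>z. h1 (\<iota> z) - h1 z) x" if x: "x \<in> \<real>" "x \<noteq> 0" for x
  proof (cases "Re x > 0")
    case True
    have "ext_at (\<lambda>z. - (cfac \<nu> z * \<psi> z)) x"
      by (rule ext_at_minus[OF ext_at_analytic[OF uan[OF x(1) True]]])
    moreover have "\<forall>\<^sub>F z in at_nonreal x. - (cfac \<nu> z * \<psi> z) = h1 (\<iota> z) - h1 z"
      using U[OF x(1) True] by eventually_elim (simp add: algebra_simps)
    ultimately show ?thesis by (rule ext_at_transfer)
  next
    case False
    then have "Re x < 0" using x by (auto simp: complex_is_Real_iff complex_eq_iff)
    then have pos: "Re (\<iota> x) > 0" unfolding Re\<iota>[OF x(1)] by (simp add: field_simps)
    have "ext_at (\<lambda>z. h1 z - h1 (\<iota> z)) (\<iota> x)"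
    proof (rule ext_at_transfer)
      show "ext_at (\<lambda>z. cfac \<nu> z * \<psi> z) (\<iota> x)"
        by (rule ext_at_analytic[OF uan[OF ir[OF x(1)] pos]])
      show "\<forall>\<^sub>F z in at_nonreal (\<iota> x). cfac \<nu> z * \<psi> z = h1 z - h1 (\<iota> z)"
        using U[OF ir[OF x(1)] pos] by eventually_elim simp
    qed
    from ext_at_compose[OF this ian[OF x(2)] x(1) ir[OF x(1)] inr] show ?thesis by (simp add: ii)
  qed
  \<comment> \<open>The corrections are invisible to the hyperfunction on the finite line: there
    translation invariance and \<open>represents\<close> are inherited from
    \<open>h1\<close>.\<close>
  have H3: "ext_at (\<lambda>z. h z - h1 z) x" if x: "x \<in> \<real>" for x
  proof (cases "norm x \<le> 1")
    case True
    have "\<forall>\<^sub>F z in at_nonreal x. - a z = h z - h1 z" using H1[OF x True] by eventually_elim (simp add: k_def)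
    then show ?thesis by (rule ext_at_transfer[OF ext_at_minus[OF aext[OF x True]]])
  next
    case False
    then have nx: "norm x \<ge> 1" by simp
    note x0 = inv_real(2)[OF nx]
    have "ext_at (\<lambda>z. a (\<iota> z)) x"
      by (rule ext_at_compose[OF aext[OF ir[OF x] inv_real(1)[OF nx]] ian[OF x0] x ir[OF x] inr])
    from ext_at_diff[OF swap[OF x x0] this]
    have "ext_at (\<lambda>z. h1 (\<iota> z) - h1 z - a (\<iota> z)) x" .
    moreover have "\<forall>\<^sub>F z in at_nonreal x. h1 (\<iota> z) - h1 z - a (\<iota> z) = h z - h1 z"
      using H2[OF x nx] by eventually_elim (simp add: k_def)
    ultimately show ?thesis by (rule ext_at_transfer)
  qed
  have fs: "f (z - 1) = f z" if "z \<notin> \<real>" for z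
    using periodic_part_shift[OF psi, of "z - 1"] that by (simp add: f_def complex_is_Real_iff)
  have invT: "hf_equiv (pi_rep \<nu> (mT 1) h) h"
  proof (rule hf_equiv_rep[OF rep])
    fix x :: complex assume x: "x \<in> \<real>"
    let ?J = "\<lambda>z. ((1 + z\<^sup>2) / (1 + (z - 1)\<^sup>2)) powr ((1 + \<nu>) / 2)"
    have Jan: "?J analytic_on {x}"
      using analytic_powr_pos[OF jfac_analytic(1,2)[OF mS_mT_PSL2R(2) x], of 1 "(1 + \<nu>) / 2"] by (simp add: mT_def)
    have "ext_at (\<lambda>z. h (z - 1) - h1 (z - 1)) x"
      by (rule ext_at_compose[of "\<lambda>z. h z - h1 z" "\<lambda>z. z - 1", OF H3])
        (use x in \<open>auto intro!: analytic_intros simp: complex_is_Real_iff\<close>)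
    from ext_at_diff[OF ext_at_mult[OF ext_at_analytic[OF Jan] this] H3[OF x]]
    have "ext_at (\<lambda>z. ?J z * (h (z - 1) - h1 (z - 1)) - (h z - h1 z)) x" .
    moreover have "\<forall>\<^sub>F z in at_nonreal x. ?J z * (h (z - 1) - h1 (z - 1)) - (h z - h1 z) = pi_rep \<nu> (mT 1) h z - h z"
      using cfac_shift[OF x, of \<nu>] eventually_nonreal
    proof eventually_elim
      case (elim z)
      have "?J z * h1 (z - 1) = (?J z * cfac \<nu> (z - 1)) * f z" unfolding h1_def fs[OF elim(2)] by (simp only: mult.assoc)
      also have "\<dots> = h1 z" using elim(1) by (simp add: h1_def)
      finally have "?J z * h1 (z - 1) = h1 z" .
      moreover have "pi_rep \<nu> (mT 1) h z = ?J z * h (z - 1)" by (simp add: pi_rep_mT)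
      ultimately show ?case by (simp only: right_diff_distrib) simp
    qed
    ultimately show "ext_at (\<lambda>z. pi_rep \<nu> (mT 1) h z - h z) x" by (rule ext_at_transfer)
  next
    \<comment> \<open>Infinity is studied at 0 in the variable v = -w, where the translation is
      \<open>?t\<close>; the symmetry of h under \<iota> justifies the change of variable.\<close>
    let ?J = "\<lambda>v. ((v\<^sup>2 + 1) / (v\<^sup>2 + (1 + v)\<^sup>2)) powr ((1 + \<nu>) / 2)"
    let ?t = "\<lambda>v::complex. v / (1 + v)"
    have Jan: "?J analytic_on {0}" by (rule analytic_powr_pos) (auto intro!: analytic_intros)
    have tan: "?t analytic_on {0}" by (auto intro!: analytic_intros)
    have tnr: "?t v \<notin> \<real>" if "v \<notin> \<real>" for v
    proof
      assume "?t v \<in> \<real>"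
      moreover have "1 + v \<noteq> 0" "v \<noteq> 0" using that by (auto simp: complex_is_Real_iff complex_eq_iff)
      then have "1 / ?t v = 1 / v + 1" by (simp add: field_simps)
      ultimately have "1 / v + 1 \<in> \<real>" by (metis nonreal_divide)
      then have "1 / v \<in> \<real>" by (metis Reals_1 Reals_diff add_diff_cancel_right')
      then show False using that by simp
    qed
    have e0: "ext_at (\<lambda>z. h z - h1 z) (?t 0)" using H3[of 0] by simp
    have "ext_at (\<lambda>v. h (?t v) - h1 (?t v)) 0"
      by (rule ext_at_compose[of "\<lambda>z. h z - h1 z" ?t, OF e0 tan _ _ tnr]) auto
    \<comment> \<open>This is the defect of \<open>h1\<close> under the parabolic map;
      \<open>v + 1\<close> is near 1, inside the slit plane.\<close>
    moreover have "ext_at (\<lambda>v. cfac \<nu> v * \<psi> (v + 1)) 0"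
    proof (rule ext_at_analytic[OF analytic_on_mult[OF cfac_analytic(1)[OF Reals_0]]])
      show "(\<lambda>v. \<psi> (v + 1)) analytic_on {0}"
        by (rule analytic_at_compose[of "\<lambda>v. v + 1" 0 \<psi>, OF _ Psi_mod_analytic[OF psi]]) (auto intro!: analytic_intros simp: slit_iff)
    qed
    ultimately have "ext_at (\<lambda>v. ?J v * (h (?t v) - h1 (?t v)) - (h v - h1 v) - cfac \<nu> v * \<psi> (v + 1)) 0"
      by (rule ext_at_diff[OF ext_at_diff[OF ext_at_mult[OF ext_at_analytic[OF Jan]] H3[OF Reals_0]]])
    moreover have "\<forall>\<^sub>F v in at_nonreal 0. ?J v * (h (?t v) - h1 (?t v)) - (h v - h1 v) - cfac \<nu> v * \<psi> (v + 1) = ?J v * h (?t v) - h v"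
      using cfac_at_zero[of \<nu>] eventually_nonreal
    proof eventually_elim
      case (elim v)
      have "?J v * h1 (?t v) = (?J v * cfac \<nu> (?t v)) * f (?t v)" unfolding h1_def by (simp only: mult.assoc)
      also have "\<dots> = cfac \<nu> v * ((1 + v) powr (-1 - \<nu>) * f (?t v))" unfolding elim(1) by (simp only: mult.assoc)
      finally have "h1 v - ?J v * h1 (?t v) = cfac \<nu> v * (f v - (1 + v) powr (-1 - \<nu>) * f (?t v))"
        by (simp only: h1_def right_diff_distrib)
      also have "\<dots> = cfac \<nu> v * \<psi> (v + 1)" using periodic_part_parabolic[OF nu psi elim(2)] by (simp only: f_def)
      finally have "h1 v - ?J v * h1 (?t v) = cfac \<nu> v * \<psi> (v + 1)" .
      then show ?case unfolding right_diff_distrib by algebra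
    qed
    ultimately have th: "ext_at (\<lambda>v. ?J v * h (?t v) - h v) 0" by (rule ext_at_transfer)
    have "ext_at (\<lambda>w. ?J (- w) * h (?t (- w)) - h (- w)) 0"
      by (rule ext_at_compose[of "\<lambda>v. ?J v * h (?t v) - h v" uminus, unfolded minus_zero, OF _ _ Reals_0], simp, rule th)
        (auto intro!: analytic_intros)
    moreover have "\<forall>\<^sub>F w in at_nonreal 0. ?J (- w) * h (?t (- w)) - h (- w) = pi_rep \<nu> (mT 1) h (1 / w) - h (1 / w)"
    proof -
      have "(\<lambda>w. ?t (- w)) analytic_on {0}" by (auto intro!: analytic_intros)
      then have "((\<lambda>w. norm (?t (- w))) \<longlongrightarrow> norm (?t (- 0))) (at_nonreal 0)"
        by (rule tendsto_norm[OF tendsto_within_subset[OF analytic_at_imp_isCont[unfolded isCont_def] subset_UNIV]])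
      then have "\<forall>\<^sub>F w in at_nonreal 0. norm (?t (- w)) < 1"
        by (rule order_tendstoD(2)) simp
      with near0 eventually_nonreal show ?thesis
      proof eventually_elim
        case (elim w)
        have w: "w \<noteq> 0" "norm w < 1" using elim(1) by auto
        have tw: "?t (- w) \<noteq> 0" using tnr[of "- w"] elim(2) by auto
        then have w1: "1 - w \<noteq> 0" by auto
        \<comment> \<open>1/w - 1 is the inversion of \<open>?t (- w)\<close>, and h takes the same
          value at both.\<close>
        have "1 / w - 1 = \<iota> (?t (- w))" using w w1 by (simp add: \<iota>_def field_simps)
        then have "h (1 / w - 1) = h (?t (- w))" using hS[OF elim(3) tw] by simp
        moreover have "h (1 / w) = h (- w)" using hinf[OF w] w by (simp add: h_def)
        moreover have "(1 + (1 / w)\<^sup>2) / (1 + (1 / w - 1)\<^sup>2) = ((- w)\<^sup>2 + 1) / ((- w)\<^sup>2 + (1 + - w)\<^sup>2)"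
          using w by (simp add: divide_simps power2_eq_square)
        ultimately show ?case by (simp only: pi_rep_mT of_real_1)
      qed
    qed
    ultimately show "ext_at (\<lambda>w. pi_rep \<nu> (mT 1) h (1 / w) - h (1 / w)) 0" by (rule ext_at_transfer)
  qed
  have "represents \<nu> h \<psi>"
    unfolding represents_def
  proof
    fix x :: complex assume x: "x \<in> \<real>"
    have "\<forall>\<^sub>F z in at_nonreal x. (h z - h1 z) * inverse (cfac \<nu> z) = h z / cfac \<nu> z - periodic_part \<nu> \<psi> z"
      using eventually_one_plus_square(1)[OF x]
    proof eventually_elim
      case (elim z)
      show ?case using cfac_nonzero[OF elim, of \<nu>] by (simp add: h1_def f_def field_simps)
    qed
    then show "ext_at (\<lambda>z. h z / cfac \<nu> z - periodic_part \<nu> \<psi> z) x"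
      by (rule ext_at_transfer[OF ext_at_mult[OF H3[OF x] ext_at_analytic[OF cfac_analytic(2)[OF x]]]])
  qed
  with rep invS invT show ?thesis by (rule that)
qed

section \<open>The period map\<close>

definition period_map :: "complex \<Rightarrow> (complex \<Rightarrow> complex) set \<Rightarrow> complex \<Rightarrow> complex" where
  "period_map \<nu> \<alpha> = (THE \<psi>. \<psi> \<in> Psi_mod \<nu> \<and> (\<exists>h\<in>\<alpha>. represents \<nu> h \<psi>))"

text \<open>\<open>represents_unique\<close> makes the description in \<open>period_map\<close>
  unambiguous. Linearity and surjectivity both reduce to this: a period function represented by
  every member of the class is the value of the map.\<close>

lemma period_map_eq:
  assumes "\<forall>k::int. \<nu> \<noteq> 1 + 2 * of_int k" "\<psi> \<in> Psi_mod \<nu>" "h \<in> \<alpha>" "\<And>h. h \<in> \<alpha> \<Longrightarrow> represents \<nu> h \<psi>"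
  shows "period_map \<nu> \<alpha> = \<psi>"
  unfolding period_map_def
  by (rule the_equality) (use assms represents_unique[OF assms(1)] in blast)+

lemma hf_class_eq: "hf_equiv h1 h2 \<Longrightarrow> hf_class h1 = hf_class h2"
  unfolding hf_class_def using hf_equiv_trans hf_equiv_sym by blast

theorem theorem5p11:
  fixes \<nu> :: complex
  assumes "\<forall>k::int. \<nu> \<noteq> 1 + 2 * of_int k"
  shows "\<exists>\<Phi>. bij_betw \<Phi> (automorphic \<nu> PSL2Z) (Psi_mod \<nu>) \<and>
    (\<forall>\<alpha>\<in>automorphic \<nu> PSL2Z. \<forall>\<beta>\<in>automorphic \<nu> PSL2Z.
        \<Phi> (hf_add \<alpha> \<beta>) = (\<lambda>z. \<Phi> \<alpha> z + \<Phi> \<beta> z)) \<and>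
    (\<forall>c. \<forall>\<alpha>\<in>automorphic \<nu> PSL2Z. \<Phi> (hf_scale c \<alpha>) = (\<lambda>z. c * \<Phi> \<alpha> z))"
proof (intro exI[of _ "period_map \<nu>"] conjI ballI allI)
  let ?\<Phi> = "period_map \<nu>" and ?A = "automorphic \<nu> PSL2Z"
  \<comment> \<open>\<open>represents\<close> passes to every member of the class, so the value of
    the map may be tested on whichever representative is convenient.\<close>
  have char: "\<exists>h. h \<in> \<alpha> \<and> hf_rep h \<and> \<alpha> = hf_class h \<and> hf_equiv (pi_rep \<nu> mS h) h \<and>
      ?\<Phi> \<alpha> \<in> Psi_mod \<nu> \<and> (\<forall>h\<in>\<alpha>. represents \<nu> h (?\<Phi> \<alpha>) \<and> hf_rep h)" if alpha: "\<alpha> \<in> ?A" for \<alpha>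
  proof -
    obtain h where h: "hf_rep h" "\<alpha> = hf_class h" "hf_equiv (pi_rep \<nu> mS h) h" "hf_equiv (pi_rep \<nu> (mT 1) h) h"
      using automorphicD[OF alpha] .
    obtain \<psi> where psi: "\<psi> \<in> Psi_mod \<nu>" "represents \<nu> h \<psi>"
      using automorphic_imp_Psi_mod[OF assms h(1,3,4)] .
    have mem: "h \<in> \<alpha>" using h by (simp add: mem_hf_class hf_equiv_refl)
    have all: "represents \<nu> h' \<psi>" "hf_rep h'" if "h' \<in> \<alpha>" for h'
    proof -
      have "hf_equiv h h'" using that by (simp add: h(2) mem_hf_class)
      then show "represents \<nu> h' \<psi>" "hf_rep h'" using represents_cong psi(2) by (auto simp: hf_equiv_iff)
    qed
    have "?\<Phi> \<alpha> = \<psi>" using period_map_eq[OF assms psi(1) mem all(1)] .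
    then show ?thesis using h mem all psi by auto
  qed
  show "bij_betw ?\<Phi> ?A (Psi_mod \<nu>)"
  proof (rule bij_betw_imageI)
    show "inj_on ?\<Phi> ?A"
    proof (rule inj_onI)
      fix \<alpha> \<beta> assume ab: "\<alpha> \<in> ?A" "\<beta> \<in> ?A" "?\<Phi> \<alpha> = ?\<Phi> \<beta>"
      obtain h1 where 1: "h1 \<in> \<alpha>" "hf_rep h1" "\<alpha> = hf_class h1" "hf_equiv (pi_rep \<nu> mS h1) h1" "represents \<nu> h1 (?\<Phi> \<alpha>)"
        using char[OF ab(1)] by blast
      obtain h2 where 2: "h2 \<in> \<beta>" "hf_rep h2" "\<beta> = hf_class h2" "hf_equiv (pi_rep \<nu> mS h2) h2" "represents \<nu> h2 (?\<Phi> \<beta>)"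
        using char[OF ab(2)] by blast
      have "hf_equiv h1 h2"
        using represents_injective[OF 1(2) 2(2) 1(5) _ 1(4) 2(4)] 2(5) ab(3) by simp
      then show "\<alpha> = \<beta>" unfolding 1(3) 2(3) by (rule hf_class_eq)
    qed
    show "?\<Phi> ` ?A = Psi_mod \<nu>"
    proof
      show "?\<Phi> ` ?A \<subseteq> Psi_mod \<nu>" using char by blast
      show "Psi_mod \<nu> \<subseteq> ?\<Phi> ` ?A"
      proof
        fix \<psi> assume psi: "\<psi> \<in> Psi_mod \<nu>"
        obtain h where h: "hf_rep h" "hf_equiv (pi_rep \<nu> mS h) h" "hf_equiv (pi_rep \<nu> (mT 1) h) h" "represents \<nu> h \<psi>"
          using Psi_mod_imp_automorphic[OF assms psi] .
        have "?\<Phi> (hf_class h) = \<psi>"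
          by (rule period_map_eq[OF assms psi, of h]) (use h represents_cong in \<open>auto simp: mem_hf_class hf_equiv_refl\<close>)
        then show "\<psi> \<in> ?\<Phi> ` ?A" using automorphic_classI[OF h(1-3)] by blast
      qed
    qed
  qed
  show "?\<Phi> (hf_add \<alpha> \<beta>) = (\<lambda>z. ?\<Phi> \<alpha> z + ?\<Phi> \<beta> z)" if ab: "\<alpha> \<in> ?A" "\<beta> \<in> ?A" for \<alpha> \<beta>
  proof -
    obtain h1 where 1: "h1 \<in> \<alpha>" "?\<Phi> \<alpha> \<in> Psi_mod \<nu>" "\<And>h. h \<in> \<alpha> \<Longrightarrow> represents \<nu> h (?\<Phi> \<alpha>)" "hf_rep h1"
      using char[OF ab(1)] by blast
    obtain h2 where 2: "h2 \<in> \<beta>" "?\<Phi> \<beta> \<in> Psi_mod \<nu>" "\<And>h. h \<in> \<beta> \<Longrightarrow> represents \<nu> h (?\<Phi> \<beta>)" "hf_rep h2"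
      using char[OF ab(2)] by blast
    \<comment> \<open>Membership of the sum in \<open>hf_add\<close> rests on reflexivity of
      \<open>hf_equiv\<close>, which holds for representatives only.\<close>
    have "hf_rep (\<lambda>z. h1 z + h2 z)" using 1(4) 2(4) by (simp add: hf_rep_iff hol_near_add)
    then have mem: "(\<lambda>z. h1 z + h2 z) \<in> hf_add \<alpha> \<beta>"
      using 1(1) 2(1) hf_equiv_refl unfolding hf_add_def by blast
    show ?thesis
    proof (rule period_map_eq[OF assms Psi_mod_add[OF 1(2) 2(2)] mem])
      fix h assume "h \<in> hf_add \<alpha> \<beta>"
      then obtain u v where "u \<in> \<alpha>" "v \<in> \<beta>" "hf_equiv (\<lambda>z. u z + v z) h" unfolding hf_add_def by blast
      then show "represents \<nu> h (\<lambda>z. ?\<Phi> \<alpha> z + ?\<Phi> \<beta> z)"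
        using represents_cong represents_add[OF 1(3) 2(3)] by blast
    qed
  qed
  show "?\<Phi> (hf_scale c \<alpha>) = (\<lambda>z. c * ?\<Phi> \<alpha> z)" if a: "\<alpha> \<in> ?A" for c \<alpha>
  proof -
    obtain h1 where 1: "h1 \<in> \<alpha>" "?\<Phi> \<alpha> \<in> Psi_mod \<nu>" "\<And>h. h \<in> \<alpha> \<Longrightarrow> represents \<nu> h (?\<Phi> \<alpha>)" "hf_rep h1"
      using char[OF a] by blast
    have c: "hol_near (\<lambda>_. c) x" for x by (rule hol_near_analytic) simp
    have "hf_rep (\<lambda>z. c * h1 z)" using 1(4) c by (simp add: hf_rep_iff hol_near_mult)
    then have mem: "(\<lambda>z. c * h1 z) \<in> hf_scale c \<alpha>"
      using 1(1) hf_equiv_refl unfolding hf_scale_def by blast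
    show ?thesis
    proof (rule period_map_eq[OF assms Psi_mod_scale[OF 1(2)] mem])
      fix h assume "h \<in> hf_scale c \<alpha>"
      then obtain u where "u \<in> \<alpha>" "hf_equiv (\<lambda>z. c * u z) h" unfolding hf_scale_def by blast
      then show "represents \<nu> h (\<lambda>z. c * ?\<Phi> \<alpha> z)"
        using represents_cong represents_scale[OF 1(3)] by blast
    qed
  qed
qed

end
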